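(* Let $V$ be an $m$-dimensional real normed space ($m\geqslant1$), let $G$ be a compact group of linear norm isometries of $V$, and choose an auxiliary Euclidean inner product on $V$ for which $G$ acts orthogonally. If $$\operatorname{End}(V)^G:=\{R\in\operatorname{End}(V):RQ=QR\text{ for every }Q\in G\}=\mathbb R I_V,$$ then the normalised Euclidean hypersurface measure $\mu_V$ on $S_V$ satisfies $$T_{\mu_V}:=m\int_{S_V}w\otimes w^\sharp\,\mathrm d\mu_V(w)=I_V.$$ In particular, let $X$ be an $N$-dimensional real normed space with a $1$-symmetric basis $e_1,\dots,e_N$, let $1\leqslant k\leqslant N$, equip $\Lambda^kX$ with the projective exterior norm, and let $\mu_{\Lambda^kX}$ be the normalised hypersurface measure on $S_{\Lambda^kX}$ formed from the Euclidean structure on $\Lambda^kX$ induced by declaring $e_1,\dots,e_N$ orthonormal (that is, for which the vectors $e_{i_1}\wedge\cdots\wedge e_{i_k}$, $i_1<\dots<i_k$, are orthonormal). Then for every $A\in\operatorname{End}(X)$, $$\operatorname{tr}(\Lambda^kA)=\binom Nk\int_{S_{\Lambda^kX}}w^\sharp\big((\Lambda^kA)w\big)\,\mathrm d\mu_{\Lambda^kX}(w).$$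
   Context: $S_V$ is the unit sphere of $V$ for its norm. Given an auxiliary Euclidean inner product on $V$, with Hausdorff measure $\mathcal H^{m-1}$, the normalised Euclidean hypersurface measure on $S_V$ is $$\mu_V=\frac{\mathcal H^{m-1}|_{S_V}}{\mathcal H^{m-1}(S_V)}.$$ A norming functional at $w\in S_V$ is a functional $w^\sharp\in V^*$ with dual norm $1$ and $w^\sharp(w)=1$; it is unique for $\mu_V$-almost every $w$. For $w\in V$, $f\in V^*$, $w\otimes f$ is the operator $z\mapsto f(z)w$. A basis $e_1,\dots,e_N$ of $X$ is $1$-symmetric if $\|\sum_i\varepsilon_ia_ie_{\sigma(i)}\|=\|\sum_ia_ie_i\|$ for all scalars $a_i$, all signs $\varepsilon_i\in\{-1,1\}$ and all permutations $\sigma$ of $\{1,\dots,N\}$. The projective exterior norm on $\Lambda^kX$ is $$\|w\|_{\wedge,\pi}=\inf\Big\{\sum_{r=1}^s\prod_{j=1}^k\|x_j^{(r)}\| : w=\sum_{r=1}^s x_1^{(r)}\wedge\cdots\wedge x_k^{(r)}\Big\}.$$ $\Lambda^kA$ is the operator on $\Lambda^kX$ with $(\Lambda^kA)(x_1\wedge\cdots\wedge x_k)=Ax_1\wedge\cdots\wedge Ax_k$. *)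

theory Defs
  imports "HOL-Analysis.Analysis"
begin

text \<open>
  The normalising factor makes \<open>\<H>\<^sup>s\<close> the usual \<open>s\<close>-dimensional surface measure.
  The empty set is singled out because \<open>0 ^ 0 = 1\<close> would give it weight 1 for \<open>s = 0\<close>,
  and boundedness is required in covers because the real-valued \<^const>\<open>diameter\<close> is meaningless
  for unbounded sets.
\<close>

definition hausdorff_gauge :: "nat \<Rightarrow> 'a::metric_space set \<Rightarrow> ennreal" where
  "hausdorff_gauge s U =
    (if U = {} then 0 else ennreal (unit_ball_vol (real s) * (diameter U / 2) ^ s))"

definition hausdorff_covers :: "real \<Rightarrow> 'a::metric_space set \<Rightarrow> (nat \<Rightarrow> 'a set) set" where
  "hausdorff_covers \<delta> A =
    {C. A \<subseteq> (\<Union>i. C i) \<and> (\<forall>i. bounded (C i) \<and> diameter (C i) \<le> \<delta>)}"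

definition hausdorff_pre :: "nat \<Rightarrow> real \<Rightarrow> 'a::metric_space set \<Rightarrow> ennreal" where
  "hausdorff_pre s \<delta> A = (INF C\<in>hausdorff_covers \<delta> A. \<Sum>i. hausdorff_gauge s (C i))"

definition hausdorff_outer :: "nat \<Rightarrow> 'a::metric_space set \<Rightarrow> ennreal" where
  "hausdorff_outer s A = (SUP \<delta>\<in>{0<..}. hausdorff_pre s \<delta> A)"

text \<open>
  The measure lives on all Caratheodory measurable sets and hence is complete.
\<close>

definition hausdorff_measure :: "nat \<Rightarrow> 'a::metric_space measure" where
  "hausdorff_measure s =
    measure_of UNIV (lambda_system UNIV UNIV (hausdorff_outer s)) (hausdorff_outer s)"

lemma hausdorff_pre_subadditive:
  fixes A :: "nat \<Rightarrow> 'a::metric_space set"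
  shows "hausdorff_pre s \<delta> (\<Union>i. A i) \<le> (\<Sum>i. hausdorff_pre s \<delta> (A i))"
proof (rule ennreal_le_epsilon)
  fix \<epsilon> :: real assume \<epsilon>: "\<epsilon> > 0"
    and fin: "(\<Sum>i. hausdorff_pre s \<delta> (A i)) < top"
  have "\<exists>C\<in>hausdorff_covers \<delta> (A i). (\<Sum>j. hausdorff_gauge s (C j))
          \<le> hausdorff_pre s \<delta> (A i) + ennreal (\<epsilon> * (1/2) ^ Suc i)" for i
  proof -
    have "hausdorff_pre s \<delta> (A i) < top"
      using fin ennreal_suminf_lessD by blast
    then have "hausdorff_pre s \<delta> (A i)
        < hausdorff_pre s \<delta> (A i) + ennreal (\<epsilon> * (1/2) ^ Suc i)"
      using \<epsilon> ennreal_add_left_cancel_less[of "hausdorff_pre s \<delta> (A i)" 0]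
      by (simp add: ennreal_less_zero_iff)
    then obtain C where "C \<in> hausdorff_covers \<delta> (A i)" "(\<Sum>j. hausdorff_gauge s (C j))
        < hausdorff_pre s \<delta> (A i) + ennreal (\<epsilon> * (1/2) ^ Suc i)"
      unfolding hausdorff_pre_def[of s \<delta> "A i"] INF_less_iff by blast
    then show ?thesis by (meson less_imp_le)
  qed
  then obtain C where C: "\<And>i. C i \<in> hausdorff_covers \<delta> (A i)"
    "\<And>i. (\<Sum>j. hausdorff_gauge s (C i j))
       \<le> hausdorff_pre s \<delta> (A i) + ennreal (\<epsilon> * (1/2) ^ Suc i)"
    by metis
  define D where "D n = (case prod_decode n of (i, j) \<Rightarrow> C i j)" for n
  have D: "D \<in> hausdorff_covers \<delta> (\<Union>i. A i)"
  proof -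
    have "A i \<subseteq> (\<Union>n. D n)" for i
    proof
      fix x assume "x \<in> A i"
      then obtain j where "x \<in> C i j"
        using C(1)[of i] by (auto simp: hausdorff_covers_def)
      then have "x \<in> D (prod_encode (i, j))"
        by (simp add: D_def)
      then show "x \<in> (\<Union>n. D n)" by blast
    qed
    then show ?thesis
      using C(1) by (auto simp: hausdorff_covers_def D_def split: prod.split)
  qed
  have sums: "(\<lambda>i. \<epsilon> * (1/2) ^ Suc i) sums \<epsilon>"
    using sums_mult[OF power_half_series, of \<epsilon>] by simp
  have "hausdorff_pre s \<delta> (\<Union>i. A i) \<le> (\<Sum>n. hausdorff_gauge s (D n))"
    unfolding hausdorff_pre_def by (rule INF_lower[OF D])
  also have "\<dots> = (\<Sum>i. \<Sum>j. hausdorff_gauge s (C i j))"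
    using suminf_ennreal_2dimen[of "\<lambda>i. \<Sum>j. hausdorff_gauge s (C i j)"
        "\<lambda>(i, j). hausdorff_gauge s (C i j)"]
    by (simp add: D_def comp_def case_prod_unfold)
  also have "\<dots> \<le> (\<Sum>i. hausdorff_pre s \<delta> (A i) + ennreal (\<epsilon> * (1/2) ^ Suc i))"
    by (intro suminf_le C) auto
  also have "\<dots> = (\<Sum>i. hausdorff_pre s \<delta> (A i)) + (\<Sum>i. ennreal (\<epsilon> * (1/2) ^ Suc i))"
    by (rule suminf_add[symmetric]) auto
  also have "(\<Sum>i. ennreal (\<epsilon> * (1/2) ^ Suc i)) = ennreal \<epsilon>"
    using sums \<epsilon> by (intro suminf_ennreal_eq) auto
  finally show "hausdorff_pre s \<delta> (\<Union>i. A i) \<le> (\<Sum>i. hausdorff_pre s \<delta> (A i)) + ennreal \<epsilon>" .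
qed

lemma outer_measure_space_hausdorff_outer:
  "outer_measure_space UNIV (hausdorff_outer s :: 'a::metric_space set \<Rightarrow> ennreal)"
proof -
  have "hausdorff_pre s \<delta> ({} :: 'a set) = 0" if "\<delta> > 0" for \<delta>
  proof -
    have "(\<lambda>_. {}) \<in> hausdorff_covers \<delta> ({} :: 'a set)"
      using that by (simp add: hausdorff_covers_def)
    then have "hausdorff_pre s \<delta> ({} :: 'a set) \<le> (\<Sum>i::nat. hausdorff_gauge s ({} :: 'a set))"
      unfolding hausdorff_pre_def by (rule INF_lower)
    then show ?thesis by (simp add: hausdorff_gauge_def)
  qed
  then have 1: "hausdorff_outer s ({} :: 'a set) = 0"
    unfolding hausdorff_outer_def by (auto intro!: antisym SUP_least)
  have 2: "hausdorff_outer s A \<le> hausdorff_outer s B" if "A \<subseteq> B" for A B :: "'a set"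
    unfolding hausdorff_outer_def hausdorff_pre_def
    using that by (intro SUP_mono' INF_superset_mono) (auto simp: hausdorff_covers_def)
  have 3: "hausdorff_outer s (\<Union>i. A i) \<le> (\<Sum>i. hausdorff_outer s (A i))"
    for A :: "nat \<Rightarrow> 'a set"
    unfolding hausdorff_outer_def[of _ "\<Union>i. A i"]
  proof (rule SUP_least)
    fix \<delta> :: real assume "\<delta> \<in> {0<..}"
    then have "(\<Sum>i. hausdorff_pre s \<delta> (A i)) \<le> (\<Sum>i. hausdorff_outer s (A i))"
      unfolding hausdorff_outer_def by (intro suminf_le SUP_upper) auto
    with hausdorff_pre_subadditive[of s \<delta> A]
    show "hausdorff_pre s \<delta> (\<Union>i. A i) \<le> (\<Sum>i. hausdorff_outer s (A i))"
      by (rule order_trans)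
  qed
  show ?thesis
    unfolding outer_measure_space_def positive_def increasing_def countably_subadditive_def
    using 1 2 3 by auto
qed

lemma
  shows sets_hausdorff_measure:
      "sets (hausdorff_measure s :: 'a::metric_space measure) = lambda_system UNIV UNIV (hausdorff_outer s)"
    and emeasure_hausdorff_measure:
      "(A :: 'a set) \<in> sets (hausdorff_measure s) \<Longrightarrow> emeasure (hausdorff_measure s) A = hausdorff_outer s A"
proof -
  interpret sigma_algebra UNIV "UNIV :: 'a set set"
    using sigma_algebra_Pow[of "UNIV :: 'a set"] by simp
  have M: "measure_space UNIV (lambda_system UNIV UNIV (hausdorff_outer s))
      (hausdorff_outer s :: 'a set \<Rightarrow> ennreal)"
    by (rule caratheodory_lemma[OF outer_measure_space_hausdorff_outer])
  then have S: "sigma_algebra UNIV (lambda_system UNIV UNIV (hausdorff_outer s :: 'a set \<Rightarrow> ennreal))"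
    by (simp add: measure_space_def)
  then show *: "sets (hausdorff_measure s :: 'a::metric_space measure) = lambda_system UNIV UNIV (hausdorff_outer s)"
    unfolding hausdorff_measure_def
    by (simp add: sets_measure_of_eq sigma_algebra.sigma_sets_eq)
  show "emeasure (hausdorff_measure s) A = hausdorff_outer s A"
    if "A \<in> sets (hausdorff_measure s)"
    using that M S unfolding * unfolding hausdorff_measure_def
    by (intro emeasure_measure_of_sigma) (auto simp: measure_space_def)
qed

text \<open>
  A finite-dimensional normed space together with an auxiliary inner product is modelled by
  a \<^class>\<open>euclidean_space\<close> type, whose class operations supply the auxiliary inner product
  and its metric, and a further function \<open>p\<close>, which is the norm of the space.
\<close>

definition is_norm :: "('v::real_vector \<Rightarrow> real) \<Rightarrow> bool" where
  "is_norm p \<longleftrightarrow>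
    (\<forall>x. p x = 0 \<longleftrightarrow> x = 0) \<and> (\<forall>x y. p (x + y) \<le> p x + p y) \<and>
    (\<forall>a x. p (a *\<^sub>R x) = \<bar>a\<bar> * p x)"

definition unit_sphere :: "('v \<Rightarrow> real) \<Rightarrow> 'v set" where
  "unit_sphere p = {w. p w = 1}"

definition hypersurface_measure :: "('v::euclidean_space \<Rightarrow> real) \<Rightarrow> 'v measure" where
  "hypersurface_measure p =
    (let H = hausdorff_measure (DIM('v) - 1); S = unit_sphere p
     in scale_measure (1 / emeasure H S) (restrict_space H S))"

definition dual_norm :: "('v::euclidean_space \<Rightarrow> real) \<Rightarrow> ('v \<Rightarrow>\<^sub>L real) \<Rightarrow> real" where
  "dual_norm p f = (SUP x\<in>{x. p x \<le> 1}. \<bar>blinfun_apply f x\<bar>)"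

definition norming_functional ::
    "('v::euclidean_space \<Rightarrow> real) \<Rightarrow> 'v \<Rightarrow> ('v \<Rightarrow>\<^sub>L real) \<Rightarrow> bool" where
  "norming_functional p w f \<longleftrightarrow> dual_norm p f = 1 \<and> blinfun_apply f w = 1"

lift_definition rank_one :: "'v::real_normed_vector \<Rightarrow> ('v \<Rightarrow>\<^sub>L real) \<Rightarrow> 'v \<Rightarrow>\<^sub>L 'v"
  is "\<lambda>w f z. f z *\<^sub>R w"
  by (rule bounded_linear_scaleR_const)

text \<open>Needed to form Bochner integrals with values in \<open>End(V)\<close>.\<close>

instance blinfun :: (euclidean_space, euclidean_space) second_countable_topology
proof
  define r where "r k = 1 / real (Suc k)" for k
  have "\<exists>K. finite K \<and> cball (0 :: 'a \<Rightarrow>\<^sub>L 'b) (real n) \<subseteq> (\<Union>x\<in>K. ball x (r k))"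
    for n k
  proof -
    have "compact (cball (0 :: 'a \<Rightarrow>\<^sub>L 'b) (real n))" by simp
    moreover have "r k > 0" by (simp add: r_def)
    ultimately show ?thesis
      unfolding compact_eq_totally_bounded by blast
  qed
  then obtain K where K: "\<And>n k. finite (K n k)"
    "\<And>n k. cball (0 :: 'a \<Rightarrow>\<^sub>L 'b) (real n) \<subseteq> (\<Union>x\<in>K n k. ball x (r k))"
    by metis
  define B where "B = (\<Union>n k. (\<lambda>x. ball x (r k)) ` K n k)"
  have "countable B"
    unfolding B_def using K(1) by (intro countable_UN countable_image) (auto intro: countable_finite)
  moreover have "topological_basis B"
  proof (rule topological_basisI)
    fix U and x :: "'a \<Rightarrow>\<^sub>L 'b" assume "open U" "x \<in> U"
    then obtain e where e: "e > 0" "ball x e \<subseteq> U"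
      using openE by blast
    obtain k where k: "r k < e / 2"
      using nat_approx_posE[of "e / 2"] e(1) unfolding r_def by auto
    obtain n where n: "x \<in> cball 0 (real n)"
      using real_arch_simple[of "norm x"] by auto
    obtain y where y: "y \<in> K n k" "x \<in> ball y (r k)"
      using K(2)[of n k] n by auto
    have "ball y (r k) \<subseteq> ball x e"
    proof
      fix z assume "z \<in> ball y (r k)"
      then show "z \<in> ball x e"
        using y(2) k dist_triangle[of x z y] by (auto simp: dist_commute)
    qed
    with e y show "\<exists>B'\<in>B. x \<in> B' \<and> B' \<subseteq> U"
      unfolding B_def by blast
  qed (auto simp: B_def)
  ultimately show "\<exists>B::('a \<Rightarrow>\<^sub>L 'b) set set. countable B \<and> open = generate_topology B"
    using topological_basis_imp_subbasis by blast
qed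

definition compact_isometry_group ::
    "('v::euclidean_space \<Rightarrow> real) \<Rightarrow> ('v \<Rightarrow>\<^sub>L 'v) set \<Rightarrow> bool" where
  "compact_isometry_group p G \<longleftrightarrow>
    compact G \<and>
    id_blinfun \<in> G \<and> (\<forall>Q\<in>G. \<forall>R\<in>G. Q o\<^sub>L R \<in> G) \<and>
    (\<forall>Q\<in>G. \<exists>R\<in>G. Q o\<^sub>L R = id_blinfun \<and> R o\<^sub>L Q = id_blinfun) \<and>
    (\<forall>Q\<in>G. \<forall>x. p (blinfun_apply Q x) = p x)"

definition commutant :: "('v::real_normed_vector \<Rightarrow>\<^sub>L 'v) set \<Rightarrow> ('v \<Rightarrow>\<^sub>L 'v) set" where
  "commutant G = {R. \<forall>Q\<in>G. R o\<^sub>L Q = Q o\<^sub>L R}"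

definition operator_trace :: "('v::euclidean_space \<Rightarrow> 'v) \<Rightarrow> real" where
  "operator_trace L = (\<Sum>b\<in>Basis. L b \<bullet> b)"

definition is_basis :: "nat \<Rightarrow> (nat \<Rightarrow> 'x::real_vector) \<Rightarrow> bool" where
  "is_basis N e \<longleftrightarrow>
    inj_on e {1..N} \<and> independent (e ` {1..N}) \<and> span (e ` {1..N}) = UNIV"

definition one_symmetric_basis :: "nat \<Rightarrow> (nat \<Rightarrow> 'x::real_normed_vector) \<Rightarrow> bool" where
  "one_symmetric_basis N e \<longleftrightarrow>
    is_basis N e \<and>
    (\<forall>(a :: nat \<Rightarrow> real) (\<epsilon> :: nat \<Rightarrow> real) \<sigma>.
       (\<forall>i\<in>{1..N}. \<epsilon> i \<in> {-1, 1}) \<and> \<sigma> permutes {1..N} \<longrightarrow>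
       norm (\<Sum>i=1..N. (\<epsilon> i * a i) *\<^sub>R e (\<sigma> i)) = norm (\<Sum>i=1..N. a i *\<^sub>R e i))"

text \<open>\<open>k\<close>-tuples of vectors are lists of length \<open>k\<close>; values on other lists are irrelevant.\<close>

definition alternating_form :: "nat \<Rightarrow> ('x::real_vector list \<Rightarrow> 'y::real_vector) \<Rightarrow> bool" where
  "alternating_form k f \<longleftrightarrow>
    (\<forall>xs j. length xs = k \<and> j < k \<longrightarrow> linear (\<lambda>v. f (xs[j := v]))) \<and>
    (\<forall>xs. length xs = k \<and> \<not> distinct xs \<longrightarrow> f xs = 0)"

text \<open>
  \<open>exterior_power k wedge\<close>: the codomain of \<open>wedge\<close> is the exterior power \<open>\<Lambda>\<^sup>kX\<close>, with
  \<open>wedge [x\<^sub>1, \<dots>, x\<^sub>k] = x\<^sub>1 \<and> \<dots> \<and> x\<^sub>k\<close>. This is the universal property; scalar-valued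
  alternating forms suffice to characterise a finite-dimensional exterior power, up to
  unique isomorphism.
\<close>

definition exterior_power :: "nat \<Rightarrow> ('x::real_vector list \<Rightarrow> 'e::real_vector) \<Rightarrow> bool" where
  "exterior_power k wedge \<longleftrightarrow>
    alternating_form k wedge \<and>
    (\<forall>f :: 'x list \<Rightarrow> real. alternating_form k f \<longrightarrow>
       (\<exists>!g. linear g \<and> (\<forall>xs. length xs = k \<longrightarrow> g (wedge xs) = f xs)))"

definition wedge_basis ::
    "('x list \<Rightarrow> 'e) \<Rightarrow> (nat \<Rightarrow> 'x) \<Rightarrow> nat set \<Rightarrow> 'e" where
  "wedge_basis wedge e I = wedge (map e (sorted_list_of_set I))"

definition projective_exterior_norm ::
    "nat \<Rightarrow> ('x::real_normed_vector list \<Rightarrow> 'e::real_vector) \<Rightarrow> 'e \<Rightarrow> real" where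
  "projective_exterior_norm k wedge w =
    Inf {(\<Sum>xs\<leftarrow>xss. prod_list (map norm xs)) | xss.
           (\<forall>xs\<in>set xss. length xs = k) \<and> w = (\<Sum>xs\<leftarrow>xss. wedge xs)}"

definition exterior_map ::
    "nat \<Rightarrow> ('x list \<Rightarrow> 'e::real_vector) \<Rightarrow> ('x \<Rightarrow> 'x) \<Rightarrow> 'e \<Rightarrow> 'e" where
  "exterior_map k wedge A =
    (THE L. linear L \<and> (\<forall>xs. length xs = k \<longrightarrow> L (wedge xs) = wedge (map A xs)))"

end

theory Submission
  imports Defs
begin

text \<open>
  A norm \<open>p\<close> is convex and Lipschitz, so its second differences in the coordinate directions
  are \<open>o(t)\<close> off a Lebesgue null cone, and comparing \<open>\<H>\<^sup>m\<^sup>-\<^sup>1\<close> on the sphere with the volume of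
  cones transfers this to the sphere: the norming functional at \<open>w\<close> is unique almost everywhere and
  depends measurably on \<open>w\<close>. An orthogonal isometry \<open>Q\<close> of \<open>p\<close> preserves the hypersurface measure and
  sends norming functionals to norming functionals, so \<open>T\<close> commutes with \<open>Q\<close>. Hence \<open>T\<close> is scalar,
  and its trace is \<open>m\<close> because \<open>w\<^sup>\<sharp>(w) = 1\<close>. For the trace formula take the trace of \<open>L T\<close> with
  \<open>L = \<Lambda>\<^sup>kA\<close>: sign changes of the \<open>e\<^sub>i\<close> separate the vectors \<open>e\<^sub>I\<close> and permutations move them
  around transitively up to sign, so only scalars commute with both.
\<close>

section \<open>Hausdorff measure\<close>

text \<open>The map \<open>sharp\<close> is an arbitrary selection of norming functionals, with no
  measurability supplied. Hausdorff measure lives on all Caratheodory measurable sets, hence is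
  complete, so it suffices that \<open>sharp\<close> agrees almost everywhere with a Borel map; its
  coordinates are one-sided partial derivatives of \<open>p\<close>. Coordinate directions are
  enough because a linear functional is determined by its coordinates. Dividing by the measure of
  the sphere happens in \<open>ennreal\<close> and gives total mass 1 only if that measure is
  positive and finite. Both facts, and the transfer of null sets, come from comparing volumes over
  the cone of points \<open>t *\<^sub>R x\<close> with 1 \<le> t \<le> 2: a set of the sphere of
  size \<epsilon> corresponds to about 1/\<epsilon> balls of radius about \<epsilon> stacked along a
  ray. The constants depend on \<open>p\<close> and the dimension only, and they may be crude, since
  the comparison only has to detect zero, positive and finite.\<close>

lemma hausdorff_pre_separated:
  fixes A B :: "'a::metric_space set"
  assumes sep: "\<And>x y. x \<in> A \<Longrightarrow> y \<in> B \<Longrightarrow> d \<le> dist x y" and \<delta>: "\<delta> < d"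
  shows "hausdorff_pre s \<delta> A + hausdorff_pre s \<delta> B \<le> hausdorff_pre s \<delta> (A \<union> B)"
  unfolding hausdorff_pre_def[of s \<delta> "A \<union> B"]
proof (rule INF_greatest)
  fix C assume C: "C \<in> hausdorff_covers \<delta> (A \<union> B)"
  \<comment> \<open>Discarded members become \<open>{}\<close>, with gauge 0 and diameter 0; that
    diameter is admissible because \<open>\<delta> \<ge> 0\<close>.\<close>
  define CA where "CA E i = (if C i \<inter> E = {} then {} else C i)" for E i
  have 0: "\<delta> \<ge> 0"
  proof -
    have "diameter (C 0) \<ge> 0" "diameter (C 0) \<le> \<delta>"
      using C by (auto simp: hausdorff_covers_def intro: diameter_ge_0)
    then show ?thesis by linarith
  qed
  have cov: "CA E \<in> hausdorff_covers \<delta> E" if "E \<subseteq> A \<union> B" for E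
    using C that 0 unfolding hausdorff_covers_def CA_def by (fastforce split: if_splits)
  \<comment> \<open>A member meeting both sets would contain two points at distance at least
    \<open>d\<close>, more than its diameter. Hence no gauge is counted twice when the cover is
    split.\<close>
  have disj: "C i \<inter> A = {} \<or> C i \<inter> B = {}" for i
  proof (rule ccontr)
    assume "\<not> ?thesis"
    then obtain x y where "x \<in> C i" "x \<in> A" "y \<in> C i" "y \<in> B" by blast
    moreover have "bounded (C i)" "diameter (C i) \<le> \<delta>"
      using C by (auto simp: hausdorff_covers_def)
    ultimately show False
      using diameter_bounded_bound[of "C i" x y] sep[of x y] \<delta> by auto
  qed
  have "hausdorff_pre s \<delta> A + hausdorff_pre s \<delta> B
      \<le> (\<Sum>i. hausdorff_gauge s (CA A i)) + (\<Sum>i. hausdorff_gauge s (CA B i))"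
    unfolding hausdorff_pre_def by (intro add_mono INF_lower cov) auto
  also have "\<dots> = (\<Sum>i. hausdorff_gauge s (CA A i) + hausdorff_gauge s (CA B i))"
    by (rule suminf_add) auto
  also have "\<dots> \<le> (\<Sum>i. hausdorff_gauge s (C i))"
    using disj by (intro suminf_le) (auto simp: CA_def hausdorff_gauge_def)
  finally show "hausdorff_pre s \<delta> A + hausdorff_pre s \<delta> B \<le> (\<Sum>i. hausdorff_gauge s (C i))" .
qed

lemma hausdorff_pre_antimono:
  "\<delta> \<le> \<delta>' \<Longrightarrow> hausdorff_pre s \<delta>' A \<le> hausdorff_pre s \<delta> A"
  unfolding hausdorff_pre_def hausdorff_covers_def
  by (rule INF_superset_mono) (auto intro: order_trans)

lemma hausdorff_pre_le_outer: "\<delta> > 0 \<Longrightarrow> hausdorff_pre s \<delta> A \<le> hausdorff_outer s A"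
  unfolding hausdorff_outer_def by (rule SUP_upper) auto

text \<open>Shrinking the scale only increases \<open>hausdorff_pre\<close>, so bounds at small
  scales control the supremum. The scale is written \<open>2 * \<epsilon>\<close> because the covers
  to come consist of balls of radius \<epsilon>.\<close>

lemma hausdorff_outer_le_scales:
  assumes "r > 0" and *: "\<And>\<epsilon>. 0 < \<epsilon> \<Longrightarrow> \<epsilon> \<le> r \<Longrightarrow> hausdorff_pre s (2 * \<epsilon>) A \<le> K"
  shows "hausdorff_outer s A \<le> K"
  unfolding hausdorff_outer_def
proof (rule SUP_least)
  fix \<delta> :: real assume "\<delta> \<in> {0<..}"
  then have "hausdorff_pre s \<delta> A \<le> hausdorff_pre s (2 * min r (\<delta> / 2)) A"
    by (intro hausdorff_pre_antimono) auto
  also have "\<dots> \<le> K" using \<open>\<delta> \<in> _\<close> \<open>r > 0\<close> by (intro *) auto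
  finally show "hausdorff_pre s \<delta> A \<le> K" .
qed

lemma hausdorff_outer_mono: "A \<subseteq> B \<Longrightarrow> hausdorff_outer s A \<le> hausdorff_outer s B"
  using outer_measure_space_hausdorff_outer[of s]
  by (auto simp: outer_measure_space_def increasing_def)

text \<open>\<open>countably_subadditive\<close> speaks of disjoint families; disjointing the sets
  and monotonicity remove that restriction.\<close>

lemma hausdorff_outer_subadditive:
  "hausdorff_outer s (\<Union>i. A i) \<le> (\<Sum>i. hausdorff_outer s (A i))" for A :: "nat \<Rightarrow> 'a::metric_space set"
proof -
  have U: "(disjointed A i :: 'a set) \<subseteq> A i" for i by (rule disjointed_subset)
  have "hausdorff_outer s (\<Union>i. disjointed A i) \<le> (\<Sum>i. hausdorff_outer s (disjointed A i))"
    using outer_measure_space_hausdorff_outer[of s] disjoint_family_disjointed[of A]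
    by (auto simp: outer_measure_space_def countably_subadditive_def)
  also have "\<dots> \<le> (\<Sum>i. hausdorff_outer s (A i))"
    by (intro suminf_le hausdorff_outer_mono U) auto
  finally show ?thesis by (simp add: UN_disjointed_eq)
qed

lemma hausdorff_outer_empty [simp]: "hausdorff_outer s {} = 0"
  using outer_measure_space_hausdorff_outer[of s]
  by (auto simp: outer_measure_space_def positive_def)

lemma hausdorff_outer_Un: "hausdorff_outer s (A \<union> B) \<le> hausdorff_outer s A + hausdorff_outer s B"
proof -
  have "hausdorff_outer s (\<Union>i. binaryset A B i) \<le> (\<Sum>i. hausdorff_outer s (binaryset A B i))"
    by (rule hausdorff_outer_subadditive)
  then show ?thesis
    by (simp add: UN_binaryset_eq suminf_binaryset_eq)
qed

text \<open>Below scale \<open>d\<close> every cover splits. The two suprema may be added because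
  the smaller of two scales dominates both terms.\<close>

lemma hausdorff_outer_separated:
  fixes A B :: "'a::metric_space set"
  assumes sep: "\<And>x y. x \<in> A \<Longrightarrow> y \<in> B \<Longrightarrow> d \<le> dist x y" and d: "0 < d"
  shows "hausdorff_outer s A + hausdorff_outer s B \<le> hausdorff_outer s (A \<union> B)"
proof -
  have "hausdorff_outer s A + hausdorff_outer s B
      = (SUP \<delta>\<in>{0<..}. hausdorff_pre s \<delta> A + hausdorff_pre s \<delta> B)"
    unfolding hausdorff_outer_def
  proof (rule SUP_add_directed_ennreal[symmetric])
    fix i j :: real assume "i \<in> {0<..}" "j \<in> {0<..}"
    then show "\<exists>k\<in>{0<..}. hausdorff_pre s i A + hausdorff_pre s j B
        \<le> hausdorff_pre s k A + hausdorff_pre s k B"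
      by (intro bexI[of _ "min i j"] add_mono hausdorff_pre_antimono) auto
  qed
  also have "\<dots> \<le> hausdorff_outer s (A \<union> B)"
  proof (rule SUP_least)
    fix \<delta> :: real assume "\<delta> \<in> {0<..}"
    then have "hausdorff_pre s \<delta> A + hausdorff_pre s \<delta> B
        \<le> hausdorff_pre s (min \<delta> (d / 2)) A + hausdorff_pre s (min \<delta> (d / 2)) B"
      by (intro add_mono hausdorff_pre_antimono) auto
    also have "\<dots> \<le> hausdorff_pre s (min \<delta> (d / 2)) (A \<union> B)"
      using d by (intro hausdorff_pre_separated[where d = d] sep) auto
    also have "\<dots> \<le> hausdorff_outer s (A \<union> B)"
      using d \<open>\<delta> \<in> _\<close> by (intro hausdorff_pre_le_outer) auto
    finally show "hausdorff_pre s \<delta> A + hausdorff_pre s \<delta> B \<le> hausdorff_outer s (A \<union> B)" .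
  qed
  finally show ?thesis .
qed

text \<open>
  Caratheodory's criterion: the shells at distance between \<open>1/(k+2)\<close> and \<open>1/(k+1)\<close> from a closed
  set are pairwise separated when their indices differ by 2, so their outer measures are summable.
\<close>

lemma hausdorff_outer_closed_split:
  fixes F T :: "'a::metric_space set"
  assumes "closed F"
  shows "hausdorff_outer s (F \<inter> T) + hausdorff_outer s (T - F) \<le> hausdorff_outer s T"
proof (cases "F = {} \<or> hausdorff_outer s T = \<infinity>")
  case True then show ?thesis by auto
next
  case False
  then have "F \<noteq> {}" and fin: "hausdorff_outer s T < \<infinity>" by (auto simp: top.not_eq_extremum)
  define D where "D n = {x \<in> T. 1 / real (n + 1) \<le> infdist x F}" for n
  define R where "R k = {x \<in> T. 1 / real (k + 2) \<le> infdist x F \<and> infdist x F < 1 / real (k + 1)}" for k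
  have lip: "infdist x F \<le> infdist y F + dist x y" for x y
    by (rule infdist_triangle)
  have shells: "(\<Sum>k<n. hausdorff_outer s (R (2 * k + a))) \<le> hausdorff_outer s (\<Union>k<n. R (2 * k + a))" for n a
  proof (induction n)
    case (Suc n)
    have "(\<Sum>k<Suc n. hausdorff_outer s (R (2 * k + a)))
        \<le> hausdorff_outer s (\<Union>k<n. R (2 * k + a)) + hausdorff_outer s (R (2 * n + a))"
      using Suc by (simp add: add_right_mono)
    also have "\<dots> \<le> hausdorff_outer s ((\<Union>k<n. R (2 * k + a)) \<union> R (2 * n + a))"
    \<comment> \<open>For \<open>n = 0\<close> the union is empty; the gap used below would then be
      built from \<open>1 / 0\<close> when \<open>a = 0\<close>.\<close>
    proof (cases n)
      case (Suc m)
      show ?thesis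
      proof (rule hausdorff_outer_separated)
        fix x y assume "x \<in> (\<Union>k<n. R (2 * k + a))" "y \<in> R (2 * n + a)"
        then obtain k where k: "k < n" "1 / real (2 * k + a + 2) \<le> infdist x F"
          and y: "infdist y F < 1 / real (2 * n + a + 1)"
          by (auto simp: R_def)
        have "1 / real (2 * n + a) \<le> 1 / real (2 * k + a + 2)"
          using k(1) by (intro divide_left_mono) auto
        with k y lip[of x y]
        show "1 / real (2 * n + a) - 1 / real (2 * n + a + 1) \<le> dist x y" by linarith
      next
        show "0 < 1 / real (2 * n + a) - 1 / real (2 * n + a + 1)"
          using Suc by (simp add: frac_less2)
      qed
    qed simp
    also have "(\<Union>k<n. R (2 * k + a)) \<union> R (2 * n + a) = (\<Union>k<Suc n. R (2 * k + a))"
      by (auto simp: less_Suc_eq)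
    finally show ?case .
  qed simp
  have RT: "R k \<subseteq> T" for k by (auto simp: R_def)
  have partial: "(\<Sum>k<2 * n. hausdorff_outer s (R k)) \<le> 2 * hausdorff_outer s T" for n
  proof -
    have "(\<Sum>k<2 * n. hausdorff_outer s (R k))
        = (\<Sum>k<n. hausdorff_outer s (R (2 * k + 0))) + (\<Sum>k<n. hausdorff_outer s (R (2 * k + 1)))"
      by (induction n) (auto simp: ac_simps)
    also have "\<dots> \<le> hausdorff_outer s T + hausdorff_outer s T"
      by (intro add_mono order_trans[OF shells] hausdorff_outer_mono) (use RT in auto)
    finally show ?thesis by (simp add: mult_2)
  qed
  have "(\<Sum>k. hausdorff_outer s (R k)) \<le> 2 * hausdorff_outer s T"
  proof (rule suminf_le_const)
    fix n
    have "(\<Sum>k<n. hausdorff_outer s (R k)) \<le> (\<Sum>k<2 * n. hausdorff_outer s (R k))"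
      by (rule sum_mono2) auto
    with partial[of n] show "(\<Sum>k<n. hausdorff_outer s (R k)) \<le> 2 * hausdorff_outer s T"
      by (rule order_trans[rotated])
  qed auto
  also have "\<dots> < \<infinity>" using fin by (simp add: ennreal_mult_less_top)
  finally have fsum: "(\<Sum>k. hausdorff_outer s (R k)) < \<infinity>" .
  define r where "r k = enn2real (hausdorff_outer s (R k))" for k
  have r: "hausdorff_outer s (R k) = ennreal (r k)" for k
    using fsum ennreal_suminf_lessD[of "\<lambda>k. hausdorff_outer s (R k)" \<infinity> k]
    by (simp add: r_def)
  have r0: "r k \<ge> 0" for k by (simp add: r_def)
  have sr: "summable r"
    using fsum unfolding r by (intro summable_suminf_not_top r0) auto
  have "hausdorff_outer s (F \<inter> T) + hausdorff_outer s (T - F) \<le> hausdorff_outer s T + ennreal \<epsilon>"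
    if \<epsilon>: "\<epsilon> > 0" for \<epsilon> :: real
  proof -
    \<comment> \<open>The shells from index \<open>n\<close> on carry outer measure at most
      \<epsilon>. What they leave of \<open>T - F\<close> lies in \<open>D n\<close>, at positive
      distance from \<open>F\<close>, where additivity is already known.\<close>
    obtain n where n: "\<bar>\<Sum>i. r (i + n)\<bar> < \<epsilon>"
      using suminf_exist_split[OF \<epsilon> sr] by auto
    have "hausdorff_outer s (\<Union>i. R (i + n)) \<le> (\<Sum>i. hausdorff_outer s (R (i + n)))"
      by (rule hausdorff_outer_subadditive)
    also have "\<dots> = ennreal (\<Sum>i. r (i + n))"
      unfolding r using sr by (intro suminf_ennreal2 r0) (simp add: summable_iff_shift)
    also have "\<dots> \<le> ennreal \<epsilon>" using n by (intro ennreal_leI) auto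
    finally have tail: "hausdorff_outer s (\<Union>i. R (i + n)) \<le> ennreal \<epsilon>" .
    have cover: "T - F \<subseteq> D n \<union> (\<Union>i. R (i + n))"
    proof
      fix x assume x: "x \<in> T - F"
      then have pos: "infdist x F > 0"
        using assms \<open>F \<noteq> {}\<close> by (simp add: infdist_pos_not_in_closed)
      show "x \<in> D n \<union> (\<Union>i. R (i + n))"
      proof (cases "x \<in> D n")
        case False
        have ex: "\<exists>m. 1 / real (m + 1) \<le> infdist x F"
          using nat_approx_posE[OF pos] by (metis Suc_eq_plus1 less_imp_le)
        define m where "m = (LEAST m. 1 / real (m + 1) \<le> infdist x F)"
        have m: "1 / real (m + 1) \<le> infdist x F"
          unfolding m_def by (rule LeastI_ex[OF ex])
        have lt: "infdist x F < 1 / real (j + 1)" if "j < m" for j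
          using not_less_Least[of j "\<lambda>m. 1 / real (m + 1) \<le> infdist x F"] that
          unfolding m_def by auto
        have "n < m"
        proof (rule ccontr)
          assume "\<not> n < m"
          then have "1 / real (n + 1) \<le> 1 / real (m + 1)"
            by (intro divide_left_mono) auto
          with m False x show False by (auto simp: D_def)
        qed
        then have "x \<in> R (m - 1)"
          using m lt[of "m - 1"] x by (auto simp: R_def)
        then have "x \<in> R ((m - 1 - n) + n)" using \<open>n < m\<close> by simp
        then show ?thesis by blast
      qed simp
    qed
    have "hausdorff_outer s (T - F) \<le> hausdorff_outer s (D n) + hausdorff_outer s (\<Union>i. R (i + n))"
      using hausdorff_outer_mono[OF cover] hausdorff_outer_Un by (rule order_trans)
    also have "\<dots> \<le> hausdorff_outer s (D n) + ennreal \<epsilon>"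
      using tail by (intro add_mono) auto
    finally have "hausdorff_outer s (F \<inter> T) + hausdorff_outer s (T - F)
        \<le> (hausdorff_outer s (F \<inter> T) + hausdorff_outer s (D n)) + ennreal \<epsilon>"
      by (simp add: add.assoc add_left_mono)
    also have "hausdorff_outer s (F \<inter> T) + hausdorff_outer s (D n) \<le> hausdorff_outer s (F \<inter> T \<union> D n)"
    proof (rule hausdorff_outer_separated)
      fix x y assume "x \<in> F \<inter> T" "y \<in> D n"
      then show "1 / real (n + 1) \<le> dist x y"
        using infdist_le[of x F y] by (auto simp: D_def dist_commute)
    qed auto
    also have "\<dots> \<le> hausdorff_outer s T"
      by (intro hausdorff_outer_mono) (auto simp: D_def)
    finally show ?thesis by (simp add: add_right_mono)
  qed
  then show ?thesis by (rule ennreal_le_epsilon)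
qed

text \<open>Subadditivity supplies the opposite inequality, so only one direction of the
  Caratheodory condition has to be checked.\<close>

lemma sets_hausdorff_measure_iff:
  fixes A :: "'a::metric_space set"
  shows "A \<in> sets (hausdorff_measure s) \<longleftrightarrow>
    (\<forall>T. hausdorff_outer s (A \<inter> T) + hausdorff_outer s (T - A) \<le> hausdorff_outer s T)"
proof -
  have "hausdorff_outer s T \<le> hausdorff_outer s (A \<inter> T) + hausdorff_outer s (T - A)" for T
    using hausdorff_outer_Un[of s "A \<inter> T" "T - A"]
    by (simp add: Int_Diff_Un Int_commute[of A T])
  moreover have "(UNIV - A) \<inter> T = T - A" for T by auto
  ultimately show ?thesis
    unfolding sets_hausdorff_measure lambda_system_def by (auto intro: antisym)
qed

lemma space_hausdorff_measure [simp]: "space (hausdorff_measure s) = UNIV"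
  unfolding hausdorff_measure_def by (rule space_measure_of) auto

lemma borel_subset_sets_hausdorff_measure:
  "sets borel \<subseteq> sets (hausdorff_measure s :: 'a::metric_space measure)"
proof -
  have "sets (borel :: 'a measure) = sigma_sets UNIV (Collect closed)"
    unfolding borel_eq_closed by (simp add: sets_measure_of)
  moreover have "A \<in> sets (hausdorff_measure s)" if "closed A" for A :: "'a set"
    unfolding sets_hausdorff_measure_iff using hausdorff_outer_closed_split[OF that] by blast
  then have "sigma_sets UNIV (Collect closed) \<subseteq> sets (hausdorff_measure s :: 'a measure)"
    by (metis mem_Collect_eq sets.sigma_sets_subset space_hausdorff_measure subsetI)
  ultimately show ?thesis by simp
qed

text \<open>This is completeness: changing a measurable function on a null set, in whatever way,
  leaves it measurable.\<close>

lemma hausdorff_outer_zero_sets: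
  "hausdorff_outer s A = 0 \<Longrightarrow> A \<in> sets (hausdorff_measure s)"
  unfolding sets_hausdorff_measure_iff
proof
  fix T assume "hausdorff_outer s A = 0"
  then have "hausdorff_outer s (A \<inter> T) = 0"
    using hausdorff_outer_mono[of "A \<inter> T" A s] by auto
  then show "hausdorff_outer s (A \<inter> T) + hausdorff_outer s (T - A) \<le> hausdorff_outer s T"
    by (auto intro: hausdorff_outer_mono)
qed

text \<open>The image of a cover is a cover whose members have the same diameters, hence the same
  gauges.\<close>

lemma hausdorff_outer_isometry_le:
  fixes f :: "'a::metric_space \<Rightarrow> 'b::metric_space"
  assumes iso: "\<And>x y. dist (f x) (f y) = dist x y"
  shows "hausdorff_outer s (f ` A) \<le> hausdorff_outer s A"
  unfolding hausdorff_outer_def hausdorff_pre_def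
proof (intro SUP_mono' INF_mono)
  fix \<delta> :: real and C assume C: "C \<in> hausdorff_covers \<delta> A"
  have diam: "diameter (f ` E) = diameter E" for E
  proof (cases "E = {}")
    case False
    have "(\<lambda>(x, y). dist x y) ` (f ` E \<times> f ` E) = (\<lambda>(x, y). dist x y) ` (E \<times> E)"
      using iso by (force simp: image_iff)
    with False show ?thesis by (simp add: diameter_def)
  qed simp
  have bdd: "bounded (f ` E)" if E: "bounded E" for E
  proof -
    obtain x e where "\<forall>y\<in>E. dist x y \<le> e" using E by (auto simp: bounded_def)
    then have "\<forall>y\<in>f ` E. dist (f x) y \<le> e" using iso by auto
    then show ?thesis unfolding bounded_def by blast
  qed
  have "f ` A \<subseteq> (\<Union>i. f ` C i)"
    using C unfolding hausdorff_covers_def by blast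
  then have "(\<lambda>i. f ` C i) \<in> hausdorff_covers \<delta> (f ` A)"
    using C bdd by (auto simp: hausdorff_covers_def diam)
  moreover have "hausdorff_gauge s (f ` E) = hausdorff_gauge s E" for E
    by (simp add: hausdorff_gauge_def diam)
  ultimately show "\<exists>D\<in>hausdorff_covers \<delta> (f ` A).
      (\<Sum>i. hausdorff_gauge s (D i)) \<le> (\<Sum>i. hausdorff_gauge s (C i))"
    by (intro bexI[of _ "\<lambda>i. f ` C i"]) auto
qed

lemma hausdorff_outer_isometry_vimage:
  fixes f :: "'a::metric_space \<Rightarrow> 'b::metric_space"
  assumes iso: "\<And>x y. dist (f x) (f y) = dist x y" and "surj f"
  shows "hausdorff_outer s (f -` A) = hausdorff_outer s A"
proof (rule antisym)
  have A: "A = f ` (f -` A)" using \<open>surj f\<close> by (simp add: surj_image_vimage_eq)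
  show "hausdorff_outer s A \<le> hausdorff_outer s (f -` A)"
    using hausdorff_outer_isometry_le[of f, OF iso] A by metis
  have "inj f" using iso by (metis dist_eq_0_iff injI)
  then have "f -` A = inv f ` A" using \<open>surj f\<close> by (simp add: bij_def bij_vimage_eq_inv_image)
  moreover have "dist (inv f x) (inv f y) = dist x y" for x y
    using iso \<open>surj f\<close> by (metis surj_f_inv_f)
  ultimately show "hausdorff_outer s (f -` A) \<le> hausdorff_outer s A"
    using hausdorff_outer_isometry_le[of "inv f" s A] by simp
qed

lemma sets_hausdorff_measure_isometry_vimage:
  fixes f :: "'a::metric_space \<Rightarrow> 'b::metric_space"
  assumes iso: "\<And>x y. dist (f x) (f y) = dist x y" and "surj f"
    and A: "A \<in> sets (hausdorff_measure s)"
  shows "f -` A \<in> sets (hausdorff_measure s)"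
  unfolding sets_hausdorff_measure_iff
proof
  fix T
  have "inj f" using iso by (metis dist_eq_0_iff injI)
  \<comment> \<open>Every test set is a preimage, so the criterion for \<open>A\<close> can be
    pulled back along \<open>f\<close>.\<close>
  then have T: "T = f -` (f ` T)" by (simp add: inj_vimage_image_eq)
  have "hausdorff_outer s (f -` (A \<inter> f ` T)) + hausdorff_outer s (f -` (f ` T - A))
      \<le> hausdorff_outer s (f -` (f ` T))"
    using A unfolding hausdorff_outer_isometry_vimage[OF iso \<open>surj f\<close>] sets_hausdorff_measure_iff by blast
  then show "hausdorff_outer s (f -` A \<inter> T) + hausdorff_outer s (T - f -` A) \<le> hausdorff_outer s T"
    using T by (metis vimage_Int vimage_Diff)
qed

section \<open>Hausdorff measure of the unit sphere of a norm\<close>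

locale norm_on_euclidean =
  fixes p :: "'v::euclidean_space \<Rightarrow> real"
  assumes is_norm: "is_norm p"
begin

lemma p_eq_0_iff [simp]: "p x = 0 \<longleftrightarrow> x = 0"
  and p_triangle: "p (x + y) \<le> p x + p y"
  and p_scaleR: "p (a *\<^sub>R x) = \<bar>a\<bar> * p x"
  using is_norm by (auto simp: is_norm_def)

lemma p_zero [simp]: "p 0 = 0"
  by simp

lemma p_minus: "p (- x) = p x"
  using p_scaleR[of "-1" x] by simp

lemma p_nonneg: "0 \<le> p x"
  using p_triangle[of x "- x"] by (simp add: p_minus)

lemma p_pos: "x \<noteq> 0 \<Longrightarrow> 0 < p x"
  using p_nonneg[of x] p_eq_0_iff[of x] by linarith

lemma abs_p_diff_le: "\<bar>p x - p y\<bar> \<le> p (x - y)"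
  using p_triangle[of "x - y" y] p_triangle[of "y - x" x] p_minus[of "x - y"] by simp

lemma p_sum_le: "p (\<Sum>i\<in>I. f i) \<le> (\<Sum>i\<in>I. p (f i))"
proof (induction I rule: infinite_finite_induct)
  case (insert i I)
  then show ?case using p_triangle[of "f i" "\<Sum>i\<in>I. f i"] by simp
qed auto

lemma p_le_norm:
  obtains b where "0 < b" "\<And>x. p x \<le> b * norm x"
proof -
  define b where "b = (\<Sum>i\<in>Basis. p i) + 1"
  have b: "0 < b" unfolding b_def using sum_nonneg[of Basis p] p_nonneg by fastforce
  have "p x \<le> b * norm x" for x
  proof -
    have "p x = p (\<Sum>i\<in>Basis. (x \<bullet> i) *\<^sub>R i)" by (simp add: euclidean_representation)
    also have "\<dots> \<le> (\<Sum>i\<in>Basis. \<bar>x \<bullet> i\<bar> * p i)"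
      using p_sum_le[of "\<lambda>i. (x \<bullet> i) *\<^sub>R i" Basis] by (simp add: p_scaleR)
    also have "\<dots> \<le> (\<Sum>i\<in>Basis. norm x * p i)"
      by (intro sum_mono mult_right_mono Basis_le_norm p_nonneg)
    also have "\<dots> \<le> b * norm x"
      by (simp add: b_def sum_distrib_left[symmetric] algebra_simps)
    finally show ?thesis .
  qed
  with b show thesis by (rule that)
qed

lemma continuous_on_p [continuous_intros]:
  assumes "continuous_on A f"
  shows "continuous_on A (\<lambda>x. p (f x))"
proof -
  obtain b where b: "0 < b" "\<And>x. p x \<le> b * norm x" using p_le_norm by metis
  have "continuous_on UNIV p"
  proof (rule continuous_on_iff[THEN iffD2], intro ballI allI impI)
    fix x :: 'v and e :: real assume "0 < e"
    show "\<exists>d>0. \<forall>x'\<in>UNIV. dist x' x < d \<longrightarrow> dist (p x') (p x) < e"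
    proof (intro exI[of _ "e / b"] conjI ballI impI)
      fix y assume "dist y x < e / b"
      then have "b * norm (y - x) < e" using b by (simp add: dist_norm field_simps)
      then show "dist (p y) (p x) < e"
        using abs_p_diff_le[of y x] b(2)[of "y - x"] by (simp add: dist_real_def)
    qed (use b \<open>0 < e\<close> in auto)
  qed
  then show ?thesis using assms by (rule continuous_on_compose2) auto
qed

lemma norm_equivalence:
  obtains a b where "0 < a" "0 < b" "\<And>x. a * norm x \<le> p x" "\<And>x. p x \<le> b * norm x"
proof -
  have "\<exists>u\<in>sphere 0 1. \<forall>y\<in>sphere 0 1. p u \<le> p y"
    by (rule continuous_attains_inf[OF compact_sphere])
      (use vector_choose_size[of 1] in \<open>auto simp: sphere_eq_empty intro!: continuous_intros\<close>)
  then obtain u where u: "norm u = 1" "\<And>y. norm y = 1 \<Longrightarrow> p u \<le> p y"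
    by auto
  have "0 < p u" using u(1) by (intro p_pos) auto
  moreover have "p u * norm x \<le> p x" for x
  proof (cases "x = 0")
    case False
    then have "p u \<le> p (inverse (norm x) *\<^sub>R x)" by (intro u(2)) auto
    also have "\<dots> = p x / norm x" by (simp add: p_scaleR divide_inverse)
    finally show ?thesis using False by (simp add: pos_le_divide_eq)
  qed simp
  ultimately show thesis using that p_le_norm by metis
qed

lemma compact_unit_sphere: "compact (unit_sphere p)"
  unfolding compact_eq_bounded_closed
proof
  obtain a where a: "0 < a" "\<And>x. a * norm x \<le> p x" using norm_equivalence by metis
  have "norm x \<le> 1 / a" if "x \<in> unit_sphere p" for x
    using that a(1) a(2)[of x] by (simp add: unit_sphere_def field_simps)
  then show "bounded (unit_sphere p)" unfolding bounded_iff by blast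
  show "closed (unit_sphere p)"
    unfolding unit_sphere_def by (intro closed_Collect_eq continuous_intros)
qed

text \<open>
  Around the points \<open>(1 + j\<epsilon>)x\<close>, with \<open>x\<close> from a maximal \<open>\<epsilon>\<close>-separated subset of \<open>B\<close> and
  \<open>j < \<lfloor>1/\<epsilon>\<rfloor>\<close>, there are disjoint balls of radius comparable to \<open>\<epsilon>\<close>; counting their volumes
  bounds the number of balls of radius \<open>\<epsilon>\<close> needed to cover \<open>B\<close>.
\<close>

lemma hausdorff_pre_sphere_le_volume:
  obtains C where "C > 0"
    "\<And>\<epsilon> B U. 0 < \<epsilon> \<Longrightarrow> \<epsilon> \<le> 1 \<Longrightarrow> B \<subseteq> unit_sphere p \<Longrightarrow> U \<in> sets lborel \<Longrightarrow>
      (\<And>x t. x \<in> B \<Longrightarrow> 1 \<le> t \<Longrightarrow> t \<le> 2 \<Longrightarrow> ball (t *\<^sub>R x) \<epsilon> \<subseteq> U) \<Longrightarrow>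
      hausdorff_pre (DIM('v) - 1) (2 * \<epsilon>) B \<le> ennreal C * emeasure lborel U"
proof -
  obtain a b where ab: "0 < a" "0 < b" "\<And>x. a * norm x \<le> p x" "\<And>x. p x \<le> b * norm x"
    using norm_equivalence by metis
  let ?m = "DIM('v)" and ?s = "DIM('v) - 1"
  \<comment> \<open>\<open>b * \<kappa> \<le> 1\<close> separates centres at different heights and
    \<open>b * \<kappa> \<le> a / 2\<close> those in different directions; the factor
    \<open>b\<close> converts an estimate in \<open>p\<close> into a Euclidean one.\<close>
  define \<kappa> where "\<kappa> = min 1 (min 1 (a / 2) / b)"
  have \<kappa>: "0 < \<kappa>" "\<kappa> \<le> 1" "b * \<kappa> \<le> 1" "b * \<kappa> \<le> a / 2"
    using ab(1,2) by (auto simp: \<kappa>_def min_def field_simps)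
  have far: "\<kappa> * \<epsilon> \<le> dist (t *\<^sub>R x) (t' *\<^sub>R y)"
    if x: "p x = 1" and y: "p y = 1" and t: "1 \<le> t" "t \<le> 2" "1 \<le> t'"
      and far: "\<epsilon> \<le> dist x y \<or> \<epsilon> \<le> \<bar>t - t'\<bar>" and "0 < \<epsilon>" for x y t t' \<epsilon>
  proof -
    let ?d = "p (t *\<^sub>R x - t' *\<^sub>R y)"
    have 1: "\<bar>t - t'\<bar> \<le> ?d"
      using abs_p_diff_le[of "t *\<^sub>R x" "t' *\<^sub>R y"] x y t by (simp add: p_scaleR)
    have "t * p (x - y) = p (t *\<^sub>R (x - y))" using t by (simp add: p_scaleR)
    also have "t *\<^sub>R (x - y) = (t *\<^sub>R x - t' *\<^sub>R y) + (t' - t) *\<^sub>R y"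
      by (simp add: algebra_simps)
    also have "p \<dots> \<le> ?d + \<bar>t' - t\<bar>"
      using p_triangle[of "t *\<^sub>R x - t' *\<^sub>R y" "(t' - t) *\<^sub>R y"] y by (simp add: p_scaleR)
    finally have "t * p (x - y) \<le> ?d + \<bar>t' - t\<bar>" .
    moreover have "1 * p (x - y) \<le> t * p (x - y)"
      using t p_nonneg by (intro mult_right_mono) auto
    \<comment> \<open>The radial correction is itself at most \<open>?d\<close>, which costs the
      factor 2.\<close>
    ultimately have 2: "p (x - y) / 2 \<le> ?d" using 1 by (simp add: abs_minus_commute)
    have "(b * \<kappa>) * \<epsilon> \<le> ?d"
      using far
    proof
      assume "\<epsilon> \<le> dist x y"
      then have "a * \<epsilon> \<le> a * norm (x - y)" using ab(1) by (simp add: dist_norm)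
      also have "\<dots> \<le> p (x - y)" by (rule ab(3))
      finally have "a * \<epsilon> \<le> p (x - y)" .
      moreover have "(b * \<kappa>) * \<epsilon> \<le> (a / 2) * \<epsilon>"
        using \<kappa>(4) \<open>0 < \<epsilon>\<close> by (intro mult_right_mono) auto
      ultimately show ?thesis using 2 by simp
    next
      assume "\<epsilon> \<le> \<bar>t - t'\<bar>"
      moreover have "(b * \<kappa>) * \<epsilon> \<le> 1 * \<epsilon>"
        using \<kappa>(3) \<open>0 < \<epsilon>\<close> by (intro mult_right_mono) auto
      ultimately show ?thesis using 1 by simp
    qed
    also have "\<dots> \<le> b * dist (t *\<^sub>R x) (t' *\<^sub>R y)" using ab(4) by (simp add: dist_norm)
    finally show ?thesis using ab(2) by (simp add: mult.assoc)
  qed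
  \<comment> \<open>The packed balls have volume at least \<open>card X / (2 * \<epsilon>)\<close>
    times that of a ball of radius \<open>\<kappa> * \<epsilon> / 2\<close>, and the cover has total
    gauge \<open>card X * unit_ball_vol (real ?s) * \<epsilon> ^ ?s\<close>. \<open>C\<close> is the
    second divided by the first.\<close>
  define C where "C = 2 * unit_ball_vol (real ?s) / (unit_ball_vol (real ?m) * (\<kappa> / 2) ^ ?m)"
  have C: "C > 0" unfolding C_def using \<kappa>(1) by (intro divide_pos_pos mult_pos_pos) auto
  have main: "hausdorff_pre ?s (2 * \<epsilon>) B \<le> ennreal C * emeasure lborel U"
    if \<epsilon>: "0 < \<epsilon>" "\<epsilon> \<le> 1" and B: "B \<subseteq> unit_sphere p" and U: "U \<in> sets lborel"
      and cone: "\<And>x t. x \<in> B \<Longrightarrow> 1 \<le> t \<Longrightarrow> t \<le> 2 \<Longrightarrow> ball (t *\<^sub>R x) \<epsilon> \<subseteq> U"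
    for \<epsilon> B U
  proof (cases "emeasure lborel U = \<infinity>")
    case True
    then show ?thesis using C by (simp add: ennreal_mult_top)
  next
    case False
    define J where "J = nat \<lfloor>1 / \<epsilon>\<rfloor>"
    have J1: "real j * \<epsilon> \<le> 1" if "j < J" for j
    proof -
      have "real j \<le> 1 / \<epsilon>" using that unfolding J_def by linarith
      then show ?thesis using \<epsilon> by (simp add: field_simps)
    qed
    \<comment> \<open>A number that is at least 1 is at most twice its floor; this is the 2 in
      \<open>C\<close>.\<close>
    have J2: "1 \<le> 2 * real J * \<epsilon>"
    proof -
      have "1 / \<epsilon> \<ge> 1" using \<epsilon> by simp
      then have "1 \<le> \<lfloor>1 / \<epsilon>\<rfloor>" by (simp only: one_le_floor)
      then have "real J = of_int \<lfloor>1 / \<epsilon>\<rfloor>" unfolding J_def by (intro of_nat_nat) linarith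
      then have "1 / \<epsilon> \<le> 2 * real J" using \<open>1 \<le> \<lfloor>1 / \<epsilon>\<rfloor>\<close> by linarith
      then show ?thesis using \<epsilon> by (simp add: field_simps)
    qed
    \<comment> \<open>Half the guaranteed distance between centres, so the balls are disjoint; at
      most \<epsilon>, so they stay inside \<open>U\<close>.\<close>
    define r where "r = \<kappa> * \<epsilon> / 2"
    have r: "0 < r" "r \<le> \<epsilon>"
      using \<kappa>(1,2) \<epsilon>(1) mult_right_mono[of \<kappa> 1 \<epsilon>] by (auto simp: r_def)
    define v where "v = unit_ball_vol (real ?m) * r ^ ?m"
    have v: "v > 0" using r by (simp add: v_def)
    define sep where "sep X \<longleftrightarrow> finite X \<and> X \<subseteq> B \<and> (\<forall>x\<in>X. \<forall>y\<in>X. x \<noteq> y \<longrightarrow> \<epsilon> \<le> dist x y)" for X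
    have count: "ennreal (real (card X) * (real J * v)) \<le> emeasure lborel U" if sX: "sep X" for X
    proof -
      define c where "c = (\<lambda>(x :: 'v, j). (1 + real j * \<epsilon>) *\<^sub>R x)"
      define I where "I = X \<times> {..<J}"
      have "disjoint_family_on (\<lambda>i. ball (c i) r) I"
        unfolding disjoint_family_on_def
      proof (intro ballI impI)
        fix i i' assume ii: "i \<in> I" "i' \<in> I" "i \<noteq> i'"
        obtain x j y j' where i: "i = (x, j)" "i' = (y, j')" by (cases i, cases i')
        have "\<kappa> * \<epsilon> \<le> dist (c i) (c i')"
          unfolding c_def i prod.case
        proof (rule far)
          show "p x = 1" "p y = 1"
            using ii that B by (auto simp: I_def i sep_def unit_sphere_def)
          show "\<epsilon> \<le> dist x y \<or> \<epsilon> \<le> \<bar>1 + real j * \<epsilon> - (1 + real j' * \<epsilon>)\<bar>"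
          proof (cases "j = j'")
            case True
            then show ?thesis using ii that by (auto simp: I_def i sep_def)
          next
            case False
            then have "1 \<le> \<bar>real j - real j'\<bar>" by linarith
            then have "1 * \<epsilon> \<le> \<bar>real j - real j'\<bar> * \<epsilon>" using \<epsilon> by (intro mult_right_mono) auto
            also have "\<dots> = \<bar>(real j - real j') * \<epsilon>\<bar>" using \<epsilon> by (simp add: abs_mult)
            also have "(real j - real j') * \<epsilon> = 1 + real j * \<epsilon> - (1 + real j' * \<epsilon>)"
              by (simp add: algebra_simps)
            finally show ?thesis by simp
          qed
        qed (use ii \<epsilon> J1 in \<open>auto simp: I_def i\<close>)
        then show "ball (c i) r \<inter> ball (c i') r = {}"
          by (intro disjoint_ballI) (simp add: r_def mult.commute)
      qed
      then have "(\<Sum>i\<in>I. emeasure lborel (ball (c i) r)) = emeasure lborel (\<Union>i\<in>I. ball (c i) r)"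
        using that by (intro sum_emeasure) (auto simp: I_def sep_def)
      also have "\<dots> \<le> emeasure lborel U"
      proof (rule emeasure_mono[OF _ U], rule UN_least)
        fix i assume i: "i \<in> I"
        obtain x j where xj: "i = (x, j)" "x \<in> B" "j < J"
          using i sX by (auto simp: I_def sep_def)
        have "ball (c i) r \<subseteq> ball (c i) \<epsilon>" using r by (intro subset_ball)
        also have "\<dots> \<subseteq> U"
          unfolding c_def xj(1) prod.case using xj J1 \<epsilon> by (intro cone) auto
        finally show "ball (c i) r \<subseteq> U" .
      qed
      finally have "(\<Sum>i\<in>I. ennreal v) \<le> emeasure lborel U"
        using r by (simp add: emeasure_ball v_def)
      moreover have "(\<Sum>i\<in>I. ennreal v) = ennreal (real (card X) * (real J * v))"
        using v by (simp add: I_def card_cartesian_product ennreal_of_nat_eq_real_of_nat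
            flip: ennreal_mult)
      ultimately show ?thesis by simp
    qed
    \<comment> \<open>The volume of \<open>U\<close> caps the size of separated sets, so a largest
      one exists. Being largest, it comes within \<epsilon> of every point of
      \<open>B\<close>.\<close>
    have "\<exists>X. sep X \<and> (\<forall>Y. sep Y \<longrightarrow> card Y \<le> card X)"
    proof (rule ex_has_greatest_nat[where b = "nat \<lceil>enn2real (emeasure lborel U) / (real J * v)\<rceil> + 1" and k = "{}"])
      show "sep {}" by (simp add: sep_def)
      have Jv: "real J * v > 0" using J2 \<epsilon> v by (cases J) auto
      show "\<forall>Y. sep Y \<longrightarrow> card Y < nat \<lceil>enn2real (emeasure lborel U) / (real J * v)\<rceil> + 1"
      proof (intro allI impI)
        fix Y assume "sep Y"
        have "real (card Y) * (real J * v) \<le> enn2real (emeasure lborel U)"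
          using enn2real_mono[OF count[OF \<open>sep Y\<close>]] False v by (simp add: top.not_eq_extremum)
        then have "real (card Y) \<le> enn2real (emeasure lborel U) / (real J * v)"
          using Jv by (simp add: pos_le_divide_eq)
        then show "card Y < nat \<lceil>enn2real (emeasure lborel U) / (real J * v)\<rceil> + 1"
          by linarith
      qed
    qed
    then obtain X where X: "sep X" and max: "\<And>Y. sep Y \<Longrightarrow> card Y \<le> card X" by blast
    have covered: "\<exists>y\<in>X. dist y x < \<epsilon>" if "x \<in> B" for x
    proof (rule ccontr)
      assume *: "\<not> ?thesis"
      then have "x \<notin> X" using \<epsilon> by force
      moreover have "sep (insert x X)"
        unfolding sep_def
      proof (intro conjI ballI impI)
        fix y z assume "y \<in> insert x X" "z \<in> insert x X" "y \<noteq> z"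
        then show "\<epsilon> \<le> dist y z"
          using * X by (auto simp: sep_def not_less dist_commute)
      qed (use X that in \<open>auto simp: sep_def\<close>)
      moreover have "finite X" using X by (simp add: sep_def)
      ultimately show False using max[of "insert x X"] by simp
    qed
    obtain h where h: "bij_betw h {0..<card X} X"
      using ex_bij_betw_nat_finite[of X] X by (auto simp: sep_def)
    define D where "D i = (if i < card X then ball (h i) \<epsilon> else {})" for i
    have "D \<in> hausdorff_covers (2 * \<epsilon>) B"
    proof -
      have "B \<subseteq> (\<Union>i. D i)"
      proof
        fix x assume "x \<in> B"
        then obtain y where "y \<in> X" "dist y x < \<epsilon>" using covered by blast
        moreover have "y \<in> h ` {0..<card X}" using h \<open>y \<in> X\<close> by (simp add: bij_betw_def)
        then obtain i where "i < card X" "y = h i" by auto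
        ultimately show "x \<in> (\<Union>i. D i)" by (auto simp: D_def intro!: exI[of _ i])
      qed
      then show ?thesis using \<epsilon> by (auto simp: hausdorff_covers_def D_def)
    qed
    then have "hausdorff_pre ?s (2 * \<epsilon>) B \<le> (\<Sum>i. hausdorff_gauge ?s (D i))"
      unfolding hausdorff_pre_def by (rule INF_lower)
    also have "\<dots> = (\<Sum>i<card X. hausdorff_gauge ?s (D i))"
      by (intro suminf_finite) (auto simp: D_def hausdorff_gauge_def)
    also have "\<dots> = (\<Sum>i<card X. ennreal (unit_ball_vol (real ?s) * \<epsilon> ^ ?s))"
      using \<epsilon> by (intro sum.cong) (auto simp: D_def hausdorff_gauge_def)
    also have "\<dots> = ennreal (real (card X) * (unit_ball_vol (real ?s) * \<epsilon> ^ ?s))"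
      using \<epsilon> by (simp add: ennreal_of_nat_eq_real_of_nat flip: ennreal_mult)
    also have "\<dots> \<le> ennreal (C * (real (card X) * (real J * v)))"
    proof (rule ennreal_leI)
      have "\<epsilon> ^ ?m = \<epsilon> * \<epsilon> ^ ?s"
        by (subst power_eq_if) simp
      then have "v = unit_ball_vol (real ?m) * (\<kappa> / 2) ^ ?m * (\<epsilon> * \<epsilon> ^ ?s)"
        by (simp add: v_def r_def power_mult_distrib power_divide)
      then have Cv: "C * v = 2 * unit_ball_vol (real ?s) * (\<epsilon> * \<epsilon> ^ ?s)"
        using \<kappa>(1) less_imp_neq[OF unit_ball_vol_pos[of "real ?m"]] by (simp add: C_def)
      have *: "C * (real (card X) * (real J * v))
          = (2 * real J * \<epsilon>) * (real (card X) * (unit_ball_vol (real ?s) * \<epsilon> ^ ?s))"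
      proof -
        have "C * (real (card X) * (real J * v)) = real (card X) * real J * (C * v)"
          by (simp only: ac_simps)
        also have "\<dots> = (2 * real J * \<epsilon>) * (real (card X) * (unit_ball_vol (real ?s) * \<epsilon> ^ ?s))"
          unfolding Cv by (simp only: ac_simps)
        finally show ?thesis .
      qed
      show "real (card X) * (unit_ball_vol (real ?s) * \<epsilon> ^ ?s) \<le> C * (real (card X) * (real J * v))"
        unfolding * using J2 \<epsilon> mult_right_mono[OF J2, of "real (card X) * (unit_ball_vol (real ?s) * \<epsilon> ^ ?s)"]
        by simp
    qed
    also have "\<dots> = ennreal C * ennreal (real (card X) * (real J * v))"
      using C v by (intro ennreal_mult) auto
    also have "\<dots> \<le> ennreal C * emeasure lborel U"
      by (intro mult_left_mono count X) auto
    finally show ?thesis .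
  qed
  show thesis by (rule that[OF C main])
qed

text \<open>For \<epsilon> \<le> 1 one fixed ball contains all the balls around the cone, so the
  volume bound is uniform in the scale.\<close>

lemma hausdorff_outer_unit_sphere_finite: "hausdorff_outer (DIM('v) - 1) (unit_sphere p) < \<infinity>"
proof -
  obtain C where C: "C > 0"
    "\<And>\<epsilon> B U. 0 < \<epsilon> \<Longrightarrow> \<epsilon> \<le> 1 \<Longrightarrow> B \<subseteq> unit_sphere p \<Longrightarrow> U \<in> sets lborel \<Longrightarrow>
      (\<And>x t. x \<in> B \<Longrightarrow> 1 \<le> t \<Longrightarrow> t \<le> 2 \<Longrightarrow> ball (t *\<^sub>R x) \<epsilon> \<subseteq> U) \<Longrightarrow>
      hausdorff_pre (DIM('v) - 1) (2 * \<epsilon>) B \<le> ennreal C * emeasure lborel U"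
    using hausdorff_pre_sphere_le_volume by metis
  obtain R where R: "\<And>x. x \<in> unit_sphere p \<Longrightarrow> norm x \<le> R"
    using compact_imp_bounded[OF compact_unit_sphere] by (auto simp: bounded_iff)
  let ?U = "cball (0::'v) (2 * R + 1)"
  have "hausdorff_outer (DIM('v) - 1) (unit_sphere p) \<le> ennreal C * emeasure lborel ?U"
  proof (rule hausdorff_outer_le_scales[of 1])
    fix \<epsilon> :: real assume \<epsilon>: "0 < \<epsilon>" "\<epsilon> \<le> 1"
    show "hausdorff_pre (DIM('v) - 1) (2 * \<epsilon>) (unit_sphere p) \<le> ennreal C * emeasure lborel ?U"
    proof (rule C(2)[OF \<epsilon> order_refl])
      fix x t assume x: "x \<in> unit_sphere p" and t: "1 \<le> t" "t \<le> (2::real)"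
      have "norm (t *\<^sub>R x) \<le> 2 * R"
        using t R[OF x] mult_mono[of t 2 "norm x" R] by simp
      show "ball (t *\<^sub>R x) \<epsilon> \<subseteq> ?U"
      proof
        fix y assume "y \<in> ball (t *\<^sub>R x) \<epsilon>"
        then show "y \<in> ?U"
          using \<epsilon>(2) norm_triangle_ineq[of "t *\<^sub>R x" "y - t *\<^sub>R x"] \<open>norm (t *\<^sub>R x) \<le> 2 * R\<close>
          by (simp add: dist_norm norm_minus_commute)
      qed
    qed auto
  qed auto
  also have "\<dots> < \<infinity>"
    using emeasure_compact_finite[OF compact_cball, of "0::'v" "2 * R + 1"]
    by (auto simp: ennreal_mult_less_top)
  finally show ?thesis .
qed

text \<open>Compactness makes cones Borel, and it later gives a neighbourhood of uniform width
  inside an open superset.\<close>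

lemma compact_cone:
  assumes "compact B"
  shows "compact ((\<lambda>(t, x). t *\<^sub>R x) ` ({1..2::real} \<times> (B :: 'v set)))"
  by (intro compact_continuous_image compact_Times assms)
    (auto simp: case_prod_unfold intro!: continuous_intros)

text \<open>Outer regularity encloses the null cone in an open set of volume at most
  \<open>\<eta> / C\<close>. By compactness that set contains balls of one common radius around all
  points of the cone, so the volume estimate yields at most \<eta>.\<close>

lemma hausdorff_outer_eq_0_of_null_cone:
  assumes B: "compact B" "B \<subseteq> unit_sphere p"
    and null: "(\<lambda>(t, x). t *\<^sub>R x) ` ({1..2::real} \<times> B) \<in> null_sets lborel" (is "?K \<in> _")
  shows "hausdorff_outer (DIM('v) - 1) B = 0"
proof -
  obtain C where C: "C > 0"
    "\<And>\<epsilon> B U. 0 < \<epsilon> \<Longrightarrow> \<epsilon> \<le> 1 \<Longrightarrow> B \<subseteq> unit_sphere p \<Longrightarrow> U \<in> sets lborel \<Longrightarrow>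
      (\<And>x t. x \<in> B \<Longrightarrow> 1 \<le> t \<Longrightarrow> t \<le> 2 \<Longrightarrow> ball (t *\<^sub>R x) \<epsilon> \<subseteq> U) \<Longrightarrow>
      hausdorff_pre (DIM('v) - 1) (2 * \<epsilon>) B \<le> ennreal C * emeasure lborel U"
    using hausdorff_pre_sphere_le_volume by metis
  have K: "compact ?K" by (rule compact_cone[OF B(1)])
  have "hausdorff_outer (DIM('v) - 1) B \<le> 0 + ennreal \<eta>" if "\<eta> > 0" for \<eta>
  proof -
    have "?K \<in> sets lebesgue" and K0: "emeasure lebesgue ?K = 0"
      using null null_sets_completionI[OF null] by auto
    then obtain T where T: "open T" "?K \<subseteq> T" "emeasure lebesgue (T - ?K) < ennreal (\<eta> / C)"
      using sets_lebesgue_outer_open[of ?K "\<eta> / C"] \<open>\<eta> > 0\<close> C(1) by (metis divide_pos_pos)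
    have "emeasure lborel T = emeasure lebesgue T" using T(1) by simp
    also have "\<dots> = emeasure lebesgue ((T - ?K) \<union> ?K)" using T(2) by (simp add: Un_absorb2)
    also have "\<dots> \<le> emeasure lebesgue (T - ?K) + emeasure lebesgue ?K"
      using T(1) \<open>?K \<in> sets lebesgue\<close> by (intro emeasure_subadditive) auto
    also have "\<dots> \<le> ennreal (\<eta> / C)" using T(3) K0 by simp
    finally have T': "emeasure lborel T \<le> ennreal (\<eta> / C)" .
    obtain e where e: "0 < e" "(\<Union>x\<in>?K. ball x e) \<subseteq> T"
      using compact_subset_open_imp_ball_epsilon_subset[OF K T(1,2)] by blast
    have "hausdorff_outer (DIM('v) - 1) B \<le> ennreal C * emeasure lborel T"
    proof (rule hausdorff_outer_le_scales[of "min e 1"])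
      fix \<epsilon> :: real assume \<epsilon>: "0 < \<epsilon>" "\<epsilon> \<le> min e 1"
      show "hausdorff_pre (DIM('v) - 1) (2 * \<epsilon>) B \<le> ennreal C * emeasure lborel T"
      proof (rule C(2)[OF _ _ B(2)])
        fix x t assume "x \<in> B" "1 \<le> t" "t \<le> (2::real)"
        then have "t *\<^sub>R x \<in> ?K" by (auto intro!: image_eqI[of _ _ "(t, x)"])
        then have "ball (t *\<^sub>R x) e \<subseteq> T" using e(2) by blast
        then show "ball (t *\<^sub>R x) \<epsilon> \<subseteq> T" using \<epsilon> subset_ball[of \<epsilon> e] by auto
      qed (use \<epsilon> T(1) in auto)
    qed (use e in auto)
    also have "\<dots> \<le> ennreal C * ennreal (\<eta> / C)" by (intro mult_left_mono T') auto
    also have "\<dots> = ennreal \<eta>" using C(1) \<open>\<eta> > 0\<close> by (simp flip: ennreal_mult)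
    finally show ?thesis by simp
  qed
  then have "hausdorff_outer (DIM('v) - 1) B \<le> 0" by (rule ennreal_le_epsilon)
  then show ?thesis by simp
qed

text \<open>The comparison in the other direction: the cone over a set of diameter below \<rho> is
  covered by about 1/\<rho> balls of radius \<open>R' * \<rho>\<close>, whose volumes add up to
  order \<rho> to the power \<open>DIM('v) - 1\<close>.\<close>

lemma cone_volume_le_gauge:
  obtains K where "K > 0"
    "\<And>E. E \<subseteq> unit_sphere p \<Longrightarrow> compact E \<Longrightarrow> diameter E < 1 \<Longrightarrow>
      emeasure lborel ((\<lambda>(t, x). t *\<^sub>R x) ` ({1..2::real} \<times> E)) \<le> ennreal K * hausdorff_gauge (DIM('v) - 1) E"
proof -
  obtain R where "\<And>x. x \<in> unit_sphere p \<Longrightarrow> norm x \<le> R"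
    using compact_imp_bounded[OF compact_unit_sphere] by (auto simp: bounded_iff)
  then have R: "norm x \<le> max R 0" if "x \<in> unit_sphere p" for x using that by force
  let ?m = "DIM('v)" and ?s = "DIM('v) - 1"
  \<comment> \<open>The 2 bounds the stretch \<open>t\<close> of the error \<open>x - w\<close>;
    \<open>max R 0\<close> bounds \<open>norm w\<close>, which multiplies the radial error.\<close>
  define R' where "R' = 2 + max R 0"
  have R': "R' > 0" by (simp add: R'_def)
  define K0 where "K0 = 2 * (unit_ball_vol (real ?m) * R' ^ ?m)"
  have K0: "K0 > 0" using R' by (simp add: K0_def)
  \<comment> \<open>The added factors undo the normalisation in \<open>hausdorff_gauge\<close>: the
    ball volume and the halved diameter.\<close>
  define K where "K = K0 / unit_ball_vol (real ?s) * 2 ^ ?s"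
  have K: "K > 0" using K0 by (simp add: K_def)
  have main: "emeasure lborel ((\<lambda>(t, x). t *\<^sub>R x) ` ({1..2::real} \<times> E)) \<le> ennreal K * hausdorff_gauge ?s E"
    if E: "E \<subseteq> unit_sphere p" "compact E" "diameter E < 1" for E
  proof (cases "E = {}")
    case False
    then obtain w where w: "w \<in> E" by blast
    let ?A = "(\<lambda>(t, x). t *\<^sub>R x) ` ({1..2::real} \<times> E)"
    have bd: "bounded E" using E(2) by (rule compact_imp_bounded)
    \<comment> \<open>Taking \<rho> strictly above the diameter avoids division by 0 for one-point
      sets; the bound passes to the limit afterwards.\<close>
    have bound: "emeasure lborel ?A \<le> ennreal (K0 * \<rho> ^ ?s)" if \<rho>: "diameter E < \<rho>" "\<rho> \<le> 1" for \<rho>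
    proof -
      have "\<rho> > 0" using diameter_ge_0[OF bd] \<rho> by linarith
      define J where "J = nat \<lceil>1 / \<rho>\<rceil>"
      have "0 < 1 / \<rho>" using \<open>\<rho> > 0\<close> by simp
      then have "real J = of_int \<lceil>1 / \<rho>\<rceil>" unfolding J_def by (intro of_nat_nat) linarith
      then have J0: "1 / \<rho> \<le> real J" "real J < 1 / \<rho> + 1" by linarith+
      then have "J \<ge> 1" using \<open>0 < 1 / \<rho>\<close> by (cases J) auto
      have J1: "real J * \<rho> \<le> 2"
      proof -
        have "1 / \<rho> \<ge> 1" using \<rho> \<open>\<rho> > 0\<close> by simp
        then have "real J \<le> 2 / \<rho>" using J0(2) by linarith
        then show ?thesis using \<open>\<rho> > 0\<close> by (simp add: field_simps)
      qed
      have cover: "?A \<subseteq> (\<Union>j<J. cball ((1 + real j * \<rho>) *\<^sub>R w) (R' * \<rho>))"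
      proof
        fix y assume "y \<in> ?A"
        then obtain t x where y: "y = t *\<^sub>R x" "1 \<le> t" "t \<le> 2" "x \<in> E" by auto
        \<comment> \<open>At \<open>t = 2\<close> the floor equals \<open>J\<close>, one too many,
          when \<open>1 / \<rho>\<close> is an integer; hence the separate case.\<close>
        define j where "j = (if t = 2 then J - 1 else nat \<lfloor>(t - 1) / \<rho>\<rfloor>)"
        have j: "j < J \<and> \<bar>t - (1 + real j * \<rho>)\<bar> \<le> \<rho>"
        proof (cases "t = 2")
          case True
          have "real j = real J - 1" using True \<open>J \<ge> 1\<close> by (simp add: j_def)
          moreover have "1 \<le> real J * \<rho>" using J0(1) \<open>\<rho> > 0\<close> by (simp add: field_simps)
          moreover have "real J * \<rho> < 1 + \<rho>" using J0(2) \<open>\<rho> > 0\<close> by (simp add: field_simps)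
          ultimately show ?thesis using True \<open>J \<ge> 1\<close> by (auto simp: j_def algebra_simps)
        next
          case False
          then have "(t - 1) / \<rho> < 1 / \<rho>" using y \<open>\<rho> > 0\<close> by (simp add: divide_strict_right_mono)
          moreover have "0 \<le> (t - 1) / \<rho>" using y \<open>\<rho> > 0\<close> by simp
          moreover from this have "real j = of_int \<lfloor>(t - 1) / \<rho>\<rfloor>" using False by (simp add: j_def)
          then have jr: "real j \<le> (t - 1) / \<rho>" "(t - 1) / \<rho> < real j + 1" by linarith+
          ultimately have "real j < real J" using J0(1) by linarith
          moreover have "real j * \<rho> \<le> t - 1" "t - 1 < (real j + 1) * \<rho>"
            using jr \<open>\<rho> > 0\<close> by (simp_all add: field_simps)
          ultimately show ?thesis by (simp add: algebra_simps)
        qed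
        have "dist y ((1 + real j * \<rho>) *\<^sub>R w) = norm (t *\<^sub>R (x - w) + (t - (1 + real j * \<rho>)) *\<^sub>R w)"
          by (simp add: y dist_norm algebra_simps)
        also have "\<dots> \<le> t * norm (x - w) + \<bar>t - (1 + real j * \<rho>)\<bar> * norm w"
          using y norm_triangle_ineq[of "t *\<^sub>R (x - w)" "(t - (1 + real j * \<rho>)) *\<^sub>R w"] by simp
        also have "\<dots> \<le> 2 * \<rho> + \<rho> * max R 0"
        proof (intro add_mono mult_mono)
          show "norm (x - w) \<le> \<rho>"
            using diameter_bounded_bound[OF bd y(4) w] \<rho> by (simp add: dist_norm)
          show "norm w \<le> max R 0" using R w E(1) by blast
        qed (use y j \<open>\<rho> > 0\<close> in auto)
        finally have "dist y ((1 + real j * \<rho>) *\<^sub>R w) \<le> R' * \<rho>"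
          by (simp add: R'_def algebra_simps)
        then show "y \<in> (\<Union>j<J. cball ((1 + real j * \<rho>) *\<^sub>R w) (R' * \<rho>))"
          using j by (auto simp: dist_commute)
      qed
      have "emeasure lborel ?A \<le> emeasure lborel (\<Union>j<J. cball ((1 + real j * \<rho>) *\<^sub>R w) (R' * \<rho>))"
        using cover by (rule emeasure_mono) auto
      also have "\<dots> \<le> (\<Sum>j<J. emeasure lborel (cball ((1 + real j * \<rho>) *\<^sub>R w) (R' * \<rho>)))"
        by (rule emeasure_subadditive_finite) auto
      also have "\<dots> = ennreal (real J * (unit_ball_vol (real ?m) * (R' * \<rho>) ^ ?m))"
        using R' \<open>\<rho> > 0\<close> by (simp add: emeasure_cball ennreal_of_nat_eq_real_of_nat flip: ennreal_mult)
      also have "\<dots> \<le> ennreal (K0 * \<rho> ^ ?s)"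
      proof (rule ennreal_leI)
        have m: "\<rho> ^ ?m = \<rho> * \<rho> ^ ?s"
          by (subst power_eq_if) simp
        have "real J * (unit_ball_vol (real ?m) * (R' * \<rho>) ^ ?m)
            = (real J * \<rho>) * (unit_ball_vol (real ?m) * R' ^ ?m * \<rho> ^ ?s)"
          by (simp add: power_mult_distrib m)
        also have "\<dots> \<le> 2 * (unit_ball_vol (real ?m) * R' ^ ?m * \<rho> ^ ?s)"
          using R' \<open>\<rho> > 0\<close> J1 by (intro mult_right_mono) auto
        finally show "real J * (unit_ball_vol (real ?m) * (R' * \<rho>) ^ ?m) \<le> K0 * \<rho> ^ ?s"
          by (simp add: K0_def)
      qed
      finally show ?thesis .
    qed
    have "emeasure lborel ?A \<le> ennreal (K0 * diameter E ^ ?s)"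
    proof (rule tendsto_lowerbound)
      show "((\<lambda>\<rho>. ennreal (K0 * \<rho> ^ ?s)) \<longlongrightarrow> ennreal (K0 * diameter E ^ ?s)) (at_right (diameter E))"
        by (intro tendsto_intros)
      show "\<forall>\<^sub>F \<rho> in at_right (diameter E). emeasure lborel ?A \<le> ennreal (K0 * \<rho> ^ ?s)"
        using eventually_at_right_real[OF E(3)] by eventually_elim (rule bound; simp)
    qed simp
    also have "\<dots> = ennreal K * hausdorff_gauge ?s E"
      using False K0 diameter_ge_0[OF bd] less_imp_neq[OF unit_ball_vol_pos[of "real ?s"]]
      by (simp add: K_def hausdorff_gauge_def power_divide flip: ennreal_mult)
    finally show ?thesis .
  qed simp
  show thesis by (rule that[OF K main])
qed

text \<open>A cover of the sphere induces a cover of its cone, which contains a nonempty open shell.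
  At scale 1/2 the gauges therefore sum to at least a fixed positive multiple of the shell's
  volume.\<close>

lemma hausdorff_outer_unit_sphere_pos: "0 < hausdorff_outer (DIM('v) - 1) (unit_sphere p)"
proof -
  let ?S = "unit_sphere p" and ?s = "DIM('v) - 1"
  let ?cone = "\<lambda>E. (\<lambda>(t, x). t *\<^sub>R x) ` ({1..2::real} \<times> E)"
  obtain K where K: "K > 0" "\<And>E. E \<subseteq> ?S \<Longrightarrow> compact E \<Longrightarrow> diameter E < 1 \<Longrightarrow>
      emeasure lborel (?cone E) \<le> ennreal K * hausdorff_gauge ?s E"
    using cone_volume_le_gauge by metis
  have op: "open {x. 1 < p x \<and> p x < 2}" by (intro open_Collect_conj open_Collect_less continuous_intros)
  have "{x. 1 < p x \<and> p x < 2} \<noteq> {}"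
  proof -
    obtain i :: 'v where i: "i \<in> Basis" using nonempty_Basis by blast
    then have "i \<noteq> 0" by auto
    moreover from this have "p i > 0" by (rule p_pos)
    ultimately have "p ((3 / 2 / p i) *\<^sub>R i) = 3 / 2" by (simp add: p_scaleR abs_of_pos)
    then have "(3 / 2 / p i) *\<^sub>R i \<in> {x. 1 < p x \<and> p x < 2}" by simp
    then show ?thesis by blast
  qed
  then have "\<not> negligible {x. 1 < p x \<and> p x < 2}"
    by (intro open_not_negligible op)
  moreover have "{x. 1 < p x \<and> p x < 2} \<in> sets lborel" using op by simp
  ultimately have "0 < emeasure lborel {x. 1 < p x \<and> p x < 2}"
    using null_sets_completionI[of "{x. 1 < p x \<and> p x < 2}" lborel]
    by (auto simp: negligible_iff_null_sets null_sets_def zero_less_iff_neq_zero)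
  also have "\<dots> \<le> emeasure lborel (?cone ?S)"
  proof (rule emeasure_mono)
    show "?cone ?S \<in> sets lborel"
      using compact_cone[OF compact_unit_sphere] by (simp add: borel_compact)
    show "{x. 1 < p x \<and> p x < 2} \<subseteq> ?cone ?S"
    proof
      fix x assume "x \<in> {x. 1 < p x \<and> p x < 2}"
      moreover from this have "x \<noteq> 0" by auto
      ultimately have "x = p x *\<^sub>R (inverse (p x) *\<^sub>R x)" "inverse (p x) *\<^sub>R x \<in> ?S" "p x \<in> {1..2}"
        by (auto simp: unit_sphere_def p_scaleR)
      then show "x \<in> ?cone ?S" by (intro image_eqI[of _ _ "(p x, inverse (p x) *\<^sub>R x)"]) auto
    qed
  qed
  also have "\<dots> \<le> ennreal K * hausdorff_pre ?s (1 / 2) ?S"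
  proof -
    have "emeasure lborel (?cone ?S) / ennreal K \<le> hausdorff_pre ?s (1 / 2) ?S"
      unfolding hausdorff_pre_def
    proof (rule INF_greatest)
      fix D :: "nat \<Rightarrow> 'v set" assume D: "D \<in> hausdorff_covers (1 / 2) ?S"
      then have bdD: "bounded (D i)" "diameter (D i) \<le> 1 / 2" for i by (auto simp: hausdorff_covers_def)
      \<comment> \<open>Members of a cover are arbitrary sets. Closing them keeps the diameter, and
        intersecting with the sphere makes them compact, as \<open>cone_volume_le_gauge\<close>
        requires.\<close>
      define E where "E i = closure (D i) \<inter> ?S" for i
      have E: "E i \<subseteq> ?S" "compact (E i)" "diameter (E i) \<le> diameter (D i)" for i
      proof -
        show "E i \<subseteq> ?S" by (simp add: E_def)
        show "compact (E i)"
          unfolding E_def using bdD compact_unit_sphere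
          by (intro compact_Int_closed compact_imp_closed) (auto simp: compact_closure)
        show "diameter (E i) \<le> diameter (D i)"
          using diameter_subset[of "E i" "closure (D i)"] bdD(1)[of i]
          by (simp add: E_def diameter_closure bounded_closure)
      qed
      have gauge: "hausdorff_gauge ?s (E i) \<le> hausdorff_gauge ?s (D i)" for i
      proof (cases "E i = {}")
        case False
        then have "D i \<noteq> {}" by (auto simp: E_def)
        with False show ?thesis
          using E(3)[of i] diameter_ge_0[of "E i"] compact_imp_bounded[OF E(2)]
          by (auto simp: hausdorff_gauge_def intro!: ennreal_leI mult_left_mono power_mono)
      qed (simp add: hausdorff_gauge_def)
      have "?S \<subseteq> (\<Union>i. D i)" using D by (auto simp: hausdorff_covers_def)
      then have cov: "?S \<subseteq> (\<Union>i. E i)" using closure_subset unfolding E_def by blast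
      have "emeasure lborel (?cone ?S) \<le> emeasure lborel (\<Union>i. ?cone (E i))"
      proof (rule emeasure_mono)
        have "{1..2} \<times> ?S \<subseteq> (\<Union>i. {1..2::real} \<times> E i)" using cov by blast
        from image_mono[OF this, of "\<lambda>(t, x). t *\<^sub>R x"]
        show "?cone ?S \<subseteq> (\<Union>i. ?cone (E i))" unfolding image_UN .
        show "(\<Union>i. ?cone (E i)) \<in> sets lborel"
          using compact_cone[OF E(2)] by (intro sets.countable_UN) (auto simp: borel_compact)
      qed
      also have "\<dots> \<le> (\<Sum>i. emeasure lborel (?cone (E i)))"
        using compact_cone[OF E(2)] by (intro emeasure_subadditive_countably) (auto simp: borel_compact)
      also have "\<dots> \<le> (\<Sum>i. ennreal K * hausdorff_gauge ?s (D i))"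
      proof (rule suminf_le)
        fix i
        have "diameter (E i) < 1" using E(3)[of i] bdD(2)[of i] by simp
        then have "emeasure lborel (?cone (E i)) \<le> ennreal K * hausdorff_gauge ?s (E i)"
          by (intro K E)
        also have "\<dots> \<le> ennreal K * hausdorff_gauge ?s (D i)"
          by (intro mult_left_mono gauge) auto
        finally show "emeasure lborel (?cone (E i)) \<le> ennreal K * hausdorff_gauge ?s (D i)" .
      qed auto
      also have "\<dots> = (\<Sum>i. hausdorff_gauge ?s (D i)) * ennreal K" by (simp add: mult.commute)
      finally show "emeasure lborel (?cone ?S) / ennreal K \<le> (\<Sum>i. hausdorff_gauge ?s (D i))"
        using K(1) by (intro divide_le_posI_ennreal) (auto simp: mult.commute)
    qed
    then have "ennreal K * (emeasure lborel (?cone ?S) / ennreal K)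
        \<le> ennreal K * hausdorff_pre ?s (1 / 2) ?S"
      by (rule mult_left_mono) auto
    moreover have "ennreal K * (emeasure lborel (?cone ?S) / ennreal K) = emeasure lborel (?cone ?S)"
      using K(1) ennreal_mult_divide_eq[of "ennreal K" "emeasure lborel (?cone ?S)"]
      by (simp add: ennreal_times_divide mult.commute)
    ultimately show ?thesis by simp
  qed
  also have "\<dots> \<le> ennreal K * hausdorff_outer ?s ?S"
    by (intro mult_left_mono hausdorff_pre_le_outer) auto
  finally show ?thesis by (metis mult_zero_right not_gr_zero)
qed

end

section \<open>Differentiability of the norm almost everywhere on the sphere\<close>

lemma integrable_continuous_bounded_support:
  fixes g :: "'v::euclidean_space \<Rightarrow> real"
  assumes "continuous_on UNIV g" and "\<And>x. r < norm x \<Longrightarrow> g x = 0"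
  shows "integrable lborel g"
proof -
  have "integrable lborel (\<lambda>x. indicator (cball 0 r) x *\<^sub>R g x)"
    using assms(1) by (intro borel_integrable_compact) (auto intro: continuous_on_subset)
  also have "(\<lambda>x. indicator (cball 0 r) x *\<^sub>R g x) = g"
    using assms(2) by (auto simp: fun_eq_iff indicator_def)
  finally show ?thesis .
qed

context norm_on_euclidean begin

text \<open>
  The second difference quotient is tested against the cutoff \<open>max 0 (R + 1 - \<parallel>x\<parallel>)\<close>: summation by
  parts moves one difference onto the cutoff, so the integral is of order \<open>t\<^sup>2\<close>, whereas on the set
  below the integrand is at least of order \<open>t\<close>.
\<close>

lemma null_sets_second_difference_ge:
  assumes c: "c > 0"
  shows "{x. \<forall>t>0. c * t \<le> p (x + t *\<^sub>R v) + p (x - t *\<^sub>R v) - 2 * p x} \<in> null_sets lborel"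
    (is "?F \<in> _")
proof -
  have F: "?F = (\<Inter>t\<in>{0<..}. {x. c * t \<le> p (x + t *\<^sub>R v) + p (x - t *\<^sub>R v) - 2 * p x})" by auto
  have "closed ?F" unfolding F by (intro closed_INT ballI closed_Collect_le continuous_intros)
  then have Fm: "?F \<in> sets lborel" by auto
  have null: "emeasure lborel (?F \<inter> cball 0 R) = 0" if "R \<ge> 0" for R :: real
  proof -
    \<comment> \<open>At least 1 on \<open>cball 0 R\<close>, Lipschitz with constant 1, and zero
      from radius \<open>R + 1\<close> on. The radius \<open>r\<close> leaves room for shifts by
      \<open>t *\<^sub>R v\<close> with t \<le> 1.\<close>
    define \<phi> where "\<phi> x = max 0 (R + 1 - norm x)" for x :: 'v
    define r where "r = R + 1 + norm v"
    define V where "V = measure lborel (cball (0::'v) r)"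
    define M where "M = measure lborel (?F \<inter> cball 0 R)"
    define L where "L = norm v * p v * V"
    have cont: "continuous_on UNIV (\<lambda>x. \<phi> (f x))" if "continuous_on UNIV f" for f :: "'v \<Rightarrow> 'v"
      unfolding \<phi>_def by (intro continuous_intros that)
    have "c * M \<le> t * L" if t: "0 < t" "t \<le> 1" for t
    proof -
      let ?T = "t *\<^sub>R v"
      have supp: "\<phi> x = 0 \<and> \<phi> (x + ?T) = 0" if x: "r < norm x" for x
      proof -
        have "norm ?T \<le> norm v" using t by (simp add: mult_left_le_one_le)
        moreover have "norm x \<le> norm (x + ?T) + norm ?T"
          using norm_triangle_ineq4[of "x + ?T" ?T] by simp
        ultimately have "R + 1 \<le> norm x" "R + 1 \<le> norm (x + ?T)"
          using x norm_ge_zero[of v] unfolding r_def by linarith+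
        then show ?thesis unfolding \<phi>_def by simp
      qed
      have i1: "integrable lborel (\<lambda>x. \<phi> x * (p (x + ?T) - p x))"
        using supp by (intro integrable_continuous_bounded_support[of _ r] continuous_intros cont) auto
      have i2: "integrable lborel (\<lambda>x. \<phi> (x + ?T) * (p (x + ?T) - p x))"
        using supp by (intro integrable_continuous_bounded_support[of _ r] continuous_intros cont) auto
      have i3: "integrable lborel (\<lambda>x. \<phi> x * (p x - p (x - ?T)))"
        using supp by (intro integrable_continuous_bounded_support[of _ r] continuous_intros cont) auto
      \<comment> \<open>Translation invariance of Lebesgue measure is what performs the summation by
        parts.\<close>
      have shift: "(\<integral>x. \<phi> x * (p x - p (x - ?T)) \<partial>lborel) = (\<integral>x. \<phi> (x + ?T) * (p (x + ?T) - p x) \<partial>lborel)"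
      proof -
        have "(\<integral>x. \<phi> x * (p x - p (x - ?T)) \<partial>lborel)
            = (\<integral>x. \<phi> x * (p x - p (x - ?T)) \<partial>distr lborel borel ((+) ?T))"
          by (simp add: lborel_distr_plus)
        also have "\<dots> = (\<integral>x. \<phi> (?T + x) * (p (?T + x) - p (?T + x - ?T)) \<partial>lborel)"
          by (intro integral_distr borel_measurable_continuous_onI) (auto intro!: continuous_intros cont)
        finally show ?thesis by (simp add: add.commute)
      qed
      have "c * t * M = (\<integral>x. c * t * indicator (?F \<inter> cball 0 R) x \<partial>lborel)"
        by (simp add: M_def)
      also have "\<dots> \<le> (\<integral>x. \<phi> x * (p (x + ?T) - p x) - \<phi> x * (p x - p (x - ?T)) \<partial>lborel)"
      proof (rule integral_mono)
        show "integrable lborel (\<lambda>x. c * t * indicator (?F \<inter> cball 0 R) x)"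
          using Fm emeasure_compact_finite[OF compact_cball, of "0::'v" R]
            emeasure_mono[of "?F \<inter> cball 0 R" "cball 0 R" lborel]
          by (intro integrable_mult_right integrable_real_indicator) (auto simp: le_less_trans)
        show "integrable lborel (\<lambda>x. \<phi> x * (p (x + ?T) - p x) - \<phi> x * (p x - p (x - ?T)))"
          by (intro Bochner_Integration.integrable_diff i1 i3)
        fix x
        define \<Delta> where "\<Delta> = p (x + ?T) + p (x - ?T) - 2 * p x"
        have eq: "\<phi> x * (p (x + ?T) - p x) - \<phi> x * (p x - p (x - ?T)) = \<phi> x * \<Delta>"
          by (simp add: \<Delta>_def algebra_simps)
        \<comment> \<open>By convexity the integrand is nonnegative everywhere, so discarding the
          points outside the set only lowers the integral.\<close>
        have "\<Delta> \<ge> 0"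
          using p_triangle[of "x + ?T" "x - ?T"] p_scaleR[of 2 x]
          by (simp add: \<Delta>_def flip: scaleR_2)
        moreover have "\<phi> x \<ge> 0" by (simp add: \<phi>_def)
        moreover have "1 * (c * t) \<le> \<phi> x * \<Delta>" if "x \<in> ?F \<inter> cball 0 R"
          using that t c by (intro mult_mono) (auto simp: \<phi>_def \<Delta>_def)
        ultimately show "c * t * indicator (?F \<inter> cball 0 R) x
            \<le> \<phi> x * (p (x + ?T) - p x) - \<phi> x * (p x - p (x - ?T))"
          unfolding eq by (auto simp: indicator_def)
      qed
      also have "\<dots> = (\<integral>x. \<phi> x * (p (x + ?T) - p x) - \<phi> (x + ?T) * (p (x + ?T) - p x) \<partial>lborel)"
        by (simp add: i1 i2 i3 shift)
      also have "\<dots> \<le> (\<integral>x. t * norm v * (t * p v) * indicator (cball (0::'v) r) x \<partial>lborel)"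
      proof (rule integral_mono)
        show "integrable lborel (\<lambda>x. t * norm v * (t * p v) * indicator (cball (0::'v) r) x)"
          using emeasure_compact_finite[OF compact_cball, of "0::'v" r]
          by (intro integrable_mult_right integrable_real_indicator) auto
        show "integrable lborel (\<lambda>x. \<phi> x * (p (x + ?T) - p x) - \<phi> (x + ?T) * (p (x + ?T) - p x))"
          by (intro Bochner_Integration.integrable_diff i1 i2)
        fix x
        show "\<phi> x * (p (x + ?T) - p x) - \<phi> (x + ?T) * (p (x + ?T) - p x)
            \<le> t * norm v * (t * p v) * indicator (cball 0 r) x"
        proof (cases "norm x \<le> r")
          case True
          have "\<bar>\<phi> x - \<phi> (x + ?T)\<bar> \<le> \<bar>norm x - norm (x + ?T)\<bar>" unfolding \<phi>_def by linarith
          also have "\<dots> \<le> norm ?T" using norm_triangle_ineq3[of x "x + ?T"] by simp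
          finally have 1: "\<bar>\<phi> x - \<phi> (x + ?T)\<bar> \<le> t * norm v" using t by simp
          have 2: "\<bar>p (x + ?T) - p x\<bar> \<le> t * p v"
            using abs_p_diff_le[of "x + ?T" x] t by (simp add: p_scaleR)
          have "\<phi> x * (p (x + ?T) - p x) - \<phi> (x + ?T) * (p (x + ?T) - p x)
              = (\<phi> x - \<phi> (x + ?T)) * (p (x + ?T) - p x)" by (simp add: algebra_simps)
          also have "\<dots> \<le> \<bar>\<phi> x - \<phi> (x + ?T)\<bar> * \<bar>p (x + ?T) - p x\<bar>"
            by (metis abs_ge_self abs_mult)
          also have "\<dots> \<le> (t * norm v) * (t * p v)" using 1 2 t by (intro mult_mono) auto
          finally show ?thesis using True by simp
        next
          case False
          then show ?thesis using supp[of x] by simp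
        qed
      qed
      also have "\<dots> = t * (t * L)" by (simp add: L_def V_def)
      finally have "t * (c * M) \<le> t * (t * L)" by (simp add: mult.assoc mult.left_commute)
      then show ?thesis using t by simp
    qed
    \<comment> \<open>One factor \<open>t\<close> has been cancelled; letting the other tend to 0
      forces \<open>c * M \<le> 0\<close>.\<close>
    then have "\<forall>\<^sub>F t in at_right 0. c * M \<le> t * L"
      unfolding eventually_at_right_field by (intro exI[of _ 1]) auto
    moreover have "((\<lambda>t. t * L) \<longlongrightarrow> 0 * L) (at_right 0)" by (intro tendsto_intros)
    ultimately have "c * M \<le> 0 * L" by (intro tendsto_lowerbound) auto
    then have "M \<le> 0" using c by (simp add: mult_le_0_iff not_less)
    then have "M = 0" unfolding M_def by (simp add: measure_le_0_iff)
    moreover have "emeasure lborel (?F \<inter> cball 0 R) \<noteq> \<infinity>"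
      using emeasure_compact_finite[OF compact_cball, of "0::'v" R]
        emeasure_mono[of "?F \<inter> cball 0 R" "cball 0 R" lborel] by (auto simp: top_unique)
    ultimately show ?thesis
      using emeasure_eq_ennreal_measure[of lborel "?F \<inter> cball 0 R"] unfolding M_def
      by (simp only: ennreal_0 infinity_ennreal_def not_False_eq_True simp_thms)
  qed
  have "(\<Union>n::nat. cball (0::'v) (real n)) = UNIV"
  proof (intro equalityI subsetI UNIV_I)
    fix x :: 'v
    obtain n :: nat where "norm x \<le> real n" using real_arch_simple by blast
    then show "x \<in> (\<Union>n::nat. cball 0 (real n))" by auto
  qed
  then have "?F = (\<Union>n::nat. ?F \<inter> cball 0 (real n))"
    unfolding Int_UN_distrib[symmetric] by (rule ssubst) (rule Int_UNIV_right[symmetric])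
  moreover have "(\<Union>n::nat. ?F \<inter> cball 0 (real n)) \<in> null_sets lborel"
    using null Fm by (intro null_sets_UN null_setsI) auto
  ultimately show ?thesis by simp
qed

text \<open>By convexity the second difference divided by \<open>t\<close> is nondecreasing in
  \<open>t\<close>, so such a \<open>c\<close> exists exactly when the left and right derivatives of
  \<open>p\<close> at \<open>w\<close> in direction \<open>i\<close> differ.\<close>

definition nonsmooth :: "'v set" where
  "nonsmooth = {w \<in> unit_sphere p. \<exists>i\<in>Basis. \<exists>c>0. \<forall>t>0. c * t \<le> p (w + t *\<^sub>R i) + p (w - t *\<^sub>R i) - 2 * p w}"

lemma hausdorff_outer_nonsmooth: "hausdorff_outer (DIM('v) - 1) nonsmooth = 0"
proof -
  let ?F = "\<lambda>i c. {x. \<forall>t>0. c * t \<le> p (x + t *\<^sub>R i) + p (x - t *\<^sub>R i) - 2 * p x}"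
  \<comment> \<open>Restricting \<open>c\<close> to the values \<open>1 / real (Suc n)\<close> gives
    countably many pieces, each closed in the sphere and hence compact, as the null cone criterion
    demands.\<close>
  define B where "B i n = unit_sphere p \<inter> ?F i (1 / real (Suc n))" for i n
  have B0: "hausdorff_outer (DIM('v) - 1) (B i n) = 0" for i n
  proof (rule hausdorff_outer_eq_0_of_null_cone)
    have F: "?F i c = (\<Inter>t\<in>{0<..}. {x. c * t \<le> p (x + t *\<^sub>R i) + p (x - t *\<^sub>R i) - 2 * p x})" for c by auto
    show cB: "compact (B i n)"
      unfolding B_def F
      by (intro compact_Int_closed compact_unit_sphere closed_INT ballI closed_Collect_le continuous_intros)
    show "B i n \<subseteq> unit_sphere p" by (simp add: B_def)
    have "(\<lambda>(t, x). t *\<^sub>R x) ` ({1..2} \<times> B i n) \<subseteq> ?F i (1 / real (Suc n))"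
    proof clarify
      fix t x and u :: real assume t: "t \<in> {1..2::real}" and x: "x \<in> B i n" and u: "0 < u"
      \<comment> \<open>Homogeneity: the second difference at \<open>t *\<^sub>R x\<close> with step
        \<open>u\<close> is \<open>t\<close> times the one at \<open>x\<close> with step
        \<open>u / t\<close>, so one constant serves the whole ray.\<close>
      have "1 / real (Suc n) * (u / t) \<le> p (x + (u / t) *\<^sub>R i) + p (x - (u / t) *\<^sub>R i) - 2 * p x"
      proof -
        have "\<forall>u>0. 1 / real (Suc n) * u \<le> p (x + u *\<^sub>R i) + p (x - u *\<^sub>R i) - 2 * p x"
          using x unfolding B_def by blast
        moreover have "0 < u / t" using t u by simp
        ultimately show ?thesis by blast
      qed
      then have "t * (1 / real (Suc n) * (u / t))
          \<le> t * (p (x + (u / t) *\<^sub>R i) + p (x - (u / t) *\<^sub>R i) - 2 * p x)"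
        using t by (intro mult_left_mono) auto
      also have "\<dots> = p (t *\<^sub>R (x + (u / t) *\<^sub>R i)) + p (t *\<^sub>R (x - (u / t) *\<^sub>R i)) - 2 * p (t *\<^sub>R x)"
      proof -
        have "\<bar>t\<bar> = t" using t by simp
        then show ?thesis by (simp only: p_scaleR) (simp only: distrib_left right_diff_distrib mult.left_commute)
      qed
      also have "t *\<^sub>R (x + (u / t) *\<^sub>R i) = t *\<^sub>R x + u *\<^sub>R i" using t by (simp add: scaleR_right_distrib)
      also have "t *\<^sub>R (x - (u / t) *\<^sub>R i) = t *\<^sub>R x - u *\<^sub>R i" using t by (simp add: scaleR_right_diff_distrib)
      finally show "1 / real (Suc n) * u \<le> p (t *\<^sub>R x + u *\<^sub>R i) + p (t *\<^sub>R x - u *\<^sub>R i) - 2 * p (t *\<^sub>R x)"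
        using t by simp
    qed
    then show "(\<lambda>(t, x). t *\<^sub>R x) ` ({1..2} \<times> B i n) \<in> null_sets lborel"
    proof (rule null_sets_subset[rotated 2])
      show "?F i (1 / real (Suc n)) \<in> null_sets lborel" by (rule null_sets_second_difference_ge) simp
      show "(\<lambda>(t, x). t *\<^sub>R x) ` ({1..2} \<times> B i n) \<in> sets lborel"
        using compact_cone[OF cB] by (simp add: borel_compact)
    qed
  qed
  have "nonsmooth \<subseteq> (\<Union>i\<in>Basis. \<Union>n. B i n)"
  proof
    fix w assume "w \<in> nonsmooth"
    then obtain i c where i: "w \<in> unit_sphere p" "i \<in> Basis" "c > 0"
      "\<And>t. t > 0 \<Longrightarrow> c * t \<le> p (w + t *\<^sub>R i) + p (w - t *\<^sub>R i) - 2 * p w"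
      by (auto simp: nonsmooth_def)
    obtain n where "1 / real (Suc n) < c" using nat_approx_posE[OF i(3)] by blast
    then have n: "1 / real (Suc n) * t \<le> c * t" if "t > 0" for t
      using that by (intro mult_right_mono) auto
    have "1 / real (Suc n) * t \<le> p (w + t *\<^sub>R i) + p (w - t *\<^sub>R i) - 2 * p w" if "t > 0" for t
      by (rule order_trans[OF n[OF that] i(4)[OF that]])
    then have "w \<in> B i n" using i(1) unfolding B_def by blast
    then show "w \<in> (\<Union>i\<in>Basis. \<Union>n. B i n)" using i(2) by blast
  qed
  moreover have "(\<Union>i\<in>Basis. \<Union>n. B i n) = (\<Union>n. \<Union>i\<in>Basis. B i n)" by blast
  moreover have "hausdorff_outer (DIM('v) - 1) (\<Union>i\<in>I. B i n) = 0" if "finite I" for I n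
    using that
  proof (induction I)
    case (insert i I)
    then show ?case
      using hausdorff_outer_Un[of "DIM('v) - 1" "B i n" "\<Union>i\<in>I. B i n"] B0 by simp
  qed simp
  ultimately have sub: "nonsmooth \<subseteq> (\<Union>n. \<Union>i\<in>Basis. B i n)"
    and 0: "hausdorff_outer (DIM('v) - 1) (\<Union>i\<in>Basis. B i n) = 0" for n
    by auto
  have "hausdorff_outer (DIM('v) - 1) nonsmooth \<le> hausdorff_outer (DIM('v) - 1) (\<Union>n. \<Union>i\<in>Basis. B i n)"
    by (rule hausdorff_outer_mono[OF sub])
  also have "\<dots> \<le> (\<Sum>n. hausdorff_outer (DIM('v) - 1) (\<Union>i\<in>Basis. B i n))"
    by (rule hausdorff_outer_subadditive)
  finally show ?thesis by (simp only: 0 suminf_zero le_zero_eq)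
qed

text \<open>Norm equivalence bounds the functional on the unit ball of \<open>p\<close>, so the real
  supremum in \<open>dual_norm\<close> is a genuine upper bound; homogeneity extends the estimate to
  all vectors.\<close>

lemma norming_functional_le:
  assumes "norming_functional p w f"
  shows "blinfun_apply f x \<le> p x" "blinfun_apply f w = 1"
proof -
  show "blinfun_apply f w = 1" using assms by (simp add: norming_functional_def)
  obtain a where a: "0 < a" "\<And>x. a * norm x \<le> p x" using norm_equivalence by metis
  have bdd: "bdd_above ((\<lambda>x. \<bar>blinfun_apply f x\<bar>) ` {x. p x \<le> 1})"
  proof (rule bdd_aboveI2)
    fix x assume "x \<in> {x. p x \<le> 1}"
    then have "norm x \<le> 1 / a" using a(1) a(2)[of x] by (simp add: field_simps)
    then have "norm f * norm x \<le> norm f * (1 / a)" by (intro mult_left_mono) auto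
    then show "\<bar>blinfun_apply f x\<bar> \<le> norm f * (1 / a)"
      using norm_blinfun[of f x] by simp
  qed
  show "blinfun_apply f x \<le> p x"
  proof (cases "x = 0")
    case False
    then have "0 < p x" by (rule p_pos)
    then have "\<bar>blinfun_apply f (inverse (p x) *\<^sub>R x)\<bar> \<le> dual_norm p f"
      unfolding dual_norm_def by (intro cSUP_upper bdd) (use False in \<open>simp add: p_scaleR\<close>)
    then have "\<bar>blinfun_apply f x\<bar> / p x \<le> 1"
      using assms \<open>0 < p x\<close> by (simp add: norming_functional_def blinfun.scaleR_right abs_mult divide_inverse mult.commute)
    then show ?thesis using \<open>0 < p x\<close> by (simp add: pos_divide_le_eq)
  qed simp
qed

text \<open>Off \<open>nonsmooth\<close> these are the coordinates of the only norming functional.\<close>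

definition right_partial :: "'v \<Rightarrow> 'v \<Rightarrow> real" where
  "right_partial i w = (INF t\<in>{0<..}. (p (w + t *\<^sub>R i) - p w) / t)"

lemma right_partial_bdd: "bdd_below ((\<lambda>t. (p (w + t *\<^sub>R i) - p w) / t) ` {0<..})"
proof (rule bdd_belowI2)
  fix t :: real assume t: "t \<in> {0<..}"
  have "p w - p (w + t *\<^sub>R i) \<le> t * p i"
    using abs_p_diff_le[of w "w + t *\<^sub>R i"] t by (simp add: p_minus p_scaleR)
  then show "- p i \<le> (p (w + t *\<^sub>R i) - p w) / t" using t by (simp add: field_simps)
qed

text \<open>The one-sided derivative is written as an infimum over all steps for this purpose: an
  infimum of continuous functions has open strict sublevel sets.\<close>

lemma borel_measurable_right_partial [measurable]: "right_partial i \<in> borel_measurable borel"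
proof (rule borel_measurableI_less)
  fix y
  have "{w \<in> space borel. right_partial i w < y} = (\<Union>t\<in>{0<..}. {w. (p (w + t *\<^sub>R i) - p w) / t < y})"
    unfolding right_partial_def by (auto simp: cINF_less_iff right_partial_bdd)
  moreover have "open \<dots>" by (intro open_UN ballI open_Collect_less continuous_intros) auto
  ultimately show "{w \<in> space borel. right_partial i w < y} \<in> sets borel" by simp
qed

text \<open>A functional below \<open>p\<close> that touches it at \<open>w\<close> lies below every
  right difference quotient, and above the left ones by testing at \<open>w - t *\<^sub>R i\<close>;
  at a smooth point the two sides come arbitrarily close. The assumptions on \<open>f\<close> are
  pointwise so that \<open>f\<close> may also be a composite with an isometry.\<close>

lemma norming_eq_right_partial:
  assumes w: "w \<in> unit_sphere p" "w \<notin> nonsmooth" and i: "i \<in> Basis"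
    and f: "\<And>x. blinfun_apply f x \<le> p x" "blinfun_apply f w = 1"
  shows "blinfun_apply f i = right_partial i w"
proof (rule antisym)
  have pw: "p w = 1" using w by (simp add: unit_sphere_def)
  have up: "blinfun_apply f i \<le> (p (w + t *\<^sub>R i) - p w) / t" if "t > 0" for t
    using f(1)[of "w + t *\<^sub>R i"] f(2) that pw
    by (simp add: blinfun.add_right blinfun.scaleR_right field_simps)
  show "blinfun_apply f i \<le> right_partial i w"
    unfolding right_partial_def by (rule cINF_greatest) (auto intro: up)
  show "right_partial i w \<le> blinfun_apply f i"
  proof (rule field_le_epsilon)
    fix c :: real assume "c > 0"
    then obtain t where t: "t > 0" "p (w + t *\<^sub>R i) + p (w - t *\<^sub>R i) - 2 * p w < c * t"
      using w i unfolding nonsmooth_def by (auto simp: not_le)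
    have "1 - t * blinfun_apply f i \<le> p (w - t *\<^sub>R i)"
      using f(1)[of "w - t *\<^sub>R i"] f(2) by (simp add: blinfun.diff_right blinfun.scaleR_right)
    then have "p (w + t *\<^sub>R i) - p w \<le> (blinfun_apply f i + c) * t"
      using t pw by (simp add: algebra_simps)
    then have "(p (w + t *\<^sub>R i) - p w) / t \<le> blinfun_apply f i + c" using t by (simp add: field_simps)
    moreover have "right_partial i w \<le> (p (w + t *\<^sub>R i) - p w) / t"
      unfolding right_partial_def using t by (intro cINF_lower right_partial_bdd) auto
    ultimately show "right_partial i w \<le> blinfun_apply f i + c" by linarith
  qed
qed

end

section \<open>Isometries and the operator \<open>T\<close>\<close>

lemma blinfun_apply_rank_one [simp]: "blinfun_apply (rank_one w f) z = blinfun_apply f z *\<^sub>R w"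
  by transfer simp

text \<open>Separates the coordinates of \<open>f\<close> from operators linear in \<open>w\<close>,
  which reduces measurability to those coordinates.\<close>

lemma rank_one_expansion:
  fixes w :: "'v::euclidean_space"
  shows "rank_one w f = (\<Sum>i\<in>Basis. blinfun_apply f i *\<^sub>R rank_one w (blinfun_inner_left i))"
proof (rule blinfun_euclidean_eqI)
  fix j :: 'v assume j: "j \<in> Basis"
  have "(\<Sum>i\<in>Basis. blinfun_apply f i *\<^sub>R (j \<bullet> i) *\<^sub>R w)
      = (\<Sum>i\<in>Basis. if i = j then blinfun_apply f j *\<^sub>R w else 0)"
    using j by (intro sum.cong) (auto simp: inner_Basis)
  with j show "blinfun_apply (rank_one w f) j
      = blinfun_apply (\<Sum>i\<in>Basis. blinfun_apply f i *\<^sub>R rank_one w (blinfun_inner_left i)) j"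
    by (simp add: blinfun.sum_left blinfun.scaleR_left)
qed

lemma bounded_linear_rank_one_left: "bounded_linear (\<lambda>w :: 'v::euclidean_space. rank_one w f)"
  by (intro linear_conv_bounded_linear[THEN iffD1] linearI)
    (auto intro!: blinfun_eqI simp: blinfun.add_left blinfun.scaleR_left algebra_simps)

text \<open>Boundedness and linearity allow the trace to move inside the Bochner integral.\<close>

lemma bounded_linear_trace_compose:
  assumes "linear (L :: 'v::euclidean_space \<Rightarrow> 'v)"
  shows "bounded_linear (\<lambda>R. operator_trace (\<lambda>x. L (blinfun_apply R x)))"
  unfolding operator_trace_def
proof (intro bounded_linear_sum bounded_linear_compose[OF bounded_linear_inner_left])
  fix i :: 'v
  have "bounded_linear L" using assms by (simp add: linear_conv_bounded_linear)
  then show "bounded_linear (\<lambda>R. L (blinfun_apply R i))"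
    by (rule bounded_linear_compose) (rule bounded_linear_intros)+
qed

lemma trace_compose_rank_one:
  assumes "linear (L :: 'v::euclidean_space \<Rightarrow> 'v)"
  shows "operator_trace (\<lambda>x. L (blinfun_apply (rank_one w f) x)) = blinfun_apply f (L w)"
proof -
  have "blinfun_apply f (L w) = blinfun_apply f (\<Sum>i\<in>Basis. (L w \<bullet> i) *\<^sub>R i)"
    by (simp add: euclidean_representation)
  then show ?thesis
    using assms by (simp add: operator_trace_def linear_scale blinfun.sum_right blinfun.scaleR_right mult.commute)
qed

context norm_on_euclidean begin

abbreviation "\<H> \<equiv> hausdorff_measure (DIM('v) - 1) :: 'v measure"
abbreviation "\<mu> \<equiv> hypersurface_measure p"

lemma unit_sphere_in_sets: "unit_sphere p \<in> sets \<H>"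
  using borel_subset_sets_hausdorff_measure compact_unit_sphere borel_compact by blast

text \<open>In \<open>ennreal\<close> the product \<open>1 / h * h\<close> is 0 both for
  \<open>h = 0\<close> and for \<open>h = top\<close>; positivity and finiteness of the measure of
  the sphere rule these out.\<close>

lemma hypersurface_factor: "1 / emeasure \<H> (unit_sphere p) \<noteq> 0"
    "1 / emeasure \<H> (unit_sphere p) * emeasure \<H> (unit_sphere p) = 1"
proof -
  let ?h = "emeasure \<H> (unit_sphere p)"
  have h: "?h \<noteq> 0" "?h \<noteq> top"
    unfolding emeasure_hausdorff_measure[OF unit_sphere_in_sets]
    using hausdorff_outer_unit_sphere_pos hausdorff_outer_unit_sphere_finite by auto
  then show "1 / ?h \<noteq> 0" by (simp add: ennreal_divide_eq_0_iff)
  show "1 / ?h * ?h = 1"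
    using h ennreal_mult_divide_eq[of ?h 1] by (simp add: ennreal_times_divide mult.commute)
qed

lemma space_hypersurface_measure: "space \<mu> = unit_sphere p"
  by (simp add: hypersurface_measure_def Let_def space_scale_measure space_restrict_space)

lemma sets_hypersurface_measure: "A \<in> sets \<mu> \<longleftrightarrow> A \<subseteq> unit_sphere p \<and> A \<in> sets \<H>"
  using unit_sphere_in_sets
  by (simp add: hypersurface_measure_def Let_def sets_restrict_space_iff)

lemma emeasure_hypersurface_measure:
  assumes "A \<in> sets \<mu>"
  shows "emeasure \<mu> A = 1 / emeasure \<H> (unit_sphere p) * hausdorff_outer (DIM('v) - 1) A"
  using assms unit_sphere_in_sets emeasure_hausdorff_measure[of A]
  by (simp add: hypersurface_measure_def Let_def emeasure_restrict_space sets_restrict_space_iff)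

lemma null_sets_hypersurface_measure:
  "A \<in> null_sets \<mu> \<longleftrightarrow> A \<subseteq> unit_sphere p \<and> hausdorff_outer (DIM('v) - 1) A = 0"
  using hypersurface_factor(1) hausdorff_outer_zero_sets[of "DIM('v) - 1" A]
  by (auto simp: null_sets_def sets_hypersurface_measure emeasure_hypersurface_measure)

lemma emeasure_space_hypersurface_measure: "emeasure \<mu> (space \<mu>) = 1"
proof -
  have S: "unit_sphere p \<in> sets \<mu>" using unit_sphere_in_sets by (simp add: sets_hypersurface_measure)
  show ?thesis
    unfolding space_hypersurface_measure emeasure_hypersurface_measure[OF S]
    using hypersurface_factor(2) unfolding emeasure_hausdorff_measure[OF unit_sphere_in_sets] .
qed

lemma finite_measure_hypersurface_measure: "finite_measure \<mu>"
  by (rule finite_measureI) (simp add: emeasure_space_hypersurface_measure)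

lemma borel_measurable_hypersurface_measure:
  assumes "f \<in> measurable borel N"
  shows "f \<in> measurable \<mu> N"
proof (rule measurableI)
  fix A assume "A \<in> sets N"
  then have "f -` A \<inter> space borel \<in> sets borel" using assms by (rule measurable_sets[rotated])
  then have "f -` A \<in> sets \<H>" using borel_subset_sets_hausdorff_measure by auto
  then show "f -` A \<inter> space \<mu> \<in> sets \<mu>"
    using unit_sphere_in_sets by (auto simp: sets_hypersurface_measure space_hypersurface_measure)
qed (use measurable_space[OF assms] in auto)

text \<open>Inside a null set \<open>N\<close> every set is measurable, so the values of
  \<open>f\<close> there may be arbitrary. This is how a mere almost everywhere choice of norming
  functionals becomes measurable.\<close>

lemma measurable_hypersurface_measure_AE_eq:
  fixes f g :: "'v \<Rightarrow> 'b::topological_space"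
  assumes g: "g \<in> borel_measurable \<mu>" and eq: "AE w in \<mu>. f w = g w"
  shows "f \<in> borel_measurable \<mu>"
proof (rule measurableI)
  fix A :: "'b set" assume A: "A \<in> sets borel"
  obtain N where "{w \<in> space \<mu>. f w \<noteq> g w} \<subseteq> N" "emeasure \<mu> N = 0" "N \<in> sets \<mu>"
    using eq by (rule AE_E)
  then have N: "{w \<in> space \<mu>. f w \<noteq> g w} \<subseteq> N" "N \<in> null_sets \<mu>" by (auto intro: null_setsI)
  have "f -` A \<inter> N \<in> null_sets \<mu>"
    using N(2) hausdorff_outer_mono[of "f -` A \<inter> N" N "DIM('v) - 1"]
    by (auto simp: null_sets_hypersurface_measure)
  moreover have "(g -` A \<inter> space \<mu>) - N \<in> sets \<mu>"
    using g A N(2) by (intro sets.Diff measurable_sets) auto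
  ultimately have "((g -` A \<inter> space \<mu>) - N) \<union> (f -` A \<inter> N) \<in> sets \<mu>" by auto
  also have "((g -` A \<inter> space \<mu>) - N) \<union> (f -` A \<inter> N) = f -` A \<inter> space \<mu>"
    using N null_setsD2[OF N(2)] sets.sets_into_space[of N \<mu>] by auto
  finally show "f -` A \<inter> space \<mu> \<in> sets \<mu>" .
qed simp

lemma AE_not_nonsmooth: "AE w in \<mu>. w \<in> unit_sphere p \<and> w \<notin> nonsmooth"
proof (rule AE_I')
  show "nonsmooth \<in> null_sets \<mu>"
    using hausdorff_outer_nonsmooth by (auto simp: null_sets_hypersurface_measure nonsmooth_def)
qed (auto simp: space_hypersurface_measure)

lemma distr_hypersurface_measure:
  assumes Q: "orthogonal_transformation Q" "\<And>x. p (Q x) = p x"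
  shows "Q \<in> measurable \<mu> \<mu>" "distr \<mu> \<mu> Q = \<mu>"
proof -
  have iso: "dist (Q x) (Q y) = dist x y" for x y
    using Q(1) by (simp add: orthogonal_transformation_isometry)
  have surj: "surj Q" using Q(1) by (rule orthogonal_transformation_surj)
  have S: "Q -` A \<inter> unit_sphere p = Q -` A" if "A \<subseteq> unit_sphere p" for A
    using that Q(2) by (auto simp: unit_sphere_def)
  have sets: "Q -` A \<inter> space \<mu> \<in> sets \<mu>" if "A \<in> sets \<mu>" for A
    using that sets_hausdorff_measure_isometry_vimage[OF iso surj] S[of A] Q(2)
    by (auto simp: sets_hypersurface_measure space_hypersurface_measure unit_sphere_def)
  show meas: "Q \<in> measurable \<mu> \<mu>"
    using sets Q(2) by (intro measurableI) (auto simp: space_hypersurface_measure unit_sphere_def)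
  show "distr \<mu> \<mu> Q = \<mu>"
  proof (rule measure_eqI)
    fix A assume A: "A \<in> sets (distr \<mu> \<mu> Q)"
    then have AS: "A \<in> sets \<mu>" "A \<subseteq> unit_sphere p" by (auto simp: sets_hypersurface_measure)
    have "emeasure (distr \<mu> \<mu> Q) A = emeasure \<mu> (Q -` A)"
      using AS meas S[of A] by (simp add: emeasure_distr space_hypersurface_measure)
    also have "\<dots> = emeasure \<mu> A"
      using AS sets[OF AS(1)] S[of A] hausdorff_outer_isometry_vimage[OF iso surj, of "DIM('v) - 1" A]
      by (simp add: emeasure_hypersurface_measure space_hypersurface_measure)
    finally show "emeasure (distr \<mu> \<mu> Q) A = emeasure \<mu> A" .
  qed simp
qed

context
  fixes sharp :: "'v \<Rightarrow> 'v \<Rightarrow>\<^sub>L real"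
  assumes sharp: "AE w in \<mu>. norming_functional p w (sharp w)"
begin

lemma AE_norming:
  "AE w in \<mu>. w \<in> unit_sphere p \<and> w \<notin> nonsmooth \<and> blinfun_apply (sharp w) w = 1 \<and>
    (\<forall>x. blinfun_apply (sharp w) x \<le> p x)"
  using sharp AE_not_nonsmooth by eventually_elim (auto dest: norming_functional_le)

lemma borel_measurable_rank_one_sharp: "(\<lambda>w. rank_one w (sharp w)) \<in> borel_measurable \<mu>"
proof (rule measurable_hypersurface_measure_AE_eq)
  \<comment> \<open>A Borel representative: the coordinates of \<open>sharp w\<close> are replaced
    by the one-sided partial derivatives.\<close>
  define g where "g w = (\<Sum>i\<in>Basis. right_partial i w *\<^sub>R rank_one w (blinfun_inner_left i))" for w
  have [measurable]: "(\<lambda>w. rank_one w f) \<in> borel_measurable borel" for f :: "'v \<Rightarrow>\<^sub>L real"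
    by (intro borel_measurable_continuous_onI linear_continuous_on bounded_linear_rank_one_left)
  have "g \<in> borel_measurable borel" unfolding g_def by measurable
  then show "g \<in> borel_measurable \<mu>" by (rule borel_measurable_hypersurface_measure)
  show "AE w in \<mu>. rank_one w (sharp w) = g w"
    using AE_norming
  proof eventually_elim
    case (elim w)
    then show ?case
      unfolding g_def by (subst rank_one_expansion) (intro sum.cong; simp add: norming_eq_right_partial)
  qed
qed

lemma integrable_rank_one_sharp: "integrable \<mu> (\<lambda>w. rank_one w (sharp w))"
proof -
  obtain a b where ab: "0 < a" "0 < b" "\<And>x. a * norm x \<le> p x" "\<And>x. p x \<le> b * norm x"
    using norm_equivalence by metis
  interpret finite_measure \<mu> by (rule finite_measure_hypersurface_measure)
  show ?thesis
  proof (rule integrable_const_bound)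
    \<comment> \<open>The functional contributes \<open>b\<close> and the vector
      \<open>1 / a\<close>, both through comparison of \<open>p\<close> with the Euclidean
      norm.\<close>
    show "AE w in \<mu>. norm (rank_one w (sharp w)) \<le> b / a"
      using AE_norming
    proof eventually_elim
      case (elim w)
      show ?case
      proof (rule norm_blinfun_bound)
        fix x
        have "blinfun_apply (sharp w) x \<le> p x" "blinfun_apply (sharp w) (- x) \<le> p (- x)"
          using elim by blast+
        then have "blinfun_apply (sharp w) x \<le> p x" "- blinfun_apply (sharp w) x \<le> p x"
          by (simp_all add: blinfun.minus_right p_minus)
        then have "\<bar>blinfun_apply (sharp w) x\<bar> \<le> b * norm x" using ab(4)[of x] by linarith
        moreover have "norm w \<le> 1 / a"
          using ab(1) ab(3)[of w] elim by (simp add: unit_sphere_def field_simps)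
        ultimately have "\<bar>blinfun_apply (sharp w) x\<bar> * norm w \<le> (b * norm x) * (1 / a)"
          using ab by (intro mult_mono) auto
        then show "norm (blinfun_apply (rank_one w (sharp w)) x) \<le> b / a * norm x" by simp
      qed (use ab in auto)
    qed
  qed (rule borel_measurable_rank_one_sharp)
qed

lemma integral_rank_one_sharp_commutes:
  assumes Q: "orthogonal_transformation (blinfun_apply Q)" "\<And>x. p (blinfun_apply Q x) = p x"
  shows "(\<integral>w. rank_one w (sharp w) \<partial>\<mu>) o\<^sub>L Q = Q o\<^sub>L (\<integral>w. rank_one w (sharp w) \<partial>\<mu>)"
proof -
  let ?F = "\<lambda>w. rank_one w (sharp w)"
  note distr = distr_hypersurface_measure[OF Q]
  have [measurable]: "blinfun_apply Q \<in> measurable \<mu> \<mu>" by (rule distr)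
  note [measurable] = borel_measurable_rank_one_sharp
  have comp1: "bounded_linear (\<lambda>R. R o\<^sub>L Q)" and comp2: "bounded_linear (\<lambda>R. Q o\<^sub>L R)"
    by (rule bounded_bilinear.bounded_linear_left[OF bounded_bilinear_blinfun_compose]
        bounded_bilinear.bounded_linear_right[OF bounded_bilinear_blinfun_compose])+
  have int: "integrable \<mu> (\<lambda>w. ?F (blinfun_apply Q w))"
    using integrable_rank_one_sharp integrable_distr_eq[of "blinfun_apply Q" \<mu> \<mu> ?F]
    by (simp add: distr(2))
  \<comment> \<open>Since \<open>Q\<close> preserves the measure, what holds for
    \<open>sharp\<close> at almost every \<open>w\<close> also holds at \<open>Q w\<close> for
    almost every \<open>w\<close>.\<close>
  have "AE w in distr \<mu> \<mu> (blinfun_apply Q). blinfun_apply (sharp w) w = 1 \<and>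
    (\<forall>x. blinfun_apply (sharp w) x \<le> p x)"
    unfolding distr(2) using AE_norming by eventually_elim auto
  from AE_distrD[OF distr(1) this] AE_norming
  have AE: "AE w in \<mu>. ?F (blinfun_apply Q w) o\<^sub>L Q = Q o\<^sub>L ?F w"
  proof eventually_elim
    case (elim w)
    \<comment> \<open>The composite is dominated by \<open>p\<close> and takes the value 1 at the
      smooth point \<open>w\<close>, so its coordinates are forced to be those of
      \<open>sharp w\<close>.\<close>
    have "sharp (blinfun_apply Q w) o\<^sub>L Q = sharp w"
    proof (rule blinfun_euclidean_eqI)
      fix i :: 'v assume i: "i \<in> Basis"
      have "blinfun_apply (sharp (blinfun_apply Q w) o\<^sub>L Q) i = right_partial i w"
        using elim Q(2) by (intro norming_eq_right_partial i) (auto, metis)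
      also have "\<dots> = blinfun_apply (sharp w) i"
        using elim by (intro norming_eq_right_partial[symmetric] i) auto
      finally show "blinfun_apply (sharp (blinfun_apply Q w) o\<^sub>L Q) i = blinfun_apply (sharp w) i" .
    qed
    then have "blinfun_apply (sharp (blinfun_apply Q w)) (blinfun_apply Q z) = blinfun_apply (sharp w) z" for z
      by (metis blinfun_apply_blinfun_compose)
    then show ?case by (intro blinfun_eqI) (simp add: blinfun.scaleR_right)
  qed
  have "(\<integral>w. ?F w \<partial>\<mu>) = (\<integral>w. ?F w \<partial>distr \<mu> \<mu> (blinfun_apply Q))" by (simp add: distr(2))
  also have "\<dots> = (\<integral>w. ?F (blinfun_apply Q w) \<partial>\<mu>)" by (rule integral_distr) measurable
  finally have "(\<integral>w. ?F w \<partial>\<mu>) o\<^sub>L Q = (\<integral>w. (?F (blinfun_apply Q w) o\<^sub>L Q) \<partial>\<mu>)"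
    by (simp add: integral_bounded_linear[OF comp1 int])
  also have "\<dots> = (\<integral>w. (Q o\<^sub>L ?F w) \<partial>\<mu>)"
  proof (rule integral_cong_AE[OF _ _ AE])
    show "(\<lambda>w. ?F (blinfun_apply Q w) o\<^sub>L Q) \<in> borel_measurable \<mu>"
      using integrable_bounded_linear[OF comp1 int] by auto
    show "(\<lambda>w. Q o\<^sub>L ?F w) \<in> borel_measurable \<mu>"
      using integrable_bounded_linear[OF comp2 integrable_rank_one_sharp] by auto
  qed
  also have "\<dots> = Q o\<^sub>L (\<integral>w. ?F w \<partial>\<mu>)"
    by (rule integral_bounded_linear[OF comp2 integrable_rank_one_sharp])
  finally show ?thesis .
qed

theorem integral_rank_one_sharp:
  assumes "\<And>Q. Q \<in> G \<Longrightarrow> orthogonal_transformation (blinfun_apply Q)"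
    and "\<And>Q x. Q \<in> G \<Longrightarrow> p (blinfun_apply Q x) = p x"
    and "commutant G \<subseteq> range (\<lambda>c::real. c *\<^sub>R id_blinfun)"
  shows "real DIM('v) *\<^sub>R (\<integral>w. rank_one w (sharp w) \<partial>\<mu>) = id_blinfun"
proof -
  let ?T = "\<integral>w. rank_one w (sharp w) \<partial>\<mu>" and ?tr = "\<lambda>R. operator_trace (\<lambda>x. id (blinfun_apply R x))"
  interpret finite_measure \<mu> by (rule finite_measure_hypersurface_measure)
  have "?T \<in> commutant G"
    unfolding commutant_def using integral_rank_one_sharp_commutes assms(1,2) by blast
  then obtain c where c: "?T = c *\<^sub>R id_blinfun" using assms(3) by blast
  have "?tr ?T = (\<integral>w. ?tr (rank_one w (sharp w)) \<partial>\<mu>)"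
    by (rule integral_bounded_linear[OF bounded_linear_trace_compose integrable_rank_one_sharp, symmetric])
      (rule linear_id)
  also have "\<dots> = (\<integral>w. 1 \<partial>\<mu>)"
  proof (rule integral_cong_AE)
    show "(\<lambda>w. ?tr (rank_one w (sharp w))) \<in> borel_measurable \<mu>"
      using integrable_bounded_linear[OF bounded_linear_trace_compose[OF linear_id] integrable_rank_one_sharp]
      by auto
    show "AE w in \<mu>. ?tr (rank_one w (sharp w)) = 1"
      unfolding trace_compose_rank_one[OF linear_id] unfolding id_apply
      using AE_norming by eventually_elim blast
  qed simp
  also have "\<dots> = 1" by (simp add: measure_def emeasure_space_hypersurface_measure)
  finally have "c * real DIM('v) = 1"
    unfolding c by (simp add: operator_trace_def blinfun.scaleR_left mult.commute)
  then show ?thesis unfolding c by (simp add: mult.commute)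
qed

theorem trace_eq_integral:
  assumes "\<And>Q. Q \<in> G \<Longrightarrow> orthogonal_transformation (blinfun_apply Q)"
    and "\<And>Q x. Q \<in> G \<Longrightarrow> p (blinfun_apply Q x) = p x"
    and "commutant G \<subseteq> range (\<lambda>c::real. c *\<^sub>R id_blinfun)"
    and L: "linear L"
  shows "integrable \<mu> (\<lambda>w. blinfun_apply (sharp w) (L w))"
    and "operator_trace L = real DIM('v) * (\<integral>w. blinfun_apply (sharp w) (L w) \<partial>\<mu>)"
proof -
  let ?tr = "\<lambda>R. operator_trace (\<lambda>x. L (blinfun_apply R x))"
  let ?T = "\<integral>w. rank_one w (sharp w) \<partial>\<mu>"
  note bl = bounded_linear_trace_compose[OF L]
  show "integrable \<mu> (\<lambda>w. blinfun_apply (sharp w) (L w))"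
    using integrable_bounded_linear[OF bl integrable_rank_one_sharp]
    by (simp only: trace_compose_rank_one[OF L])
  have "operator_trace L = ?tr id_blinfun" by simp
  also have "\<dots> = ?tr (real DIM('v) *\<^sub>R ?T)" by (simp only: integral_rank_one_sharp[OF assms(1-3)])
  also have "\<dots> = real DIM('v) * ?tr ?T"
    by (subst bounded_linear.linear[OF bl, THEN linear_scale]) simp
  also have "?tr ?T = (\<integral>w. blinfun_apply (sharp w) (L w) \<partial>\<mu>)"
    using integral_bounded_linear[OF bl integrable_rank_one_sharp]
    by (simp only: trace_compose_rank_one[OF L])
  finally show "operator_trace L = real DIM('v) * (\<integral>w. blinfun_apply (sharp w) (L w) \<partial>\<mu>)" .
qed

end

end

section \<open>Exterior powers\<close>

text \<open>Replaces list update by a prefix and a suffix around the slot, the shape in which the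
  inductions over the slots proceed.\<close>

lemma alternating_form_linear_slot:
  assumes f: "alternating_form k f" and len: "Suc (length us + length zs) = k"
  shows "linear (\<lambda>v. f (us @ v # zs))"
proof -
  have "length (us @ 0 # zs) = k \<and> length us < k" using len by simp
  then have "linear (\<lambda>v. f ((us @ 0 # zs)[length us := v]))"
    using f unfolding alternating_form_def by blast
  then show ?thesis by (simp add: list_update_append)
qed

text \<open>Polarisation: expand the vanishing value with \<open>a + b\<close> in both
  slots.\<close>

lemma alternating_form_swap:
  assumes f: "alternating_form k f" and len: "Suc (Suc (length us + length vs + length zs)) = k"
  shows "f (us @ a # vs @ b # zs) = - f (us @ b # vs @ a # zs)"
proof -
  define h where "h x y = f (us @ x # vs @ y # zs)" for x y
  have h1: "h (x + x') y = h x y + h x' y" for x x' y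
    using linear_add[OF alternating_form_linear_slot[OF f, of us "vs @ y # zs"]] len
    by (simp add: h_def)
  have h2: "h x (y + y') = h x y + h x y'" for x y y'
    using linear_add[OF alternating_form_linear_slot[OF f, of "us @ x # vs" zs]] len
    by (simp add: h_def)
  have "h x x = 0" for x
    using f len unfolding alternating_form_def h_def by simp
  from this[of "a + b"] this[of a] this[of b] have "h a b + h b a = 0"
    by (simp add: h1 h2 add.commute)
  then show ?thesis by (simp add: h_def eq_neg_iff_add_eq_0)
qed

text \<open>One swap brings the required head to the front, and the prefix \<open>ps\<close> then
  absorbs it. The sign is left undetermined, so parities need not be tracked.\<close>

lemma alternating_form_permuted:
  assumes f: "alternating_form k f"
  shows "length ps + length xs = k \<Longrightarrow> mset ys = mset xs \<Longrightarrow>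
    f (ps @ ys) = f (ps @ xs) \<or> f (ps @ ys) = - f (ps @ xs)"
proof (induction xs arbitrary: ps ys)
  case (Cons x xs)
  have IH: "f (ps @ x # ws) = f (ps @ x # xs) \<or> f (ps @ x # ws) = - f (ps @ x # xs)"
    if "mset ws = mset xs" for ws
    using Cons.IH[of "ps @ [x]" ws] Cons.prems that by simp
  obtain y ws where ys: "ys = y # ws" using Cons.prems(2) by (cases ys) auto
  show ?case
  proof (cases "y = x")
    case True
    then show ?thesis using IH[of ws] Cons.prems(2) ys by simp
  next
    case False
    have "x \<in> set ys" using Cons.prems(2) by (metis list.set_intros(1) set_mset_mset)
    then obtain us vs where ws: "ws = us @ x # vs" using False ys by (auto simp: in_set_conv_decomp)
    have ms: "mset (us @ y # vs) = mset xs" using Cons.prems(2) ys ws by simp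
    then have "length (us @ y # vs) = length xs" by (rule mset_eq_length)
    then have "f (ps @ y # us @ x # vs) = - f (ps @ x # us @ y # vs)"
      using Cons.prems(1) by (intro alternating_form_swap[OF f]) simp
    then show ?thesis using IH[OF ms] ys ws by auto
  qed
qed simp

lemma alternating_form_scale:
  assumes f: "alternating_form k f"
  shows "length us + length is = k \<Longrightarrow>
    f (us @ map (\<lambda>i. c i *\<^sub>R v i) is) = prod_list (map c is) *\<^sub>R f (us @ map v is)"
proof (induction "is" arbitrary: us)
  case (Cons i "is")
  have "f (us @ (c i *\<^sub>R v i) # map (\<lambda>i. c i *\<^sub>R v i) is)
      = c i *\<^sub>R f (us @ v i # map (\<lambda>i. c i *\<^sub>R v i) is)"
    using Cons.prems by (intro linear_scale[OF alternating_form_linear_slot[OF f]]) simp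
  also have "f (us @ v i # map (\<lambda>i. c i *\<^sub>R v i) is) = prod_list (map c is) *\<^sub>R f (us @ v i # map v is)"
    using Cons.IH[of "us @ [v i]"] Cons.prems by simp
  finally show ?case by simp
qed simp

lemma orthogonal_transformation_on_spanning_set:
  assumes L: "linear L" and B: "span B = UNIV"
    and eq: "\<And>x y. x \<in> B \<Longrightarrow> y \<in> B \<Longrightarrow> L x \<bullet> L y = x \<bullet> y"
  shows "orthogonal_transformation L"
  unfolding orthogonal_transformation_def
proof (intro conjI allI L)
  fix v w
  show "L v \<bullet> L w = v \<bullet> w"
  proof (rule bilinear_eq[where f = "\<lambda>x y. L x \<bullet> L y" and g = "\<lambda>x y. x \<bullet> y" and S = UNIV and T = UNIV])
    show "bilinear (\<lambda>x y. L x \<bullet> L y)" "bilinear (\<lambda>x y::'a. x \<bullet> y)"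
      unfolding bilinear_def
      by (auto intro!: linearI simp: linear_add[OF L] linear_scale[OF L] inner_add_left inner_add_right)
  qed (use B eq in auto)
qed

text \<open>The complements in \<open>A\<close> also have equal size, so a bijection from
  \<open>I\<close> to \<open>J\<close> extends.\<close>

lemma permutation_moving_subset:
  assumes "finite A" "I \<subseteq> A" "J \<subseteq> A" "card I = card J"
  obtains \<sigma> where "\<sigma> permutes A" "\<sigma> ` I = J"
proof -
  have fin: "finite I" "finite J" using assms finite_subset by auto
  obtain f where f: "bij_betw f I J"
    using finite_same_card_bij[OF fin assms(4)] by blast
  have "card (A - I) = card (A - J)" using assms fin by (simp add: card_Diff_subset)
  then obtain g where g: "bij_betw g (A - I) (A - J)"
    using finite_same_card_bij[of "A - I" "A - J"] assms(1) by blast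
  define \<sigma> where "\<sigma> x = (if x \<in> I then f x else if x \<in> A then g x else x)" for x
  have 1: "bij_betw \<sigma> I J" using f by (rule bij_betw_cong[THEN iffD1, rotated]) (simp add: \<sigma>_def)
  have 2: "bij_betw \<sigma> (A - I) (A - J)"
    using g by (rule bij_betw_cong[THEN iffD1, rotated]) (simp add: \<sigma>_def)
  have "bij_betw \<sigma> (I \<union> (A - I)) (J \<union> (A - J))"
    by (rule bij_betw_combine[OF 1 2]) auto
  then have "bij_betw \<sigma> A A" using assms by (simp add: Un_absorb1)
  then have "\<sigma> permutes A"
    by (rule bij_imp_permutes) (use assms in \<open>auto simp: \<sigma>_def\<close>)
  moreover have "\<sigma> ` I = J" using 1 by (simp add: bij_betw_def)
  ultimately show thesis by (rule that)
qed

locale symmetric_exterior_power =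
  fixes N k :: nat and e :: "nat \<Rightarrow> 'x::real_normed_vector"
    and wedge :: "'x list \<Rightarrow> 'e::euclidean_space"
  assumes symmetric: "one_symmetric_basis N e"
    and k: "1 \<le> k" "k \<le> N"
    and exterior: "exterior_power k wedge"
    and orthonormal: "\<And>I J. I \<subseteq> {1..N} \<Longrightarrow> J \<subseteq> {1..N} \<Longrightarrow> card I = k \<Longrightarrow> card J = k \<Longrightarrow>
           wedge_basis wedge e I \<bullet> wedge_basis wedge e J = (if I = J then 1 else 0)"
begin

lemma basis: "inj_on e {1..N}" "independent (e ` {1..N})" "span (e ` {1..N}) = UNIV"
  using symmetric by (auto simp: one_symmetric_basis_def is_basis_def)

definition coord :: "nat \<Rightarrow> 'x \<Rightarrow> real" where
  "coord i x = representation (e ` {1..N}) x (e i)"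

lemma sum_coord: "(\<Sum>i=1..N. coord i x *\<^sub>R e i) = x"
proof -
  have "(\<Sum>b\<in>e ` {1..N}. representation (e ` {1..N}) x b *\<^sub>R b) = x"
    using basis by (intro real_vector.sum_representation_eq) auto
  then show ?thesis using basis(1) by (simp add: sum.reindex coord_def)
qed

lemma coord_e: "j \<in> {1..N} \<Longrightarrow> i \<in> {1..N} \<Longrightarrow> coord i (e j) = (if i = j then 1 else 0)"
  using basis inj_onD[OF basis(1)]
  by (auto simp: coord_def real_vector.representation_basis)

lemma linear_coord: "linear (coord i)"
  using basis by (intro linearI)
    (auto simp: coord_def real_vector.representation_add real_vector.representation_scale)

lemma linear_eq_on_e:
  assumes "linear f" "linear g" "\<And>i. i \<in> {1..N} \<Longrightarrow> f (e i) = g (e i)"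
  shows "f x = g x"
proof (rule linear_eq_on_span[OF assms(1,2)])
  show "x \<in> span (e ` {1..N})" unfolding basis(3) by simp
qed (use assms(3) in auto)

definition signed_perm :: "(nat \<Rightarrow> real) \<Rightarrow> (nat \<Rightarrow> nat) \<Rightarrow> 'x \<Rightarrow> 'x" where
  "signed_perm \<epsilon> \<sigma> x = (\<Sum>i=1..N. (\<epsilon> i * coord i x) *\<^sub>R e (\<sigma> i))"

lemma linear_signed_perm: "linear (signed_perm \<epsilon> \<sigma>)"
  by (intro linearI)
    (simp_all add: signed_perm_def linear_add[OF linear_coord] linear_scale[OF linear_coord]
      distrib_left scaleR_left_distrib sum.distrib scaleR_sum_right mult.left_commute)

lemma signed_perm_e:
  assumes "j \<in> {1..N}"
  shows "signed_perm \<epsilon> \<sigma> (e j) = \<epsilon> j *\<^sub>R e (\<sigma> j)"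
proof -
  have "signed_perm \<epsilon> \<sigma> (e j) = (\<Sum>i=1..N. if i = j then \<epsilon> j *\<^sub>R e (\<sigma> j) else 0)"
    unfolding signed_perm_def using assms by (intro sum.cong) (auto simp: coord_e)
  then show ?thesis using assms by simp
qed

lemma norm_signed_perm:
  assumes "\<And>i. i \<in> {1..N} \<Longrightarrow> \<epsilon> i \<in> {-1, 1}" "\<sigma> permutes {1..N}"
  shows "norm (signed_perm \<epsilon> \<sigma> x) = norm x"
proof -
  have "norm (\<Sum>i=1..N. (\<epsilon> i * coord i x) *\<^sub>R e (\<sigma> i)) = norm (\<Sum>i=1..N. coord i x *\<^sub>R e i)"
    by (rule symmetric[unfolded one_symmetric_basis_def, THEN conjunct2, THEN spec, THEN spec, THEN spec, THEN mp])
      (use assms in blast)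
  then show ?thesis unfolding signed_perm_def sum_coord .
qed

abbreviation flip :: "nat \<Rightarrow> 'x \<Rightarrow> 'x" where
  "flip i \<equiv> signed_perm (\<lambda>j. if j = i then -1 else 1) id"

abbreviation perm :: "(nat \<Rightarrow> nat) \<Rightarrow> 'x \<Rightarrow> 'x" where
  "perm \<sigma> \<equiv> signed_perm (\<lambda>_. 1) \<sigma>"

lemma e_nonzero: "i \<in> {1..N} \<Longrightarrow> e i \<noteq> 0"
  using basis(2) real_vector.dependent_zero by (metis imageI)

text \<open>Changing the sign of one coordinate preserves the norm and moves \<open>x\<close> by
  \<open>2 * coord i x\<close> times \<open>e i\<close>; the triangle inequality does the
  rest.\<close>

lemma coord_bound:
  assumes i: "i \<in> {1..N}"
  shows "\<bar>coord i x\<bar> \<le> norm x / norm (e i)"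
proof -
  have "x - flip i x = (2 * coord i x) *\<^sub>R e i"
  proof (rule linear_eq_on_e[of "\<lambda>x. x - flip i x" "\<lambda>x. (2 * coord i x) *\<^sub>R e i"])
    show "linear (\<lambda>x. x - flip i x)"
      by (intro linear_compose_sub linear_ident linear_signed_perm)
    show "linear (\<lambda>x. (2 * coord i x) *\<^sub>R e i)"
      by (intro linearI) (simp_all add: linear_add[OF linear_coord] linear_scale[OF linear_coord] algebra_simps)
    fix j assume "j \<in> {1..N}"
    then show "e j - flip i (e j) = (2 * coord i (e j)) *\<^sub>R e i"
      using i by (simp add: signed_perm_e coord_e flip: scaleR_2)
  qed
  then have "2 * \<bar>coord i x\<bar> * norm (e i) = norm (x - flip i x)" by (simp add: abs_mult)
  also have "\<dots> \<le> norm x + norm (flip i x)" by (rule norm_triangle_ineq4)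
  also have "norm (flip i x) = norm x"
    by (intro norm_signed_perm) (auto simp: permutes_id)
  finally show ?thesis using e_nonzero[OF i] by (simp add: field_simps)
qed

lemma alternating_wedge: "alternating_form k wedge"
  using exterior by (simp add: exterior_power_def)

lemma wedge_slot_expansion:
  assumes "Suc (length us + length zs) = k"
  shows "wedge (us @ x # zs) = (\<Sum>i=1..N. coord i x *\<^sub>R wedge (us @ e i # zs))"
proof -
  note lin = alternating_form_linear_slot[OF alternating_wedge assms]
  have "wedge (us @ x # zs) = wedge (us @ (\<Sum>i=1..N. coord i x *\<^sub>R e i) # zs)"
    unfolding sum_coord ..
  then show ?thesis by (simp only: linear_sum[OF lin] linear_scale[OF lin])
qed

text \<open>This is the uniqueness half of the universal property: a functional vanishing on all
  wedges and the zero functional both represent the zero form.\<close>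

lemma span_wedges: "span {wedge xs |xs. length xs = k} = UNIV"
proof (rule ccontr)
  assume "\<not> ?thesis"
  then obtain a :: 'e where a: "a \<noteq> 0" "\<And>x. x \<in> span {wedge xs |xs. length xs = k} \<Longrightarrow> a \<bullet> x = 0"
    using span_not_UNIV_orthogonal by blast
  have "alternating_form k (\<lambda>_ :: 'x list. 0 :: real)"
    by (auto simp: alternating_form_def intro: linearI)
  then have "\<exists>!g. linear g \<and> (\<forall>xs. length xs = k \<longrightarrow> g (wedge xs) = (0::real))"
    using exterior unfolding exterior_power_def by blast
  moreover have "linear (\<lambda>x. a \<bullet> x) \<and> (\<forall>xs. length xs = k \<longrightarrow> a \<bullet> wedge xs = 0)"
    using a(2)[OF span_base] by (auto intro!: linearI simp: inner_add_right)
  moreover have "linear (\<lambda>x::'e. 0::real) \<and> (\<forall>xs::'x list. length xs = k \<longrightarrow> (0::real) = 0)"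
    by (auto intro: linearI)
  ultimately have "(\<lambda>x. a \<bullet> x) = (\<lambda>x. 0)" by (metis (no_types, lifting))
  then have "a \<bullet> a = 0" by metis
  then show False using a(1) by simp
qed

lemma linear_eq_on_wedges:
  assumes "linear f" "linear g" "\<And>xs. length xs = k \<Longrightarrow> f (wedge xs) = g (wedge xs)"
  shows "f w = g w"
proof (rule linear_eq_on_span[OF assms(1,2)])
  show "w \<in> span {wedge xs |xs. length xs = k}" unfolding span_wedges by simp
qed (use assms(3) in auto)

definition index_sets :: "nat set set" where
  "index_sets = {I. I \<subseteq> {1..N} \<and> card I = k}"

abbreviation "eb \<equiv> wedge_basis wedge e"

lemma wedge_map_e:
  assumes "length is = k" "distinct is"
  shows "wedge (map e is) = eb (set is) \<or> wedge (map e is) = - eb (set is)"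
proof -
  have "mset is = mset (sorted_list_of_set (set is))"
    using assms(2) sorted_list_of_mset_set[of "set is"] mset_sorted_list_of_multiset[of "mset_set (set is)"]
    by (simp add: mset_set_set)
  then have "mset (map e is) = mset (map e (sorted_list_of_set (set is)))"
    by (simp only: mset_map)
  moreover have "length ([] :: 'x list) + length (map e (sorted_list_of_set (set is))) = k"
    using assms by (simp add: distinct_card)
  ultimately show ?thesis
    using alternating_form_permuted[OF alternating_wedge, of "[]" "map e (sorted_list_of_set (set is))" "map e is"]
    by (simp add: wedge_basis_def)
qed

text \<open>Slots are expanded from left to right, with \<open>us\<close> holding those already
  turned into basis vectors. At the end a repeated index gives 0, and distinct indices are sorted up
  to a sign.\<close>

lemma span_eb: "span (eb ` index_sets) = UNIV"
proof -
  have "wedge (us @ xs) \<in> span (eb ` index_sets)"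
    if "length us + length xs = k" "set us \<subseteq> e ` {1..N}" for us xs
    using that
  proof (induction xs arbitrary: us)
    case Nil
    have "us \<in> lists (e ` {1..N})" using Nil.prems(2) by auto
    then obtain "is" where iss: "us = map e is" "set is \<subseteq> {1..N}"
      by (auto simp: lists_image)
    show ?case
    proof (cases "distinct us")
      case False
      then show ?thesis
        using alternating_wedge Nil.prems(1) by (simp add: alternating_form_def span_0)
    next
      case True
      then have "distinct is" using iss(1) by (simp add: distinct_map)
      then have "eb (set is) \<in> span (eb ` index_sets)"
        using Nil.prems(1) iss by (intro span_base imageI) (simp add: index_sets_def distinct_card)
      then show ?thesis
        using wedge_map_e[of "is"] \<open>distinct is\<close> Nil.prems(1) iss(1) span_neg by fastforce
    qed
  next
    case (Cons x xs)
    have "wedge ((us @ [e i]) @ xs) \<in> span (eb ` index_sets)" if "i \<in> {1..N}" for i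
      using Cons.prems that by (intro Cons.IH) auto
    then show ?case
      using Cons.prems(1) by (subst wedge_slot_expansion) (auto intro!: span_sum span_scale)
  qed
  from this[of "[]"] have "{wedge xs |xs. length xs = k} \<subseteq> span (eb ` index_sets)" by auto
  then have "span {wedge xs |xs. length xs = k} \<subseteq> span (eb ` index_sets)"
    by (intro span_minimal) auto
  then show ?thesis using span_wedges by auto
qed

lemma eb_inner: "I \<in> index_sets \<Longrightarrow> J \<in> index_sets \<Longrightarrow> eb I \<bullet> eb J = (if I = J then 1 else 0)"
  using orthonormal by (simp add: index_sets_def)

lemma eq_on_eb:
  assumes "\<And>I. I \<in> index_sets \<Longrightarrow> x \<bullet> eb I = y \<bullet> eb I"
  shows "x = y"
proof -
  have "(x - y) \<bullet> z = 0" if "z \<in> span (eb ` index_sets)" for z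
    using that
    by (induction rule: span_induct_alt)
      (use assms in \<open>auto simp: inner_add_right inner_diff_left\<close>)
  from this[of "x - y"] show ?thesis by (simp add: span_eb)
qed

text \<open>Orthonormality makes the spanning family independent. This converts the dimension factor
  of the general formula into the binomial coefficient.\<close>

lemma dim_exterior: "DIM('e) = N choose k"
proof -
  have inj: "inj_on eb index_sets"
    by (rule inj_onI) (metis eb_inner zero_neq_one)
  have "independent (eb ` index_sets)"
  proof (rule pairwise_orthogonal_independent)
    show "pairwise orthogonal (eb ` index_sets)"
      using eb_inner by (auto simp: pairwise_def orthogonal_def)
    show "0 \<notin> eb ` index_sets"
      using eb_inner by (metis imageE inner_zero_left zero_neq_one)
  qed
  then have "card (eb ` index_sets) = dim (UNIV :: 'e set)"
    using span_eb by (metis dim_eq_card dim_span)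
  then have "DIM('e) = card index_sets" using inj by (simp add: card_image)
  also have "\<dots> = N choose k" using n_subsets[of "{1..N}" k] by (simp add: index_sets_def)
  finally show ?thesis .
qed

text \<open>The universal property concerns scalar forms, so each coordinate of
  \<open>wedge (map A xs)\<close> is factored separately and the results are reassembled. It makes
  the description in \<open>exterior_map\<close> meaningful.\<close>

lemma exterior_map_exists:
  assumes A: "linear A"
  shows "\<exists>!L. linear L \<and> (\<forall>xs. length xs = k \<longrightarrow> L (wedge xs) = wedge (map A xs))"
proof -
  have "\<exists>g. linear g \<and> (\<forall>xs. length xs = k \<longrightarrow> g (wedge xs) = wedge (map A xs) \<bullet> b)" for b
  proof -
    have "alternating_form k (\<lambda>xs. wedge (map A xs) \<bullet> b)"
      unfolding alternating_form_def
    proof (intro conjI allI impI)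
      fix xs :: "'x list" and j assume *: "length xs = k \<and> j < k"
      then have "linear (\<lambda>v. wedge ((map A xs)[j := v]))"
        using alternating_wedge by (auto simp: alternating_form_def)
      from linear_compose[OF linear_compose[OF A this], of "\<lambda>z. z \<bullet> b"]
      show "linear (\<lambda>v. wedge (map A (xs[j := v])) \<bullet> b)"
        by (simp add: map_update o_def linearI inner_add_left)
    next
      fix xs :: "'x list" assume "length xs = k \<and> \<not> distinct xs"
      then show "wedge (map A xs) \<bullet> b = 0"
        using alternating_wedge by (simp add: alternating_form_def distinct_map)
    qed
    then show ?thesis using exterior unfolding exterior_power_def by blast
  qed
  then obtain g where g: "\<And>b. linear (g b)"
    "\<And>b xs. length xs = k \<Longrightarrow> g b (wedge xs) = wedge (map A xs) \<bullet> b" by metis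
  show ?thesis
  proof (rule ex1I)
    show "linear (\<lambda>w. \<Sum>b\<in>Basis. g b w *\<^sub>R b) \<and>
        (\<forall>xs. length xs = k \<longrightarrow> (\<Sum>b\<in>Basis. g b (wedge xs) *\<^sub>R b) = wedge (map A xs))"
      by (auto intro!: linearI simp: g(2) linear_add[OF g(1)] linear_scale[OF g(1)]
          euclidean_representation scaleR_left_distrib sum.distrib scaleR_sum_right)
    fix L assume L: "linear L \<and> (\<forall>xs. length xs = k \<longrightarrow> L (wedge xs) = wedge (map A xs))"
    show "L = (\<lambda>w. \<Sum>b\<in>Basis. g b w *\<^sub>R b)"
    proof
      fix w
      have "linear (\<lambda>w. \<Sum>b\<in>Basis. g b w *\<^sub>R b)"
        by (auto intro!: linearI simp: linear_add[OF g(1)] linear_scale[OF g(1)]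
          scaleR_left_distrib sum.distrib scaleR_sum_right)
      with conjunct1[OF L] show "L w = (\<Sum>b\<in>Basis. g b w *\<^sub>R b)"
        by (rule linear_eq_on_wedges) (simp add: L g(2) euclidean_representation)
    qed
  qed
qed

lemma
  assumes "linear A"
  shows linear_exterior_map: "linear (exterior_map k wedge A)"
    and exterior_map_wedge: "length xs = k \<Longrightarrow> exterior_map k wedge A (wedge xs) = wedge (map A xs)"
  using theI'[OF exterior_map_exists[OF assms]] unfolding exterior_map_def by auto

section \<open>The projective exterior norm\<close>

abbreviation "pn \<equiv> projective_exterior_norm k wedge"

abbreviation (input) "cost xss \<equiv> (\<Sum>xs\<leftarrow>xss. prod_list (map norm xs))"

lemma cost_nonneg: "0 \<le> (\<Sum>xs\<leftarrow>xss. prod_list (map norm (xs :: 'x list)))"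
  by (intro sum_list_nonneg) (auto intro!: prod_list_nonneg)

lemma pn_le:
  assumes "\<forall>xs\<in>set xss. length xs = k"
  shows "pn (\<Sum>xs\<leftarrow>xss. wedge xs) \<le> cost xss"
  unfolding projective_exterior_norm_def
  by (rule cInf_lower) (use assms in \<open>auto intro!: bdd_belowI[of _ 0] cost_nonneg\<close>)

text \<open>The first slot exists because k \<ge> 1. Absorbing scalars there keeps decompositions
  free of coefficients.\<close>

lemma wedge_scale:
  assumes "length xs = k"
  shows "wedge (xs[0 := a *\<^sub>R xs ! 0]) = a *\<^sub>R wedge xs"
proof -
  obtain y ys where xs: "xs = y # ys" using assms k by (cases xs) auto
  show ?thesis
    using linear_scale[OF alternating_form_linear_slot[OF alternating_wedge, of "[]" ys], of a y] assms xs
    by simp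
qed

lemma cost_scale:
  assumes "length xs = k"
  shows "prod_list (map norm (xs[0 := a *\<^sub>R xs ! 0])) = \<bar>a\<bar> * prod_list (map norm xs)"
  using assms k by (cases xs) auto

lemma decomposable_sum:
  obtains xss where "\<forall>xs\<in>set xss. length xs = k" "w = (\<Sum>xs\<leftarrow>xss. wedge xs)"
proof -
  have "w \<in> span {wedge xs |xs. length xs = k}" by (simp add: span_wedges)
  then have "\<exists>xss. (\<forall>xs\<in>set xss. length xs = k) \<and> w = (\<Sum>xs\<leftarrow>xss. wedge xs)"
  proof (induction rule: span_induct_alt)
    case base
    show ?case by (intro exI[of _ "[]"]) simp
  next
    case (step c x y)
    then obtain xs xss where "length xs = k" "x = wedge xs"
      "\<forall>xs\<in>set xss. length xs = k" "y = (\<Sum>xs\<leftarrow>xss. wedge xs)" by blast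
    then show ?case
      by (intro exI[of _ "xs[0 := c *\<^sub>R xs ! 0] # xss"]) (simp add: wedge_scale)
  qed
  then show thesis using that by blast
qed

text \<open>Every \<open>w\<close> has a decomposition, so the real infimum is taken over a nonempty
  set.\<close>

lemma pn_greatest:
  assumes "\<And>xss. \<forall>xs\<in>set xss. length xs = k \<Longrightarrow> w = (\<Sum>xs\<leftarrow>xss. wedge xs) \<Longrightarrow> z \<le> cost xss"
  shows "z \<le> pn w"
  unfolding projective_exterior_norm_def
proof (rule cInf_greatest)
  obtain xss where "\<forall>xs\<in>set xss. length xs = k" "w = (\<Sum>xs\<leftarrow>xss. wedge xs)"
    by (rule decomposable_sum)
  then have "cost xss \<in> {cost xss |xss. (\<forall>xs\<in>set xss. length xs = k) \<and> w = (\<Sum>xs\<leftarrow>xss. wedge xs)}"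
    by blast
  then show "{cost xss |xss. (\<forall>xs\<in>set xss. length xs = k) \<and> w = (\<Sum>xs\<leftarrow>xss. wedge xs)} \<noteq> {}"
    by blast
qed (use assms in auto)

text \<open>Expanding a slot in the basis costs a factor \<open>K\<close> by
  \<open>coord_bound\<close>, until only finitely many wedges of basis vectors remain. The estimate
  is what makes the projective norm definite.\<close>

lemma norm_wedge_le:
  obtains C where "C > 0" "\<And>xs. length xs = k \<Longrightarrow> norm (wedge xs) \<le> C * prod_list (map norm xs)"
proof -
  define U where "U = {us. set us \<subseteq> e ` {1..N} \<and> length us = k}"
  have "finite U" unfolding U_def by (intro finite_lists_length_eq) auto
  define M where "M = (\<Sum>us\<in>U. norm (wedge us))"
  define K where "K = (\<Sum>i=1..N. 1 / norm (e i))"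
  have M0: "M \<ge> 0" unfolding M_def by (intro sum_nonneg) auto
  have K0: "K \<ge> 0" unfolding K_def by (intro sum_nonneg) auto
  have bound: "norm (wedge (us @ xs)) \<le> M * K ^ length xs * prod_list (map norm xs)"
    if "length us + length xs = k" "set us \<subseteq> e ` {1..N}" for us xs
    using that
  proof (induction xs arbitrary: us)
    case Nil
    then have "us \<in> U" by (simp add: U_def)
    then show ?case using member_le_sum[of us U "\<lambda>us. norm (wedge us)"] \<open>finite U\<close> by (simp add: M_def)
  next
    case (Cons x xs)
    let ?B = "M * K ^ length xs * prod_list (map norm xs)"
    have B: "norm (wedge (us @ e i # xs)) \<le> ?B" if "i \<in> {1..N}" for i
      using Cons.IH[of "us @ [e i]"] Cons.prems that by simp
    have "norm (wedge (us @ x # xs)) \<le> (\<Sum>i=1..N. \<bar>coord i x\<bar> * norm (wedge (us @ e i # xs)))"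
      using Cons.prems(1) by (subst wedge_slot_expansion) (auto intro!: sum_norm_le)
    also have "\<dots> \<le> (\<Sum>i=1..N. (norm x / norm (e i)) * ?B)"
      by (intro sum_mono mult_mono coord_bound B) auto
    also have "\<dots> = (\<Sum>i=1..N. 1 / norm (e i)) * (norm x * ?B)"
      by (simp only: sum_distrib_right) (simp add: mult.assoc)
    also have "\<dots> = M * K ^ length (x # xs) * prod_list (map norm (x # xs))"
      unfolding K_def[symmetric] by (simp add: ac_simps)
    finally show ?case .
  qed
  show thesis
  proof (rule that[of "M * K ^ k + 1"])
    show "M * K ^ k + 1 > 0" using M0 K0 by (intro add_nonneg_pos mult_nonneg_nonneg) auto
    fix xs :: "'x list" assume xs: "length xs = k"
    have "0 \<le> prod_list (map norm xs)" by (intro prod_list_nonneg) auto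
    then show "norm (wedge xs) \<le> (M * K ^ k + 1) * prod_list (map norm xs)"
      using bound[of "[]" xs] xs by (simp add: distrib_right)
  qed
qed

lemma is_norm_pn: "is_norm pn"
proof -
  have nonneg: "0 \<le> pn w" for w by (intro pn_greatest cost_nonneg)
  have zero: "pn 0 = 0" using pn_le[of "[]"] nonneg[of 0] by simp
  \<comment> \<open>Concatenating decompositions of \<open>v\<close> and \<open>w\<close> adds their
    costs; the two infima are then taken one after the other.\<close>
  have tri: "pn (v + w) \<le> pn v + pn w" for v w
  proof -
    have "pn (v + w) - pn w \<le> pn v"
    proof (rule pn_greatest)
      fix xss assume v: "\<forall>xs\<in>set xss. length xs = k" "v = (\<Sum>xs\<leftarrow>xss. wedge xs)"
      have "pn (v + w) - cost xss \<le> pn w"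
      proof (rule pn_greatest)
        fix yss assume w: "\<forall>xs\<in>set yss. length xs = k" "w = (\<Sum>xs\<leftarrow>yss. wedge xs)"
        show "pn (v + w) - cost xss \<le> cost yss"
        proof -
          have "pn (\<Sum>xs\<leftarrow>xss @ yss. wedge xs) \<le> cost (xss @ yss)"
            using v(1) w(1) by (intro pn_le) auto
          then show ?thesis using v(2) w(2) by simp
        qed
      qed
      then show "pn (v + w) - pn w \<le> cost xss" by simp
    qed
    then show ?thesis by simp
  qed
  have scale_le: "pn (a *\<^sub>R w) \<le> \<bar>a\<bar> * pn w" if "a \<noteq> 0" for a w
  proof -
    have "pn (a *\<^sub>R w) / \<bar>a\<bar> \<le> pn w"
    proof (rule pn_greatest)
      fix xss assume w: "\<forall>xs\<in>set xss. length xs = k" "w = (\<Sum>xs\<leftarrow>xss. wedge xs)"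
      let ?yss = "map (\<lambda>xs. xs[0 := a *\<^sub>R xs ! 0]) xss"
      have "(\<Sum>xs\<leftarrow>?yss. wedge xs) = a *\<^sub>R (\<Sum>xs\<leftarrow>xss. wedge xs)"
        using w(1) by (induction xss) (auto simp: wedge_scale scaleR_right_distrib)
      moreover have "cost ?yss = \<bar>a\<bar> * cost xss"
        using w(1) by (induction xss) (auto simp: cost_scale distrib_left)
      ultimately have "pn (a *\<^sub>R w) \<le> \<bar>a\<bar> * cost xss"
        using pn_le[of ?yss] w by auto
      then show "pn (a *\<^sub>R w) / \<bar>a\<bar> \<le> cost xss" using that by (simp add: field_simps)
    qed
    then show ?thesis using that by (simp add: field_simps)
  qed
  \<comment> \<open>The reverse inequality is \<open>scale_le\<close> for the inverse
    scalar.\<close>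
  have scale: "pn (a *\<^sub>R w) = \<bar>a\<bar> * pn w" for a w
  proof (cases "a = 0")
    case False
    have "pn w \<le> \<bar>inverse a\<bar> * pn (a *\<^sub>R w)"
      using scale_le[of "inverse a" "a *\<^sub>R w"] False by simp
    then have "\<bar>a\<bar> * pn w \<le> \<bar>a\<bar> * (\<bar>inverse a\<bar> * pn (a *\<^sub>R w))"
      by (intro mult_left_mono) auto
    also have "\<dots> = pn (a *\<^sub>R w)" using False by (simp add: abs_inverse flip: mult.assoc)
    finally show ?thesis using scale_le[OF False, of w] by simp
  qed (simp add: zero)
  \<comment> \<open>Each decomposition costs at least \<open>norm w / C\<close>, hence so does the
    infimum.\<close>
  have pos: "w = 0" if "pn w = 0" for w
  proof -
    obtain C where C: "C > 0" "\<And>xs. length xs = k \<Longrightarrow> norm (wedge xs) \<le> C * prod_list (map norm xs)"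
      using norm_wedge_le by metis
    have "norm w / C \<le> pn w"
    proof (rule pn_greatest)
      fix xss assume w: "\<forall>xs\<in>set xss. length xs = k" "w = (\<Sum>xs\<leftarrow>xss. wedge xs)"
      have "norm (\<Sum>xs\<leftarrow>xss. wedge xs) \<le> C * cost xss"
        using w(1)
      proof (induction xss)
        case (Cons xs xss)
        then show ?case
          using C(2)[of xs] norm_triangle_ineq[of "wedge xs" "\<Sum>xs\<leftarrow>xss. wedge xs"]
          by (simp add: distrib_left)
      qed simp
      then show "norm w / C \<le> cost xss" using w C(1) by (simp add: field_simps)
    qed
    then show ?thesis using that C(1) by (simp add: divide_le_0_iff)
  qed
  show ?thesis unfolding is_norm_def using zero pos tri scale by blast
qed

text \<open>Applying \<open>Q\<close> to every factor turns a decomposition of \<open>w\<close> into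
  one of its image at the same cost.\<close>

lemma pn_exterior_map_le:
  assumes Q: "linear Q" "\<And>x. norm (Q x) = norm x"
  shows "pn (exterior_map k wedge Q w) \<le> pn w"
proof (rule pn_greatest)
  fix xss assume w: "\<forall>xs\<in>set xss. length xs = k" "w = (\<Sum>xs\<leftarrow>xss. wedge xs)"
  note lin = linear_exterior_map[OF Q(1)]
  have "exterior_map k wedge Q (\<Sum>xs\<leftarrow>xss. wedge xs) = (\<Sum>xs\<leftarrow>map (map Q) xss. wedge xs)"
    using w(1) by (induction xss) (auto simp: linear_0[OF lin] linear_add[OF lin] exterior_map_wedge[OF Q(1)])
  moreover have "cost (map (map Q) xss) = cost xss"
    by (simp add: o_def Q(2))
  ultimately show "pn (exterior_map k wedge Q w) \<le> cost xss"
    using pn_le[of "map (map Q) xss"] w by simp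
qed

lemma pn_exterior_map:
  assumes Q: "linear Q" "\<And>x. norm (Q x) = norm x"
    and Q': "linear Q'" "\<And>x. norm (Q' x) = norm x" "\<And>x. Q' (Q x) = x"
  shows "pn (exterior_map k wedge Q w) = pn w"
proof (rule antisym)
  have "exterior_map k wedge Q' (exterior_map k wedge Q w) = w"
    using linear_eq_on_wedges[OF linear_compose[OF linear_exterior_map[OF Q(1)] linear_exterior_map[OF Q'(1)]]
        linear_ident, of w]
    by (simp add: exterior_map_wedge Q(1) Q'(1,3) o_def)
  then show "pn w \<le> pn (exterior_map k wedge Q w)"
    using pn_exterior_map_le[OF Q'(1,2), of "exterior_map k wedge Q w"] by simp
qed (rule pn_exterior_map_le[OF Q])

section \<open>Signed permutations acting on the exterior power\<close>

lemma exterior_map_signed_perm_eb: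
  assumes I: "I \<in> index_sets" and \<sigma>: "\<sigma> permutes {1..N}"
  shows "exterior_map k wedge (signed_perm \<epsilon> \<sigma>) (eb I)
    = (\<Prod>i\<in>I. \<epsilon> i) *\<^sub>R wedge (map e (map \<sigma> (sorted_list_of_set I)))"
proof -
  have I': "finite I" "I \<subseteq> {1..N}" "card I = k"
    using I finite_subset[of I "{1..N}"] by (auto simp: index_sets_def)
  have "exterior_map k wedge (signed_perm \<epsilon> \<sigma>) (eb I)
      = wedge (map (\<lambda>i. \<epsilon> i *\<^sub>R e (\<sigma> i)) (sorted_list_of_set I))"
  proof -
    have "length (map e (sorted_list_of_set I)) = k" using I' by simp
    from exterior_map_wedge[OF linear_signed_perm this]
    have "exterior_map k wedge (signed_perm \<epsilon> \<sigma>) (eb I)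
        = wedge (map (signed_perm \<epsilon> \<sigma>) (map e (sorted_list_of_set I)))"
      by (simp only: wedge_basis_def)
    also have "map (signed_perm \<epsilon> \<sigma>) (map e (sorted_list_of_set I))
        = map (\<lambda>i. \<epsilon> i *\<^sub>R e (\<sigma> i)) (sorted_list_of_set I)"
      unfolding map_map by (rule map_cong) (use I' in \<open>auto intro!: signed_perm_e simp: o_def\<close>)
    finally show ?thesis .
  qed
  also have "\<dots> = prod_list (map \<epsilon> (sorted_list_of_set I)) *\<^sub>R wedge (map (\<lambda>i. e (\<sigma> i)) (sorted_list_of_set I))"
    using alternating_form_scale[OF alternating_wedge, of "[]" "sorted_list_of_set I" \<epsilon> "\<lambda>i. e (\<sigma> i)"] I' by simp
  also have "prod_list (map \<epsilon> (sorted_list_of_set I)) = (\<Prod>i\<in>I. \<epsilon> i)"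
    using I' prod.distinct_set_conv_list[of "sorted_list_of_set I" \<epsilon>] by simp
  finally show ?thesis by (simp add: o_def)
qed

lemma permutes_index_sets:
  assumes "I \<in> index_sets" "\<sigma> permutes {1..N}"
  shows "\<sigma> ` I \<in> index_sets"
  using assms permutes_image[OF assms(2)] permutes_inj_on[OF assms(2), of I]
  by (auto simp: index_sets_def card_image)

text \<open>\<open>s\<close> merges two signs: the product of the \<epsilon> over \<open>I\<close>,
  and the sign incurred by sorting the permuted indices.\<close>

lemma exterior_map_signed_perm_eb_cases:
  assumes I: "I \<in> index_sets" and \<sigma>: "\<sigma> permutes {1..N}"
    and \<epsilon>: "\<And>i. i \<in> {1..N} \<Longrightarrow> \<epsilon> i \<in> {-1, 1}"
  obtains s where "s \<in> {-1, 1}" "exterior_map k wedge (signed_perm \<epsilon> \<sigma>) (eb I) = s *\<^sub>R eb (\<sigma> ` I)"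
proof -
  have I': "finite I" "I \<subseteq> {1..N}" "card I = k"
    using I finite_subset[of I "{1..N}"] by (auto simp: index_sets_def)
  have "(\<Prod>i\<in>J. \<epsilon> i) \<in> {-1, 1}" if "finite J" "J \<subseteq> {1..N}" for J
    using that
  proof (induction J)
    case (insert i J)
    then show ?case using \<epsilon>[of i] by auto
  qed simp
  then have s: "(\<Prod>i\<in>I. \<epsilon> i) \<in> {-1, 1}" using I' by blast
  have "wedge (map e (map \<sigma> (sorted_list_of_set I))) = eb (\<sigma> ` I)
      \<or> wedge (map e (map \<sigma> (sorted_list_of_set I))) = - eb (\<sigma> ` I)"
    using wedge_map_e[of "map \<sigma> (sorted_list_of_set I)"] I' permutes_inj_on[OF \<sigma>, of I]
    by (simp add: distinct_map)
  then obtain t where t: "t \<in> {-1, 1::real}"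
    "wedge (map e (map \<sigma> (sorted_list_of_set I))) = t *\<^sub>R eb (\<sigma> ` I)"
    by (metis insert_iff scaleR_minus1_left scaleR_one)
  show thesis
  proof (rule that)
    show "(\<Prod>i\<in>I. \<epsilon> i) * t \<in> {-1, 1}" using s t(1) by auto
    show "exterior_map k wedge (signed_perm \<epsilon> \<sigma>) (eb I) = ((\<Prod>i\<in>I. \<epsilon> i) * t) *\<^sub>R eb (\<sigma> ` I)"
      by (simp only: exterior_map_signed_perm_eb[OF I \<sigma>] t(2) scaleR_scaleR)
  qed
qed

lemma orthogonal_exterior_map_signed_perm:
  assumes \<sigma>: "\<sigma> permutes {1..N}" and \<epsilon>: "\<And>i. i \<in> {1..N} \<Longrightarrow> \<epsilon> i \<in> {-1, 1}"
  shows "orthogonal_transformation (exterior_map k wedge (signed_perm \<epsilon> \<sigma>))"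
proof (rule orthogonal_transformation_on_spanning_set[OF linear_exterior_map[OF linear_signed_perm] span_eb])
  fix x y assume "x \<in> eb ` index_sets" "y \<in> eb ` index_sets"
  then obtain I J where IJ: "x = eb I" "I \<in> index_sets" "y = eb J" "J \<in> index_sets" by auto
  obtain s where s: "s \<in> {-1, 1}" "exterior_map k wedge (signed_perm \<epsilon> \<sigma>) (eb I) = s *\<^sub>R eb (\<sigma> ` I)"
    using \<epsilon> by (rule exterior_map_signed_perm_eb_cases[OF IJ(2) \<sigma>])
  obtain t where t: "t \<in> {-1, 1}" "exterior_map k wedge (signed_perm \<epsilon> \<sigma>) (eb J) = t *\<^sub>R eb (\<sigma> ` J)"
    using \<epsilon> by (rule exterior_map_signed_perm_eb_cases[OF IJ(4) \<sigma>])
  \<comment> \<open>The signs were obtained separately, so their agreement on the same index set has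
    to be recovered from the images.\<close>
  have "s = t" if "I = J"
  proof -
    have "s *\<^sub>R eb (\<sigma> ` J) \<bullet> eb (\<sigma> ` J) = t *\<^sub>R eb (\<sigma> ` J) \<bullet> eb (\<sigma> ` J)"
      using s(2) t(2) IJ that by metis
    then show ?thesis using permutes_index_sets[OF IJ(4) \<sigma>] by (simp add: eb_inner)
  qed
  moreover have "\<sigma> ` I = \<sigma> ` J \<longleftrightarrow> I = J"
    using permutes_inj[OF \<sigma>] by (simp add: inj_image_eq_iff)
  ultimately show "exterior_map k wedge (signed_perm \<epsilon> \<sigma>) x \<bullet> exterior_map k wedge (signed_perm \<epsilon> \<sigma>) y = x \<bullet> y"
    using s t IJ permutes_index_sets[OF IJ(2) \<sigma>] permutes_index_sets[OF IJ(4) \<sigma>]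
    by (auto simp: eb_inner)
qed

text \<open>Commuting with these maps is the same as commuting with the group they generate, so only
  generators are listed. For \<open>i\<close> outside \<open>{1..N}\<close> the map
  \<open>flip i\<close> is the identity.\<close>

definition symmetries :: "('e \<Rightarrow>\<^sub>L 'e) set" where
  "symmetries = {Q. (\<exists>i. blinfun_apply Q = exterior_map k wedge (flip i)) \<or>
    (\<exists>\<sigma>. \<sigma> permutes {1..N} \<and> blinfun_apply Q = exterior_map k wedge (perm \<sigma>))}"

lemma symmetries_orthogonal:
  "Q \<in> symmetries \<Longrightarrow> orthogonal_transformation (blinfun_apply Q)"
  unfolding symmetries_def
  by (auto intro!: orthogonal_exterior_map_signed_perm simp: permutes_id)

text \<open>\<open>pn_exterior_map\<close> asks for an isometric left inverse: a sign change inverts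
  itself, and a permutation of the basis is undone by the inverse permutation.\<close>

lemma symmetries_isometric:
  assumes "Q \<in> symmetries"
  shows "pn (blinfun_apply Q x) = pn x"
proof -
  consider i where "blinfun_apply Q = exterior_map k wedge (flip i)"
    | \<sigma> where "\<sigma> permutes {1..N}" "blinfun_apply Q = exterior_map k wedge (perm \<sigma>)"
    using assms by (auto simp: symmetries_def)
  then show ?thesis
  proof cases
    case (1 i)
    have "norm (flip i x) = norm x" for x
      by (intro norm_signed_perm) (auto simp: permutes_id)
    moreover have "flip i (flip i x) = x" for x
      using linear_eq_on_e[OF linear_compose[OF linear_signed_perm linear_signed_perm] linear_ident]
      by (auto simp: signed_perm_e linear_scale[OF linear_signed_perm])
    ultimately show ?thesis
      unfolding 1 by (intro pn_exterior_map[where Q' = "flip i"] linear_signed_perm)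
  next
    case (2 \<sigma>)
    have inv: "inv \<sigma> permutes {1..N}" using 2(1) by (rule permutes_inv)
    have "perm (inv \<sigma>) (perm \<sigma> x) = x" for x
      using linear_eq_on_e[OF linear_compose[OF linear_signed_perm linear_signed_perm] linear_ident]
        permutes_in_image[OF 2(1)] permutes_inverses(2)[OF 2(1)]
      by (auto simp: signed_perm_e)
    then show ?thesis
      unfolding 2(2) using 2(1) inv
      by (intro pn_exterior_map[where Q' = "perm (inv \<sigma>)"] linear_signed_perm norm_signed_perm) auto
  qed
qed

lemma commutant_symmetries: "commutant symmetries \<subseteq> range (\<lambda>c::real. c *\<^sub>R id_blinfun)"
proof
  fix R assume R: "R \<in> commutant symmetries"
  have comm: "blinfun_apply R (exterior_map k wedge (signed_perm \<epsilon> \<sigma>) x)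
      = exterior_map k wedge (signed_perm \<epsilon> \<sigma>) (blinfun_apply R x)"
    if "(\<exists>i. signed_perm \<epsilon> \<sigma> = flip i) \<or> (\<sigma> permutes {1..N} \<and> signed_perm \<epsilon> \<sigma> = perm \<sigma>)" for \<epsilon> \<sigma> x
  proof -
    define Q where "Q = Blinfun (exterior_map k wedge (signed_perm \<epsilon> \<sigma>))"
    have Q: "blinfun_apply Q = exterior_map k wedge (signed_perm \<epsilon> \<sigma>)"
      using linear_exterior_map[OF linear_signed_perm]
      by (simp add: Q_def bounded_linear_Blinfun_apply linear_conv_bounded_linear)
    then have "Q \<in> symmetries" using that unfolding symmetries_def by auto
    then have "R o\<^sub>L Q = Q o\<^sub>L R" using R by (auto simp: commutant_def)
    then have "blinfun_apply (R o\<^sub>L Q) x = blinfun_apply (Q o\<^sub>L R) x" by simp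
    then show ?thesis by (simp add: Q)
  qed
  have off_diagonal: "blinfun_apply R (eb I) \<bullet> eb J = 0"
    if I: "I \<in> index_sets" and J: "J \<in> index_sets" and "I \<noteq> J" for I J
  proof -
    have fin: "finite I" "finite J" using I J finite_subset[of _ "{1..N}"] by (auto simp: index_sets_def)
    \<comment> \<open>Two different sets of equal size cannot be nested, so some sign change tells
      them apart.\<close>
    have "\<not> I \<subseteq> J" using card_subset_eq[OF fin(2)] I J \<open>I \<noteq> J\<close> by (auto simp: index_sets_def)
    then obtain i where i: "i \<in> I" "i \<notin> J" by blast
    let ?D = "exterior_map k wedge (flip i)"
    have D: "?D (eb K) = (if i \<in> K then - eb K else eb K)" if "K \<in> index_sets" for K
    proof -
      have "finite K" using that finite_subset[of _ "{1..N}"] by (auto simp: index_sets_def)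
      then have "(\<Prod>j\<in>K. if j = i then -1 else 1 :: real) = (if i \<in> K then -1 else 1)"
        by (simp add: prod.delta)
      then show ?thesis
        using exterior_map_signed_perm_eb[OF that permutes_id, of "\<lambda>j. if j = i then -1 else 1"]
        by (simp add: wedge_basis_def)
    qed
    \<comment> \<open>\<open>?D\<close> negates \<open>eb I\<close>, fixes \<open>eb J\<close>,
      preserves inner products and commutes with \<open>R\<close>; the matrix entry therefore equals
      its own negative.\<close>
    have "orthogonal_transformation ?D"
      by (intro orthogonal_exterior_map_signed_perm) (auto simp: permutes_id)
    then have "blinfun_apply R (eb I) \<bullet> eb J = ?D (blinfun_apply R (eb I)) \<bullet> ?D (eb J)"
      by (simp add: orthogonal_transformation_def)
    also have "\<dots> = blinfun_apply R (?D (eb I)) \<bullet> ?D (eb J)"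
      by (subst comm) auto
    also have "\<dots> = - (blinfun_apply R (eb I) \<bullet> eb J)"
      using D[OF I] D[OF J] i by (simp add: blinfun.minus_right)
    finally show ?thesis by simp
  qed
  define c where "c I = blinfun_apply R (eb I) \<bullet> eb I" for I
  have diagonal: "blinfun_apply R (eb I) = c I *\<^sub>R eb I" if "I \<in> index_sets" for I
    by (rule eq_on_eb) (use off_diagonal that in \<open>auto simp: c_def eb_inner\<close>)
  have const: "c I = c J" if I: "I \<in> index_sets" and J: "J \<in> index_sets" for I J
  proof -
    obtain \<sigma> where \<sigma>: "\<sigma> permutes {1..N}" "\<sigma> ` I = J"
      using permutation_moving_subset[of "{1..N}" I J] I J by (auto simp: index_sets_def)
    let ?P = "exterior_map k wedge (perm \<sigma>)"
    obtain s where s: "s \<in> {-1, 1}" "?P (eb I) = s *\<^sub>R eb J"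
      using exterior_map_signed_perm_eb_cases[OF I \<sigma>(1), of "\<lambda>_. 1"] \<sigma>(2) by auto
    have "s *\<^sub>R c J *\<^sub>R eb J = blinfun_apply R (?P (eb I))"
      by (simp add: s(2) blinfun.scaleR_right diagonal[OF J])
    also have "\<dots> = ?P (blinfun_apply R (eb I))" using \<sigma>(1) by (subst comm) auto
    also have "\<dots> = c I *\<^sub>R s *\<^sub>R eb J"
      by (simp add: diagonal[OF I] linear_scale[OF linear_exterior_map[OF linear_signed_perm]] s(2))
    finally have "s *\<^sub>R c J *\<^sub>R eb J = c I *\<^sub>R s *\<^sub>R eb J" .
    moreover have "eb J \<noteq> 0" using eb_inner[OF J J] by auto
    ultimately show ?thesis using s(1) by auto
  qed
  \<comment> \<open>A reference index set for the common diagonal entry; k \<le> N guarantees that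
    this one is available.\<close>
  have I0: "{1..k} \<in> index_sets" using k by (auto simp: index_sets_def)
  have "blinfun_apply R x = blinfun_apply (c {1..k} *\<^sub>R id_blinfun) x" for x
  proof (rule linear_eq_on_span[OF bounded_linear.linear[OF blinfun.bounded_linear_right]
        bounded_linear.linear[OF blinfun.bounded_linear_right]])
    show "x \<in> span (eb ` index_sets)" unfolding span_eb by simp
    fix y assume "y \<in> eb ` index_sets"
    then obtain I where I: "I \<in> index_sets" "y = eb I" by blast
    show "blinfun_apply R y = blinfun_apply (c {1..k} *\<^sub>R id_blinfun) y"
      using diagonal[OF I(1)] const[OF I0 I(1)] by (simp add: I(2) blinfun.scaleR_left)
  qed
  then have "R = c {1..k} *\<^sub>R id_blinfun" by (intro blinfun_eqI)
  then show "R \<in> range (\<lambda>c::real. c *\<^sub>R id_blinfun)" by blast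
qed

end

theorem theorem3:
  shows
    "(\<forall>(p :: 'v::euclidean_space \<Rightarrow> real) (G :: ('v \<Rightarrow>\<^sub>L 'v) set) (sharp :: 'v \<Rightarrow> 'v \<Rightarrow>\<^sub>L real).
        is_norm p \<and>
        compact_isometry_group p G \<and>
        (\<forall>Q\<in>G. orthogonal_transformation (blinfun_apply Q)) \<and>
        commutant G = range (\<lambda>c::real. c *\<^sub>R id_blinfun) \<and>
        (AE w in hypersurface_measure p. norming_functional p w (sharp w))
        \<longrightarrow>
        integrable (hypersurface_measure p) (\<lambda>w. rank_one w (sharp w)) \<and>
        real DIM('v) *\<^sub>R (\<integral>w. rank_one w (sharp w) \<partial>hypersurface_measure p) = id_blinfun)
     \<and>
     (\<forall>(N::nat) (k::nat) (e :: nat \<Rightarrow> 'x::real_normed_vector)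
        (wedge :: 'x list \<Rightarrow> 'e::euclidean_space) (sharp :: 'e \<Rightarrow> 'e \<Rightarrow>\<^sub>L real) (A :: 'x \<Rightarrow> 'x).
        one_symmetric_basis N e \<and>
        1 \<le> k \<and> k \<le> N \<and>
        exterior_power k wedge \<and>
        (\<forall>I J. I \<subseteq> {1..N} \<and> J \<subseteq> {1..N} \<and> card I = k \<and> card J = k \<longrightarrow>
           wedge_basis wedge e I \<bullet> wedge_basis wedge e J = (if I = J then 1 else 0)) \<and>
        (AE w in hypersurface_measure (projective_exterior_norm k wedge).
           norming_functional (projective_exterior_norm k wedge) w (sharp w)) \<and>
        linear A
        \<longrightarrow>
        integrable (hypersurface_measure (projective_exterior_norm k wedge))
          (\<lambda>w. blinfun_apply (sharp w) (exterior_map k wedge A w)) \<and>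
        operator_trace (exterior_map k wedge A) =
          real (N choose k) *
          (\<integral>w. blinfun_apply (sharp w) (exterior_map k wedge A w)
             \<partial>hypersurface_measure (projective_exterior_norm k wedge)))"
proof (intro conjI allI impI; elim conjE)
  fix p :: "'v \<Rightarrow> real" and G :: "('v \<Rightarrow>\<^sub>L 'v) set" and sharp :: "'v \<Rightarrow> 'v \<Rightarrow>\<^sub>L real"
  assume p: "is_norm p" and G: "compact_isometry_group p G"
    "\<forall>Q\<in>G. orthogonal_transformation (blinfun_apply Q)"
    "commutant G = range (\<lambda>c::real. c *\<^sub>R id_blinfun)"
    and sharp: "AE w in hypersurface_measure p. norming_functional p w (sharp w)"
  interpret norm_on_euclidean p by unfold_locales (rule p)
  show "integrable (hypersurface_measure p) (\<lambda>w. rank_one w (sharp w))"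
    by (rule integrable_rank_one_sharp[OF sharp])
  show "real DIM('v) *\<^sub>R (\<integral>w. rank_one w (sharp w) \<partial>hypersurface_measure p) = id_blinfun"
    by (rule integral_rank_one_sharp[OF sharp, of G]) (use G in \<open>auto simp: compact_isometry_group_def\<close>)
next
  fix N k :: nat and e :: "nat \<Rightarrow> 'x" and wedge :: "'x list \<Rightarrow> 'e"
    and sharp :: "'e \<Rightarrow> 'e \<Rightarrow>\<^sub>L real" and A :: "'x \<Rightarrow> 'x"
  let ?p = "projective_exterior_norm k wedge"
  assume e: "one_symmetric_basis N e" and k: "1 \<le> k" "k \<le> N" and wedge: "exterior_power k wedge"
    and on: "\<forall>I J. I \<subseteq> {1..N} \<and> J \<subseteq> {1..N} \<and> card I = k \<and> card J = k \<longrightarrow>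
      wedge_basis wedge e I \<bullet> wedge_basis wedge e J = (if I = J then 1 else 0)"
    and sharp: "AE w in hypersurface_measure ?p. norming_functional ?p w (sharp w)"
    and A: "linear A"
  interpret symmetric_exterior_power N k e wedge
    by unfold_locales (use e k wedge on in blast)+
  interpret norm_on_euclidean ?p by unfold_locales (rule is_norm_pn)
  note trace = trace_eq_integral[OF sharp symmetries_orthogonal symmetries_isometric
      commutant_symmetries linear_exterior_map[OF A]]
  show "integrable (hypersurface_measure ?p) (\<lambda>w. blinfun_apply (sharp w) (exterior_map k wedge A w))"
    by (rule trace(1))
  show "operator_trace (exterior_map k wedge A) = real (N choose k) *
      (\<integral>w. blinfun_apply (sharp w) (exterior_map k wedge A w) \<partial>hypersurface_measure ?p)"
    using trace(2) unfolding dim_exterior .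
qed

end
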